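(* Let $R=\mathbb{C}[\partial]V\neq 0$ be a left-symmetric conformal algebra which is free as a $\mathbb{C}[\partial]$-module, let $Q=\mathbb{C}[\partial]x$ be a free $\mathbb{C}[\partial]$-module of rank $1$, and let $E=R\oplus Q$ (direct sum of $\mathbb{C}[\partial]$-modules). Then: (1) $CExtd(E,R)\cong\mathcal{H}^2_R(Q,R)\cong\mathcal{FLC}(R)/\equiv$, where $\equiv$ is the equivalence relation on $\mathcal{FLC}(R)$ defined as follows: $$(h_\lambda(\cdot,\partial),k_\lambda(\cdot,\partial),D_\lambda,T_\lambda,M(\lambda,\partial),P(\lambda,\partial))\equiv(h'_\lambda(\cdot,\partial),k'_\lambda(\cdot,\partial),D'_\lambda,T'_\lambda,M'(\lambda,\partial),P'(\lambda,\partial))$$ if and only if $h_\lambda(\cdot,\partial)=h'_\lambda(\cdot,\partial)$, $k_\lambda(\cdot,\partial)=k'_\lambda(\cdot,\partial)$ and there exist $\omega\in R$ and $\beta\in\mathbb{C}\setminus\{0\}$ such that for all $a\in V$: $$D_\lambda(a)=\beta D'_\lambda(a)+\omega_\lambda a-k_{-\lambda-\partial}(a,\partial)\omega,$$ $$T_{-\lambda-\partial}(a)=\beta T'_{-\lambda-\partial}(a)+a_\lambda\omega-h_\lambda(a,\partial)\omega,$$ $$M(\lambda,\partial)=\omega_\lambda\omega+\beta^2M'(\lambda,\partial)+\beta T'_{-\lambda-\partial}(\omega)+\beta D'_\lambda(\omega)-P(\lambda,\partial)\omega,$$ $$P(\lambda,\partial)=k'_{-\lambda-\partial}(\omega,\partial)+h'_\lambda(\omega,\partial)+\beta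 P'(\lambda,\partial).$$ The bijection between $\mathcal{FLC}(R)/\equiv$ and $CExtd(E,R)$ is given by $$\overline{(h_\lambda,k_\lambda,D_\lambda,T_\lambda,M,P)}\mapsto LC(R,\mathbb{C}[\partial]x\,|\,h_\lambda(\cdot,\partial),k_\lambda(\cdot,\partial),D_\lambda,T_\lambda,M(\lambda,\partial),P(\lambda,\partial)).$$ (2) $CExtd'(E,R)\cong\mathcal{H}^2(Q,R)\cong\mathcal{FLC}(R)/\approx$, where $\approx$ is the equivalence relation on $\mathcal{FLC}(R)$ defined as follows: two flag datums $(h_\lambda,k_\lambda,D_\lambda,T_\lambda,M,P)$ and $(h'_\lambda,k'_\lambda,D'_\lambda,T'_\lambda,M',P')$ satisfy $\approx$ if and only if $h_\lambda(\cdot,\partial)=h'_\lambda(\cdot,\partial)$, $k_\lambda(\cdot,\partial)=k'_\lambda(\cdot,\partial)$ and there exists $\omega\in R$ such that the four displayed equations in (1) hold with $\beta=1$ for all $a\in V$. The bijection between $\mathcal{FLC}(R)/\approx$ and $CExtd'(E,R)$ is given by $$\overline{\overline{(h_\lambda,k_\lambda,D_\lambda,T_\lambda,M,P)}}\mapsto LC(R,\mathbb{C}[\partial]x\,|\,h_\lambda(\cdot,\partial),k_\lambda(\cdot,\partial),D_\lambda,T_\lambda,M(\lambda,\partial),P(\lambda,\partial)).$$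
   Context: All vector spaces are over $\mathbb{C}$; $V[\lambda]$ is the space of polynomials in $\lambda$ with coefficients in $V$. $R=\mathbb{C}[\partial]V$ means $R=\mathbb{C}[\partial]\otimes V$ for a vector space $V$. The symbol $\cong$ between these sets means a bijection. A left-symmetric conformal algebra is a $\mathbb{C}[\partial]$-module $R$ with a $\mathbb{C}$-bilinear map ($\lambda$-product) $R\times R\to R[\lambda]$, $(a,b)\mapsto a_\lambda b$, such that for all $a,b,c\in R$: $(\partial a)_\lambda b=-\lambda\, a_\lambda b$, $a_\lambda(\partial b)=(\partial+\lambda)a_\lambda b$, and $(a_\lambda b)_{\lambda+\mu}c-a_\lambda(b_\mu c)=(b_\mu a)_{\lambda+\mu}c-b_\mu(a_\lambda c)$. For $\mathbb{C}[\partial]$-modules $U,V,W$: a left conformal linear map $U\to V$ is a $\mathbb{C}$-linear $\varphi_\lambda:U\to V[\lambda]$ with $\varphi_\lambda(\partial a)=-\lambda\varphi_\lambda a$; a conformal linear map is a $\mathbb{C}$-linear $\psi_\lambda:U\to V[\lambda]$ with $\psi_\lambda(\partial a)=(\partial+\lambda)\psi_\lambda a$; a conformal bilinear map is a $\mathbb{C}$-bilinear $f_\lambda:U\times V\to W[\lambda]$ with $f_\lambda(\partial a,b)=-\lambda f_\lambda(a,b)$, $f_\lambda(a,\partial b)=(\lambda+\partial)f_\lambda(a,b)$. $Cend(V)$ is the space of conformal linear maps $V\to V$, a $\mathbb{C}[\partial]$-module via $(\partial\varphi)_\lambda=-\lambda\varphi_\lambda$. Conventions: all maps are extended linearly to coefficients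 polynomial in the formal variables; if $f_\nu=\sum_i\nu^if_i$ then $f_{-\lambda-\partial}v=\sum_i(-\lambda-\partial)^if_i(v)$, with $\partial$ acting from the left on the resulting element; a polynomial in $\mathbb{C}[\lambda,\mu,\partial]$ written in front of an element of $R[\lambda,\mu]$ acts on it via the module action of $\partial$. Extending structures: an extending datum of $R$ by $Q$ is $\Omega(R,Q)=(\varphi,\psi,l,r,g_\lambda,\circ_\lambda)$ with $\mathbb{C}[\partial]$-module homomorphisms $l,r:R\to Cend(Q)$, $\varphi,\psi:Q\to Cend(R)$ and conformal bilinear maps $g_\lambda:Q\times Q\to R[\lambda]$, $\circ_\lambda:Q\times Q\to Q[\lambda]$. It is a left-symmetric conformal extending structure if $R\natural Q:=R\oplus Q$ (as $\mathbb{C}[\partial]$-module) is a left-symmetric conformal algebra under $$(a+x)_\lambda(b+y)=\big(a_\lambda b+\varphi(x)_\lambda b+\psi(y)_{-\lambda-\partial}a+g_\lambda(x,y)\big)+\big(x\circ_\lambda y+l(a)_\lambda y+r(b)_{-\lambda-\partial}x\big).$$ $\mathfrak{L}(R,Q)$ is the set of these structures. $\Omega\equiv\Omega'$ if there are a $\mathbb{C}[\partial]$-module homomorphism $u:Q\to R$ and $v\in Aut_{\mathbb{C}[\partial]}(Q)$ such that for all $a\in R$, $x,y\in Q$: $\psi(x)_{-\lambda-\partial}a+u(l(a)_\lambda x)=a_\lambda u(x)+\psi'(v(x))_{-\lambda-\partial}a$; $v(l(a)_\lambda x)=l'(a)_\lambda v(x)$; $\varphi(x)_\lambda a+u(r(a)_{-\lambda-\partial}x)=u(x)_\lambda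 a+\varphi'(v(x))_\lambda a$; $v(r(a)_{-\lambda-\partial}x)=r'(a)_{-\lambda-\partial}v(x)$; $g_\lambda(x,y)+u(x\circ_\lambda y)=u(x)_\lambda u(y)+\varphi'(v(x))_\lambda u(y)+\psi'(v(y))_{-\lambda-\partial}u(x)+g'_\lambda(v(x),v(y))$; $v(x\circ_\lambda y)=r'(u(y))_{-\lambda-\partial}v(x)+l'(u(x))_\lambda v(y)+v(x)\circ'_\lambda v(y)$. $\Omega\approx\Omega'$ if this holds with $v=\mathrm{Id}$. $\mathcal{H}^2_R(Q,R):=\mathfrak{L}(R,Q)/\equiv$ and $\mathcal{H}^2(Q,R):=\mathfrak{L}(R,Q)/\approx$. $CExtd(E,R)$ (resp. $CExtd'(E,R)$): the set of left-symmetric conformal algebra structures on the $\mathbb{C}[\partial]$-module $E=R\oplus Q$ containing $R$ as a subalgebra, modulo isomorphisms $\phi:E\to E$ which stabilize $R$, i.e. $\phi|_R=\mathrm{id}_R$ (resp. which stabilize $R$ and co-stabilize $Q$, i.e. additionally $\pi\circ\phi=\pi$ for the canonical projection $\pi:E\to Q$). Flag datum of $R=\mathbb{C}[\partial]V$: a sextuple $(h_\lambda(\cdot,\partial),k_\lambda(\cdot,\partial),D_\lambda,T_\lambda,M(\lambda,\partial),P(\lambda,\partial))$ where $P(\lambda,\partial)\in\mathbb{C}[\lambda,\partial]$, $M(\lambda,\partial)\in R[\lambda]$, $h_\lambda(\cdot,\partial),k_\lambda(\cdot,\partial):R\to\mathbb{C}[\lambda,\partial]$ are left conformal linear maps, and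 $D_\lambda,T_\lambda:R\to R[\lambda]$ are conformal linear maps, satisfying for all $a,b\in V$: (1) $(D_\lambda(a)-T_\lambda(a))_{\lambda+\mu}b+(k_\mu(a,-\lambda-\mu)-h_\mu(a,-\lambda-\mu))D_{\lambda+\mu}(b)=D_\lambda(a_\mu b)-a_\mu(D_\lambda(b))-k_{-\lambda-\mu-\partial}(b,\mu+\partial)T_{-\mu-\partial}(a)$; (2) $(k_\mu(a,-\lambda-\mu)-h_\mu(a,-\lambda-\mu))k_{-\lambda-\mu-\partial}(b,\partial)=k_{-\lambda-\partial}(a_\mu b,\partial)-k_{-\lambda-\mu-\partial}(b,\mu+\partial)h_\mu(a,\partial)$; (3) $T_{-\lambda-\mu-\partial}(a_\lambda b-b_\mu a)=a_\lambda T_{-\mu-\partial}(b)-b_\mu T_{-\lambda-\partial}(a)+h_\mu(b,\lambda+\partial)T_{-\lambda-\partial}(a)-h_\lambda(a,\mu+\partial)T_{-\mu-\partial}(b)$; (4) $h_{\lambda+\mu}(a_\lambda b-b_\mu a,\partial)=h_\mu(b,\lambda+\partial)h_\lambda(a,\partial)-h_\lambda(a,\mu+\partial)h_\mu(b,\partial)$; (5) $T_{-\lambda-\mu-\partial}(T_\mu(a)-D_\mu(a))+h_\lambda(a,-\lambda-\mu)M(\lambda+\mu,\partial)-P(\mu,\lambda+\partial)T_{-\lambda-\partial}(a)-a_\lambda M(\mu,\partial)=k_\lambda(a,-\lambda-\mu)M(\lambda+\mu,\partial)-D_\mu(T_{-\lambda-\partial}(a))-h_\lambda(a,\mu+\partial)M(\mu,\partial)$;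 (6) $h_\lambda(a,-\lambda-\mu)P(\lambda+\mu,\partial)+h_{\lambda+\mu}(T_{-\lambda-\partial}(a),\partial)-P(\mu,\lambda+\partial)h_\lambda(a,\partial)=h_{\lambda+\mu}(D_\mu(a),\partial)+k_\lambda(a,-\lambda-\mu)P(\lambda+\mu,\partial)-k_{-\mu-\partial}(T_{-\lambda-\partial}(a),\partial)-h_\lambda(a,\mu+\partial)P(\mu,\partial)$; (7) $(M(\lambda,\partial)-M(\mu,\partial))_{\lambda+\mu}a+(P(\lambda,-\lambda-\mu)-P(\mu,-\lambda-\mu))D_{\lambda+\mu}(a)=D_\lambda(D_\mu(a))-D_\mu(D_\lambda(a))+k_{-\lambda-\mu-\partial}(a,\lambda+\partial)M(\lambda,\partial)-k_{-\lambda-\mu-\partial}(a,\mu+\partial)M(\mu,\partial)$; (8) $(P(\lambda,-\lambda-\mu)-P(\mu,-\lambda-\mu))k_{-\lambda-\mu-\partial}(a,\partial)=k_{-\lambda-\partial}(D_\mu(a),\partial)-k_{-\mu-\partial}(D_\lambda(a),\partial)+k_{-\lambda-\mu-\partial}(a,\lambda+\partial)P(\lambda,\partial)-k_{-\lambda-\mu-\partial}(a,\mu+\partial)P(\mu,\partial)$; (9) $T_{-\lambda-\mu-\partial}(M(\lambda,\partial)-M(\mu,\partial))+(P(\lambda,-\lambda-\mu)-P(\mu,-\lambda-\mu))M(\lambda+\mu,\partial)=D_\lambda(M(\mu,\partial))-D_\mu(M(\lambda,\partial))+P(\mu,\lambda+\partial)M(\lambda,\partial)-P(\lambda,\mu+\partial)M(\mu,\partial)$;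 (10) $h_{\lambda+\mu}(M(\lambda,\partial)-M(\mu,\partial),\partial)+(P(\lambda,-\lambda-\mu)-P(\mu,-\lambda-\mu))P(\lambda+\mu,\partial)=k_{-\lambda-\partial}(M(\mu,\partial),\partial)-k_{-\mu-\partial}(M(\lambda,\partial),\partial)+P(\mu,\lambda+\partial)P(\lambda,\partial)-P(\lambda,\mu+\partial)P(\mu,\partial)$. (In expressions such as $k_{-\lambda-\partial}(c,\partial)$ with $c\in R[\mu]$ or $c=T_{-\lambda-\partial}(a)\in R[\lambda]$, one first evaluates $k_\nu(c,\partial)$ by linearity, $\partial$ inside $c$ being the action on $R$, and then substitutes for $\nu$.) $\mathcal{FLC}(R)$ is the set of all flag datums of $R$. $LC(R,\mathbb{C}[\partial]x\,|\,h_\lambda(\cdot,\partial),k_\lambda(\cdot,\partial),D_\lambda,T_\lambda,M(\lambda,\partial),P(\lambda,\partial))$ is the left-symmetric conformal algebra on $R\oplus\mathbb{C}[\partial]x$ which extends the $\lambda$-product of $R$ and satisfies, for $a\in V$: $a_\lambda x=T_{-\lambda-\partial}(a)+h_\lambda(a,\partial)x$, $x_\lambda a=D_\lambda(a)+k_{-\lambda-\partial}(a,\partial)x$, $x_\lambda x=M(\lambda,\partial)+P(\lambda,\partial)x$. *)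

theory Defs
  imports Complex_Main "HOL-Library.Product_Plus" "HOL-Computational_Algebra.Polynomial"
begin

text \<open>
  A \<open>\<complex>[\<partial>]\<close>-module is a type of class \<^class>\<open>ab_group_add\<close> with a scalar multiplication \<open>s\<close>
  such that \<^term>\<open>module s\<close> holds, the ring \<open>\<complex>[\<partial>]\<close> being \<^typ>\<open>complex poly\<close>; its
  underlying complex vector space has the scalar multiplication \<open>\<lambda>c. s [:c:]\<close>.
  For a module \<open>M\<close> with elements of type \<open>'m\<close>, the polynomials over \<open>M\<close> are formal ones:
  \<^item> \<open>M[\<lambda>]\<close> is \<^typ>\<open>'m poly\<close>, a module over \<open>\<complex>[\<partial>][\<lambda>]\<close>, i.e. \<^typ>\<open>complex poly poly\<close>;
  \<^item> \<open>M[\<lambda>,\<mu>]\<close> is \<^typ>\<open>'m poly poly\<close> (outer variable \<open>\<mu>\<close>, inner variable \<open>\<lambda>\<close>), a module over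
    \<open>\<complex>[\<partial>][\<lambda>][\<mu>]\<close>, i.e. \<^typ>\<open>complex poly poly poly\<close>.
\<close>

definition pscale :: "('a::comm_ring_1 \<Rightarrow> 'm::ab_group_add \<Rightarrow> 'm) \<Rightarrow> 'a poly \<Rightarrow> 'm poly \<Rightarrow> 'm poly" where
  "pscale s p f = (\<Sum>i\<le>degree p. \<Sum>j\<le>degree f. monom (s (coeff p i) (coeff f j)) (i + j))"

abbreviation del0 :: "complex poly" where "del0 \<equiv> [:0, 1:]"

abbreviation del1 :: "complex poly poly" where "del1 \<equiv> [:del0:]"
abbreviation lam1 :: "complex poly poly" where "lam1 \<equiv> [:0, 1:]"

abbreviation del :: "complex poly poly poly" where "del \<equiv> [:[:del0:]:]"
abbreviation lam :: "complex poly poly poly" where "lam \<equiv> [:[:0, 1:]:]"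
abbreviation mu :: "complex poly poly poly" where "mu \<equiv> [:0, 1:]"

text \<open>\<open>f\<^bsub>-\<lambda>-\<partial>\<^esub> \<in> M[\<lambda>]\<close> for \<open>f \<in> M[\<nu>]\<close>.\<close>

definition reflect :: "(complex poly \<Rightarrow> 'm::ab_group_add \<Rightarrow> 'm) \<Rightarrow> 'm poly \<Rightarrow> 'm poly" where
  "reflect s f = (\<Sum>i\<le>degree f. pscale s ((- lam1 - del1) ^ i) [:coeff f i:])"

definition bscale ::
  "(complex poly \<Rightarrow> 'm::ab_group_add \<Rightarrow> 'm) \<Rightarrow> complex poly poly poly \<Rightarrow> 'm poly poly \<Rightarrow> 'm poly poly" where
  "bscale s = pscale (pscale s)"

text \<open>\<open>f\<^bsub>p\<^esub> \<in> M[\<lambda>,\<mu>]\<close> for \<open>f \<in> M[\<nu>]\<close> and \<open>p \<in> \<complex>[\<lambda>,\<mu>,\<partial>]\<close>, with \<open>\<partial>\<close> acting from the left.\<close>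

definition bsubst ::
  "(complex poly \<Rightarrow> 'm::ab_group_add \<Rightarrow> 'm) \<Rightarrow> complex poly poly poly \<Rightarrow> 'm poly \<Rightarrow> 'm poly poly" where
  "bsubst s p f = (\<Sum>i\<le>degree f. bscale s (p ^ i) [:[:coeff f i:]:])"

text \<open>The value \<open>F(p, q) \<in> \<complex>[\<lambda>,\<mu>,\<partial>]\<close> of \<open>F(\<nu>,\<partial>) \<in> \<complex>[\<partial>][\<nu>]\<close>.\<close>

definition psubst :: "complex poly poly \<Rightarrow> complex poly poly poly \<Rightarrow> complex poly poly poly \<Rightarrow> complex poly poly poly" where
  "psubst F p q = poly (map_poly (\<lambda>c. poly (map_poly (\<lambda>z. [:[:[:z:]:]:]) c) q) F) p"

text \<open>Linear extension of a map \<open>F : U \<rightarrow> M[\<lambda>,\<mu>]\<close> to a map \<open>U[\<lambda>,\<mu>] \<rightarrow> M[\<lambda>,\<mu>]\<close>.\<close>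

definition lin_ext ::
  "(complex poly \<Rightarrow> 'm::ab_group_add \<Rightarrow> 'm) \<Rightarrow> ('u::ab_group_add \<Rightarrow> 'm poly poly) \<Rightarrow> 'u poly poly \<Rightarrow> 'm poly poly" where
  "lin_ext s F u = (\<Sum>j\<le>degree u. \<Sum>i\<le>degree (coeff u j).
     bscale s (lam ^ i * mu ^ j) (F (coeff (coeff u j) i)))"

text \<open>\<open>f\<^bsub>p\<^esub>(u)\<close> and \<open>f\<^bsub>p\<^esub>(u, v)\<close>, the module \<open>s\<close> being the target of \<open>f\<close>.\<close>

definition capp ::
  "(complex poly \<Rightarrow> 'm::ab_group_add \<Rightarrow> 'm) \<Rightarrow> ('u::ab_group_add \<Rightarrow> 'm poly)
   \<Rightarrow> complex poly poly poly \<Rightarrow> 'u poly poly \<Rightarrow> 'm poly poly" where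
  "capp s f p u = lin_ext s (\<lambda>a. bsubst s p (f a)) u"

definition capp2 ::
  "(complex poly \<Rightarrow> 'm::ab_group_add \<Rightarrow> 'm) \<Rightarrow> ('u::ab_group_add \<Rightarrow> 'v::ab_group_add \<Rightarrow> 'm poly)
   \<Rightarrow> complex poly poly poly \<Rightarrow> 'u poly poly \<Rightarrow> 'v poly poly \<Rightarrow> 'm poly poly" where
  "capp2 s f p u v = lin_ext s (\<lambda>a. capp s (f a) p v) u"

text \<open>\<open>h\<^bsub>p\<^esub>(u, q)\<close> for \<open>h\<^bsub>\<nu>\<^esub>(\<sqdot>, \<partial>) : U \<rightarrow> \<complex>[\<partial>][\<nu>]\<close>: first \<open>h\<close> is applied to the coefficients of \<open>u\<close>,
  then \<open>p\<close> and \<open>q\<close> are substituted for \<open>\<nu>\<close> and \<open>\<partial>\<close>.\<close>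

definition happ ::
  "('u::ab_group_add \<Rightarrow> complex poly poly) \<Rightarrow> complex poly poly poly \<Rightarrow> 'u poly poly
   \<Rightarrow> complex poly poly poly \<Rightarrow> complex poly poly poly" where
  "happ h p u q = lin_ext (*) (\<lambda>a. psubst (h a) p q) u"

definition clinear ::
  "(complex poly \<Rightarrow> 'u::ab_group_add \<Rightarrow> 'u) \<Rightarrow> (complex poly \<Rightarrow> 'w::ab_group_add \<Rightarrow> 'w)
   \<Rightarrow> ('u \<Rightarrow> 'w poly) \<Rightarrow> bool" where
  "clinear s t f \<longleftrightarrow> module_hom (\<lambda>c. s [:c:]) (\<lambda>c. pscale t [:[:c:]:]) f"

definition left_conformal_linear ::
  "(complex poly \<Rightarrow> 'u::ab_group_add \<Rightarrow> 'u) \<Rightarrow> (complex poly \<Rightarrow> 'w::ab_group_add \<Rightarrow> 'w)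
   \<Rightarrow> ('u \<Rightarrow> 'w poly) \<Rightarrow> bool" where
  "left_conformal_linear s t f \<longleftrightarrow>
     clinear s t f \<and> (\<forall>a. f (s del0 a) = pscale t (- lam1) (f a))"

definition conformal_linear ::
  "(complex poly \<Rightarrow> 'u::ab_group_add \<Rightarrow> 'u) \<Rightarrow> (complex poly \<Rightarrow> 'w::ab_group_add \<Rightarrow> 'w)
   \<Rightarrow> ('u \<Rightarrow> 'w poly) \<Rightarrow> bool" where
  "conformal_linear s t f \<longleftrightarrow>
     clinear s t f \<and> (\<forall>a. f (s del0 a) = pscale t (del1 + lam1) (f a))"

definition conformal_bilinear ::
  "(complex poly \<Rightarrow> 'u::ab_group_add \<Rightarrow> 'u) \<Rightarrow> (complex poly \<Rightarrow> 'v::ab_group_add \<Rightarrow> 'v)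
   \<Rightarrow> (complex poly \<Rightarrow> 'w::ab_group_add \<Rightarrow> 'w) \<Rightarrow> ('u \<Rightarrow> 'v \<Rightarrow> 'w poly) \<Rightarrow> bool" where
  "conformal_bilinear s s' t f \<longleftrightarrow>
     (\<forall>b. left_conformal_linear s t (\<lambda>a. f a b)) \<and> (\<forall>a. conformal_linear s' t (f a))"

definition lsc_algebra ::
  "(complex poly \<Rightarrow> 'r::ab_group_add \<Rightarrow> 'r) \<Rightarrow> ('r \<Rightarrow> 'r \<Rightarrow> 'r poly) \<Rightarrow> bool" where
  "lsc_algebra s pr \<longleftrightarrow> module s \<and> conformal_bilinear s s s pr \<and>
     (\<forall>a b c. let a' = [:[:a:]:]; b' = [:[:b:]:]; c' = [:[:c:]:] in
        capp2 s pr (lam + mu) (capp2 s pr lam a' b') c' - capp2 s pr lam a' (capp2 s pr mu b' c')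
      = capp2 s pr (lam + mu) (capp2 s pr mu b' a') c' - capp2 s pr mu b' (capp2 s pr lam a' c'))"

text \<open>\<open>R = \<complex>[\<partial>]V\<close>: the canonical map \<open>\<complex>[\<partial>] \<otimes> V = V[\<partial>] \<rightarrow> R\<close> is bijective for the complex subspace \<open>V\<close>.\<close>

definition freely_generated_by :: "(complex poly \<Rightarrow> 'r::ab_group_add \<Rightarrow> 'r) \<Rightarrow> 'r set \<Rightarrow> bool" where
  "freely_generated_by s V \<longleftrightarrow> module s \<and> module.subspace (\<lambda>c. s [:c:]) V \<and>
     bij_betw (\<lambda>f. \<Sum>i\<le>degree f. s (del0 ^ i) (coeff f i)) {f. \<forall>i. coeff f i \<in> V} UNIV"

definition free_rank_one :: "(complex poly \<Rightarrow> 'q::ab_group_add \<Rightarrow> 'q) \<Rightarrow> 'q \<Rightarrow> bool" where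
  "free_rank_one s x \<longleftrightarrow> module s \<and> \<not> module.dependent s {x} \<and> module.span s {x} = UNIV"

definition sum_scale ::
  "(complex poly \<Rightarrow> 'r::ab_group_add \<Rightarrow> 'r) \<Rightarrow> (complex poly \<Rightarrow> 'q::ab_group_add \<Rightarrow> 'q)
   \<Rightarrow> complex poly \<Rightarrow> 'r \<times> 'q \<Rightarrow> 'r \<times> 'q" where
  "sum_scale sR sQ p e = (sR p (fst e), sQ p (snd e))"

definition inR :: "'r::ab_group_add poly \<Rightarrow> ('r \<times> 'q::ab_group_add) poly" where
  "inR = map_poly (\<lambda>a. (a, 0))"

definition inQ :: "'q::ab_group_add poly \<Rightarrow> ('r::ab_group_add \<times> 'q) poly" where
  "inQ = map_poly (\<lambda>y. (0, y))"

definition extensions ::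
  "(complex poly \<Rightarrow> 'r::ab_group_add \<Rightarrow> 'r) \<Rightarrow> ('r \<Rightarrow> 'r \<Rightarrow> 'r poly) \<Rightarrow> (complex poly \<Rightarrow> 'q::ab_group_add \<Rightarrow> 'q)
   \<Rightarrow> ('r \<times> 'q \<Rightarrow> 'r \<times> 'q \<Rightarrow> ('r \<times> 'q) poly) set" where
  "extensions sR pr sQ =
     {m. lsc_algebra (sum_scale sR sQ) m \<and> (\<forall>a b. m (a, 0) (b, 0) = inR (pr a b))}"

definition stabilizing_iso ::
  "(complex poly \<Rightarrow> 'r::ab_group_add \<Rightarrow> 'r) \<Rightarrow> (complex poly \<Rightarrow> 'q::ab_group_add \<Rightarrow> 'q)
   \<Rightarrow> ('r \<times> 'q \<Rightarrow> 'r \<times> 'q \<Rightarrow> ('r \<times> 'q) poly) \<Rightarrow> ('r \<times> 'q \<Rightarrow> 'r \<times> 'q \<Rightarrow> ('r \<times> 'q) poly)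
   \<Rightarrow> ('r \<times> 'q \<Rightarrow> 'r \<times> 'q) \<Rightarrow> bool" where
  "stabilizing_iso sR sQ m m' \<phi> \<longleftrightarrow>
     module_hom (sum_scale sR sQ) (sum_scale sR sQ) \<phi> \<and> bij \<phi> \<and>
     (\<forall>e f. map_poly \<phi> (m e f) = m' (\<phi> e) (\<phi> f)) \<and> (\<forall>a. \<phi> (a, 0) = (a, 0))"

definition cext_eq where
  "cext_eq sR pr sQ = {(m, m'). m \<in> extensions sR pr sQ \<and> m' \<in> extensions sR pr sQ \<and>
     (\<exists>\<phi>. stabilizing_iso sR sQ m m' \<phi>)}"

definition cext_approx where
  "cext_approx sR pr sQ = {(m, m'). m \<in> extensions sR pr sQ \<and> m' \<in> extensions sR pr sQ \<and>
     (\<exists>\<phi>. stabilizing_iso sR sQ m m' \<phi> \<and> snd \<circ> \<phi> = snd)}"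

definition CExtd where
  "CExtd sR pr sQ = extensions sR pr sQ // cext_eq sR pr sQ"

definition CExtd' where
  "CExtd' sR pr sQ = extensions sR pr sQ // cext_approx sR pr sQ"

record (overloaded) ('r::zero, 'q::zero) ext_datum =
  e_phi :: "'q \<Rightarrow> 'r \<Rightarrow> 'r poly"
  e_psi :: "'q \<Rightarrow> 'r \<Rightarrow> 'r poly"
  e_l :: "'r \<Rightarrow> 'q \<Rightarrow> 'q poly"
  e_r :: "'r \<Rightarrow> 'q \<Rightarrow> 'q poly"
  e_g :: "'q \<Rightarrow> 'q \<Rightarrow> 'r poly"
  e_circ :: "'q \<Rightarrow> 'q \<Rightarrow> 'q poly"

text \<open>\<open>\<complex>[\<partial>]\<close>-module homomorphisms \<open>F : U \<rightarrow> Cend(W)\<close>, where \<open>(\<partial>\<phi>)\<^bsub>\<lambda>\<^esub> = -\<lambda> \<phi>\<^bsub>\<lambda>\<^esub>\<close> in \<open>Cend(W)\<close>.\<close>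

definition hom_to_Cend ::
  "(complex poly \<Rightarrow> 'u::ab_group_add \<Rightarrow> 'u) \<Rightarrow> (complex poly \<Rightarrow> 'w::ab_group_add \<Rightarrow> 'w)
   \<Rightarrow> ('u \<Rightarrow> 'w \<Rightarrow> 'w poly) \<Rightarrow> bool" where
  "hom_to_Cend s t F \<longleftrightarrow> (\<forall>a. conformal_linear t t (F a)) \<and>
     (\<forall>a b w. F (a + b) w = F a w + F b w) \<and>
     (\<forall>c a w. F (s [:c:] a) w = pscale t [:[:c:]:] (F a w)) \<and>
     (\<forall>a w. F (s del0 a) w = pscale t (- lam1) (F a w))"

definition extending_datum ::
  "(complex poly \<Rightarrow> 'r::ab_group_add \<Rightarrow> 'r) \<Rightarrow> (complex poly \<Rightarrow> 'q::ab_group_add \<Rightarrow> 'q)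
   \<Rightarrow> ('r, 'q) ext_datum \<Rightarrow> bool" where
  "extending_datum sR sQ \<Omega> \<longleftrightarrow>
     hom_to_Cend sR sQ (e_l \<Omega>) \<and> hom_to_Cend sR sQ (e_r \<Omega>) \<and>
     hom_to_Cend sQ sR (e_phi \<Omega>) \<and> hom_to_Cend sQ sR (e_psi \<Omega>) \<and>
     conformal_bilinear sQ sQ sR (e_g \<Omega>) \<and> conformal_bilinear sQ sQ sQ (e_circ \<Omega>)"

definition natural_prod ::
  "(complex poly \<Rightarrow> 'r::ab_group_add \<Rightarrow> 'r) \<Rightarrow> ('r \<Rightarrow> 'r \<Rightarrow> 'r poly) \<Rightarrow> (complex poly \<Rightarrow> 'q::ab_group_add \<Rightarrow> 'q)
   \<Rightarrow> ('r, 'q) ext_datum \<Rightarrow> 'r \<times> 'q \<Rightarrow> 'r \<times> 'q \<Rightarrow> ('r \<times> 'q) poly" where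
  "natural_prod sR pr sQ \<Omega> e f = (let a = fst e; x = snd e; b = fst f; y = snd f in
     inR (pr a b + e_phi \<Omega> x b + reflect sR (e_psi \<Omega> y a) + e_g \<Omega> x y)
   + inQ (e_circ \<Omega> x y + e_l \<Omega> a y + reflect sQ (e_r \<Omega> b x)))"

definition ext_structures ::
  "(complex poly \<Rightarrow> 'r::ab_group_add \<Rightarrow> 'r) \<Rightarrow> ('r \<Rightarrow> 'r \<Rightarrow> 'r poly) \<Rightarrow> (complex poly \<Rightarrow> 'q::ab_group_add \<Rightarrow> 'q)
   \<Rightarrow> ('r, 'q) ext_datum set" where
  "ext_structures sR pr sQ =
     {\<Omega>. extending_datum sR sQ \<Omega> \<and> lsc_algebra (sum_scale sR sQ) (natural_prod sR pr sQ \<Omega>)}"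

definition ext_equiv_via ::
  "(complex poly \<Rightarrow> 'r::ab_group_add \<Rightarrow> 'r) \<Rightarrow> ('r \<Rightarrow> 'r \<Rightarrow> 'r poly) \<Rightarrow> (complex poly \<Rightarrow> 'q::ab_group_add \<Rightarrow> 'q)
   \<Rightarrow> ('r, 'q) ext_datum \<Rightarrow> ('r, 'q) ext_datum \<Rightarrow> ('q \<Rightarrow> 'r) \<Rightarrow> ('q \<Rightarrow> 'q) \<Rightarrow> bool" where
  "ext_equiv_via sR pr sQ \<Omega> \<Omega>' u v \<longleftrightarrow>
     module_hom sQ sR u \<and> module_hom sQ sQ v \<and> bij v \<and>
     (\<forall>a x. reflect sR (e_psi \<Omega> x a) + map_poly u (e_l \<Omega> a x)
          = pr a (u x) + reflect sR (e_psi \<Omega>' (v x) a)) \<and>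
     (\<forall>a x. map_poly v (e_l \<Omega> a x) = e_l \<Omega>' a (v x)) \<and>
     (\<forall>a x. e_phi \<Omega> x a + map_poly u (reflect sQ (e_r \<Omega> a x))
          = pr (u x) a + e_phi \<Omega>' (v x) a) \<and>
     (\<forall>a x. map_poly v (reflect sQ (e_r \<Omega> a x)) = reflect sQ (e_r \<Omega>' a (v x))) \<and>
     (\<forall>x y. e_g \<Omega> x y + map_poly u (e_circ \<Omega> x y)
          = pr (u x) (u y) + e_phi \<Omega>' (v x) (u y) + reflect sR (e_psi \<Omega>' (v y) (u x))
            + e_g \<Omega>' (v x) (v y)) \<and>
     (\<forall>x y. map_poly v (e_circ \<Omega> x y)
          = reflect sQ (e_r \<Omega>' (u y) (v x)) + e_l \<Omega>' (u x) (v y) + e_circ \<Omega>' (v x) (v y))"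

definition ext_eq where
  "ext_eq sR pr sQ = {(\<Omega>, \<Omega>'). \<Omega> \<in> ext_structures sR pr sQ \<and> \<Omega>' \<in> ext_structures sR pr sQ \<and>
     (\<exists>u v. ext_equiv_via sR pr sQ \<Omega> \<Omega>' u v)}"

definition ext_approx where
  "ext_approx sR pr sQ = {(\<Omega>, \<Omega>'). \<Omega> \<in> ext_structures sR pr sQ \<and> \<Omega>' \<in> ext_structures sR pr sQ \<and>
     (\<exists>u. ext_equiv_via sR pr sQ \<Omega> \<Omega>' u id)}"

definition H2R where
  "H2R sR pr sQ = ext_structures sR pr sQ // ext_eq sR pr sQ"

definition H2 where
  "H2 sR pr sQ = ext_structures sR pr sQ // ext_approx sR pr sQ"

text \<open>In \<open>\<complex>[\<lambda>,\<partial>]\<close>, represented by \<^typ>\<open>complex poly poly\<close>, the outer variable is \<open>\<lambda>\<close>.\<close>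

record (overloaded) ('r::zero) flag =
  f_h :: "'r \<Rightarrow> complex poly poly"
  f_k :: "'r \<Rightarrow> complex poly poly"
  f_D :: "'r \<Rightarrow> 'r poly"
  f_T :: "'r \<Rightarrow> 'r poly"
  f_M :: "'r poly"
  f_P :: "complex poly poly"

text \<open>All the equations hold in \<open>R[\<lambda>,\<mu>]\<close> or \<open>\<complex>[\<lambda>,\<mu>,\<partial>]\<close>; \<open>h p u q\<close> stands for \<open>h\<^bsub>p\<^esub>(u, q)\<close>,
  \<open>act p u\<close> for the module action, and \<open>prd p u v\<close> for \<open>u\<^bsub>p\<^esub> v\<close>.\<close>

definition flag_equations ::
  "(complex poly \<Rightarrow> 'r::ab_group_add \<Rightarrow> 'r) \<Rightarrow> ('r \<Rightarrow> 'r \<Rightarrow> 'r poly) \<Rightarrow> 'r flag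
   \<Rightarrow> 'r poly poly \<Rightarrow> 'r poly poly \<Rightarrow> bool" where
  "flag_equations sR pr d a b \<longleftrightarrow> (let
     act = bscale sR; prd = capp2 sR pr;
     h = happ (f_h d); k = happ (f_k d); D = capp sR (f_D d); T = capp sR (f_T d);
     M = (\<lambda>p. bsubst sR p (f_M d)); P = psubst (f_P d)
   in
     prd (lam + mu) (D lam a - T lam a) b
       + act (k mu a (- lam - mu) - h mu a (- lam - mu)) (D (lam + mu) b)
     = D lam (prd mu a b) - prd mu a (D lam b)
       - act (k (- lam - mu - del) b (mu + del)) (T (- mu - del) a)
   \<and>
     (k mu a (- lam - mu) - h mu a (- lam - mu)) * k (- lam - mu - del) b del
     = k (- lam - del) (prd mu a b) del - k (- lam - mu - del) b (mu + del) * h mu a del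
   \<and>
     T (- lam - mu - del) (prd lam a b - prd mu b a)
     = prd lam a (T (- mu - del) b) - prd mu b (T (- lam - del) a)
       + act (h mu b (lam + del)) (T (- lam - del) a) - act (h lam a (mu + del)) (T (- mu - del) b)
   \<and>
     h (lam + mu) (prd lam a b - prd mu b a) del
     = h mu b (lam + del) * h lam a del - h lam a (mu + del) * h mu b del
   \<and>
     T (- lam - mu - del) (T mu a - D mu a) + act (h lam a (- lam - mu)) (M (lam + mu))
       - act (P mu (lam + del)) (T (- lam - del) a) - prd lam a (M mu)
     = act (k lam a (- lam - mu)) (M (lam + mu)) - D mu (T (- lam - del) a)
       - act (h lam a (mu + del)) (M mu)
   \<and>
     h lam a (- lam - mu) * P (lam + mu) del + h (lam + mu) (T (- lam - del) a) del
       - P mu (lam + del) * h lam a del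
     = h (lam + mu) (D mu a) del + k lam a (- lam - mu) * P (lam + mu) del
       - k (- mu - del) (T (- lam - del) a) del - h lam a (mu + del) * P mu del
   \<and>
     prd (lam + mu) (M lam - M mu) a
       + act (P lam (- lam - mu) - P mu (- lam - mu)) (D (lam + mu) a)
     = D lam (D mu a) - D mu (D lam a)
       + act (k (- lam - mu - del) a (lam + del)) (M lam)
       - act (k (- lam - mu - del) a (mu + del)) (M mu)
   \<and>
     (P lam (- lam - mu) - P mu (- lam - mu)) * k (- lam - mu - del) a del
     = k (- lam - del) (D mu a) del - k (- mu - del) (D lam a) del
       + k (- lam - mu - del) a (lam + del) * P lam del
       - k (- lam - mu - del) a (mu + del) * P mu del
   \<and>
     T (- lam - mu - del) (M lam - M mu)
       + act (P lam (- lam - mu) - P mu (- lam - mu)) (M (lam + mu))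
     = D lam (M mu) - D mu (M lam)
       + act (P mu (lam + del)) (M lam) - act (P lam (mu + del)) (M mu)
   \<and>
     h (lam + mu) (M lam - M mu) del
       + (P lam (- lam - mu) - P mu (- lam - mu)) * P (lam + mu) del
     = k (- lam - del) (M mu) del - k (- mu - del) (M lam) del
       + P mu (lam + del) * P lam del - P lam (mu + del) * P mu del)"

definition FLC ::
  "(complex poly \<Rightarrow> 'r::ab_group_add \<Rightarrow> 'r) \<Rightarrow> ('r \<Rightarrow> 'r \<Rightarrow> 'r poly) \<Rightarrow> 'r set \<Rightarrow> 'r flag set" where
  "FLC sR pr V = {d.
     left_conformal_linear sR (*) (f_h d) \<and> left_conformal_linear sR (*) (f_k d) \<and>
     conformal_linear sR sR (f_D d) \<and> conformal_linear sR sR (f_T d) \<and>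
     (\<forall>a\<in>V. \<forall>b\<in>V. flag_equations sR pr d [:[:a:]:] [:[:b:]:])}"

text \<open>The equations hold in \<open>R[\<lambda>]\<close> and \<open>\<complex>[\<lambda>,\<partial>]\<close>.\<close>

definition flag_equiv_via ::
  "(complex poly \<Rightarrow> 'r::ab_group_add \<Rightarrow> 'r) \<Rightarrow> ('r \<Rightarrow> 'r \<Rightarrow> 'r poly) \<Rightarrow> 'r set \<Rightarrow> 'r flag \<Rightarrow> 'r flag
   \<Rightarrow> 'r \<Rightarrow> complex \<Rightarrow> bool" where
  "flag_equiv_via sR pr V d d' \<omega> \<beta> \<longleftrightarrow> (let
     act = pscale sR; B = [:[:\<beta>:]:]; w = [:\<omega>:]
   in
     f_h d = f_h d' \<and> f_k d = f_k d' \<and>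
     (\<forall>a\<in>V. f_D d a = act B (f_D d' a) + pr \<omega> a - act (reflect (*) (f_k d a)) w) \<and>
     (\<forall>a\<in>V. reflect sR (f_T d a) = act B (reflect sR (f_T d' a)) + pr a \<omega> - act (f_h d a) w) \<and>
     f_M d = pr \<omega> \<omega> + act (B\<^sup>2) (f_M d') + act B (reflect sR (f_T d' \<omega>)) + act B (f_D d' \<omega>)
             - act (f_P d) w \<and>
     f_P d = reflect (*) (f_k d' \<omega>) + f_h d' \<omega> + B * f_P d')"

definition flag_eq where
  "flag_eq sR pr V = {(d, d'). d \<in> FLC sR pr V \<and> d' \<in> FLC sR pr V \<and>
     (\<exists>\<omega> \<beta>. \<beta> \<noteq> 0 \<and> flag_equiv_via sR pr V d d' \<omega> \<beta>)}"

definition flag_approx where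
  "flag_approx sR pr V = {(d, d'). d \<in> FLC sR pr V \<and> d' \<in> FLC sR pr V \<and>
     (\<exists>\<omega>. flag_equiv_via sR pr V d d' \<omega> 1)}"

definition is_LC ::
  "(complex poly \<Rightarrow> 'r::ab_group_add \<Rightarrow> 'r) \<Rightarrow> ('r \<Rightarrow> 'r \<Rightarrow> 'r poly) \<Rightarrow> 'r set
   \<Rightarrow> (complex poly \<Rightarrow> 'q::ab_group_add \<Rightarrow> 'q) \<Rightarrow> 'q \<Rightarrow> 'r flag
   \<Rightarrow> ('r \<times> 'q \<Rightarrow> 'r \<times> 'q \<Rightarrow> ('r \<times> 'q) poly) \<Rightarrow> bool" where
  "is_LC sR pr V sQ x d m \<longleftrightarrow> m \<in> extensions sR pr sQ \<and>
     (\<forall>a\<in>V. m (a, 0) (0, x) = inR (reflect sR (f_T d a)) + inQ (pscale sQ (f_h d a) [:x:])) \<and>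
     (\<forall>a\<in>V. m (0, x) (a, 0) = inR (f_D d a) + inQ (pscale sQ (reflect (*) (f_k d a)) [:x:])) \<and>
     m (0, x) (0, x) = inR (f_M d) + inQ (pscale sQ (f_P d) [:x:])"

definition LC ::
  "(complex poly \<Rightarrow> 'r::ab_group_add \<Rightarrow> 'r) \<Rightarrow> ('r \<Rightarrow> 'r \<Rightarrow> 'r poly) \<Rightarrow> 'r set
   \<Rightarrow> (complex poly \<Rightarrow> 'q::ab_group_add \<Rightarrow> 'q) \<Rightarrow> 'q \<Rightarrow> 'r flag
   \<Rightarrow> 'r \<times> 'q \<Rightarrow> 'r \<times> 'q \<Rightarrow> ('r \<times> 'q) poly" where
  "LC sR pr V sQ x d = (THE m. is_LC sR pr V sQ x d m)"

end

theory Submission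
  imports Defs
begin

text \<open>
  All quotients in the theorem are quotients of the set of extensions, the left-symmetric products
  on \<open>R \<oplus> Q\<close> that restrict to the product of \<open>R\<close>. The constructions \<open>\<Omega> \<mapsto> R \<natural> Q\<close> and
  \<open>d \<mapsto> LC(R, \<complex>[\<partial>]x | d)\<close> map extending structures and flag datums onto this set
  (\<open>natural_prod_image\<close>, \<open>LC_image\<close>), and the relations \<open>\<equiv>\<close>, \<open>\<approx>\<close> on both sides are the preimages of
  isomorphism of extensions (\<open>ext_rel_iff\<close>, \<open>flag_rel_iff\<close>). Preimages of equivalence relations
  under surjections have the same quotient (\<open>bij_betw_quotients\<close>), which gives all the bijections.

  For the extending structures this is a decomposition into blocks: a product on \<open>R \<oplus> Q\<close> consists of its
  restrictions to \<open>R \<times> R\<close>, \<open>R \<times> Q\<close>, \<open>Q \<times> R\<close>, \<open>Q \<times> Q\<close>, each with a component in \<open>R\<close> and one in \<open>Q\<close>, and an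
  isomorphism that fixes \<open>R\<close> is a triangular map \<open>a + y \<mapsto> (a + u(y)) + v(y)\<close>.

  For \<open>Q = \<complex>[\<partial>]x\<close> a conformal bilinear product is determined by its values on the generators
  \<open>V \<union> {x}\<close>, and these values are the six components of a flag datum. The failure of left symmetry
  (\<open>ls_defect\<close>) is sesquilinear in each of its three arguments, so it vanishes if it vanishes on
  generators. Exchanging \<open>\<lambda>\<close> with \<open>\<mu>\<close> and the first argument with the second changes its sign
  (\<open>swap_ls_defect\<close>), so besides triples in \<open>R\<close> only the five types \<open>xab\<close>, \<open>abx\<close>, \<open>axx\<close>, \<open>xxa\<close>, \<open>xxx\<close> remain;
  their components in \<open>R\<close> and in \<open>\<complex>[\<partial>]x\<close> are the ten flag equations (\<open>flag_equations_iff\<close>).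
  A module automorphism that fixes \<open>R\<close> sends \<open>x\<close> to \<open>\<omega> + \<beta> x\<close> where \<open>\<beta>\<close> is a unit of \<open>\<complex>[\<partial>]\<close>, i.e. a nonzero
  constant (\<open>stabilizing_shift\<close>), and compatibility with the products on generators is the list of
  equations that defines \<open>\<equiv>\<close>; the case \<open>\<beta> = 1\<close> is co-stabilization.

  The computations with formal variables rest on one principle. Every operation involved
  (\<open>f\<^bsub>-\<lambda>-\<partial>\<^esub>\<close>, the extension of \<open>f\<^bsub>p\<^esub>\<close> to \<open>R[\<lambda>,\<mu>]\<close>, products, the exchange of variables) is semilinear along
  an explicit homomorphism of polynomial rings, which is known from its values on
  \<open>\<partial>\<close>, \<open>\<lambda>\<close>, \<open>\<mu>\<close>. Hence an identity between two operations that are semilinear along the same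
  homomorphism need be checked on constant polynomials only, and there it is immediate.
\<close>

section \<open>Polynomials over a module and semilinear maps\<close>

definition ring_map :: "('a::comm_ring_1 \<Rightarrow> 'b::comm_ring_1) \<Rightarrow> bool" where
  "ring_map \<phi> \<longleftrightarrow> \<phi> 1 = 1 \<and> (\<forall>x y. \<phi> (x + y) = \<phi> x + \<phi> y) \<and> (\<forall>x y. \<phi> (x * y) = \<phi> x * \<phi> y)"

text \<open>
  The homomorphism \<open>A[X] \<rightarrow> B\<close> that extends \<open>\<phi> : A \<rightarrow> B\<close> and sends \<open>X\<close> to \<open>p\<close>. The substitutions below
  are iterations of it, one for each variable.
\<close>

definition poly_ev :: "('a::comm_ring_1 \<Rightarrow> 'b::comm_ring_1) \<Rightarrow> 'b \<Rightarrow> 'a poly \<Rightarrow> 'b" where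
  "poly_ev \<phi> p F = poly (map_poly \<phi> F) p"

lemma ring_mapD:
  assumes "ring_map \<phi>"
  shows ring_map_0: "\<phi> 0 = 0" and ring_map_1: "\<phi> 1 = 1"
    and ring_map_add: "\<phi> (x + y) = \<phi> x + \<phi> y" and ring_map_mult: "\<phi> (x * y) = \<phi> x * \<phi> y"
    and ring_map_uminus: "\<phi> (- x) = - \<phi> x" and ring_map_diff: "\<phi> (x - y) = \<phi> x - \<phi> y"
    and ring_map_power: "\<phi> (x ^ n) = \<phi> x ^ n"
proof -
  show 1: "\<phi> 1 = 1" and add: "\<And>x y. \<phi> (x + y) = \<phi> x + \<phi> y"
    and mult: "\<And>x y. \<phi> (x * y) = \<phi> x * \<phi> y"
    using assms by (auto simp: ring_map_def)
  show 0: "\<phi> 0 = 0" using add[of 0 0] by simp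
  show u: "\<phi> (- x) = - \<phi> x" for x
    using add[of x "- x"] 0 by (simp add: eq_neg_iff_add_eq_0 add.commute)
  show "\<phi> (x - y) = \<phi> x - \<phi> y" using add[of x "- y"] u by simp
  show "\<phi> (x ^ n) = \<phi> x ^ n" by (induction n) (simp_all add: 1 mult)
qed

lemma ring_map_comp: "ring_map \<phi> \<Longrightarrow> ring_map \<psi> \<Longrightarrow> ring_map (\<lambda>x. \<psi> (\<phi> x))"
  by (simp add: ring_map_def)

lemma ring_map_const: "ring_map (\<lambda>z. [:z:])"
  by (simp add: ring_map_def one_pCons)

lemma poly_ev_0 [simp]: "poly_ev \<phi> p 0 = 0"
  by (simp add: poly_ev_def)

lemma poly_ev_pCons:
  "ring_map \<phi> \<Longrightarrow> poly_ev \<phi> p (pCons a F) = \<phi> a + p * poly_ev \<phi> p F"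
  by (cases "a = 0 \<and> F = 0")
     (auto simp: poly_ev_def map_poly_pCons ring_map_0)

lemma ring_map_poly_ev:
  assumes "ring_map \<phi>" shows "ring_map (poly_ev \<phi> p)"
proof -
  note h = ring_mapD[OF assms] and pC = poly_ev_pCons[OF assms]
  have add: "poly_ev \<phi> p (F + G) = poly_ev \<phi> p F + poly_ev \<phi> p G" for F G
    by (induction F G rule: poly_induct2) (simp_all add: pC h algebra_simps)
  have smult: "poly_ev \<phi> p (smult a F) = \<phi> a * poly_ev \<phi> p F" for a F
    by (induction F) (simp_all add: pC h algebra_simps)
  have "poly_ev \<phi> p (F * G) = poly_ev \<phi> p F * poly_ev \<phi> p G" for F G
    by (induction F) (simp_all add: pC h add smult mult_pCons_left algebra_simps)
  then show ?thesis using add pC[of p 1 0] h by (simp add: ring_map_def one_pCons)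
qed

text \<open>
  A polynomial ring is generated by its constants and its variable. All identities between
  substitutions are proved by evaluating both sides on these generators.
\<close>

lemma ring_map_poly_unique:
  assumes "ring_map \<sigma>" shows "\<sigma> F = poly_ev (\<lambda>a. \<sigma> [:a:]) (\<sigma> [:0, 1:]) F"
proof (induction F)
  case 0 then show ?case by (simp add: ring_map_0[OF assms])
next
  case (pCons a F)
  have *: "pCons a F = [:a:] + [:0, 1:] * F" by simp
  have "\<sigma> (pCons a F) = \<sigma> [:a:] + \<sigma> [:0, 1:] * \<sigma> F"
    by (subst *) (simp only: ring_map_add[OF assms] ring_map_mult[OF assms])
  with pCons show ?case
    using ring_map_comp[OF ring_map_const assms] by (simp add: poly_ev_pCons)
qed

lemma ring_map_poly_eqI:
  assumes "ring_map \<sigma>" "ring_map \<tau>" "\<And>a. \<sigma> [:a:] = \<tau> [:a:]" "\<sigma> [:0, 1:] = \<tau> [:0, 1:]"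
  shows "\<sigma> = \<tau>"
proof
  fix F show "\<sigma> F = \<tau> F"
    by (subst ring_map_poly_unique[OF assms(1)], subst ring_map_poly_unique[OF assms(2)])
       (simp only: assms(3,4))
qed

context module
begin

lemma coeff_pscale:
  "coeff (pscale scale p f) n = (\<Sum>i\<le>n. scale (coeff p i) (coeff f (n - i)))"
proof -
  have "coeff (pscale scale p f) n
      = (\<Sum>i\<le>degree p. \<Sum>j\<le>degree f. if i + j = n then scale (coeff p i) (coeff f j) else 0)"
    by (simp add: pscale_def coeff_sum)
  also have "\<dots> = (\<Sum>i\<le>degree p. if i \<le> n then scale (coeff p i) (coeff f (n - i)) else 0)"
  proof (rule sum.cong[OF refl])
    fix i
    have "(\<Sum>j\<le>degree f. if i + j = n then scale (coeff p i) (coeff f j) else 0)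
       = (\<Sum>j\<le>degree f. if j = n - i then (if i \<le> n then scale (coeff p i) (coeff f j) else 0) else 0)"
      by (rule sum.cong) auto
    also have "\<dots> = (if i \<le> n then scale (coeff p i) (coeff f (n - i)) else 0)"
      by (subst sum.delta) (auto simp: coeff_eq_0)
    finally show "(\<Sum>j\<le>degree f. if i + j = n then scale (coeff p i) (coeff f j) else 0)
      = (if i \<le> n then scale (coeff p i) (coeff f (n - i)) else 0)" .
  qed
  also have "\<dots> = (\<Sum>i\<le>max n (degree p). if i \<le> n then scale (coeff p i) (coeff f (n - i)) else 0)"
    by (rule sum.mono_neutral_left) (auto simp: coeff_eq_0)
  also have "\<dots> = (\<Sum>i\<le>n. scale (coeff p i) (coeff f (n - i)))"
    by (rule sum.mono_neutral_cong_right) auto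
  finally show ?thesis .
qed

lemma pscale_0_left [simp]: "pscale scale 0 f = 0"
  by (rule poly_eqI) (simp add: coeff_pscale)

lemma pscale_0_right [simp]: "pscale scale p 0 = 0"
  by (rule poly_eqI) (simp add: coeff_pscale)

lemma pscale_pCons:
  "pscale scale (pCons a p) f = map_poly (scale a) f + pCons 0 (pscale scale p f)"
proof (rule poly_eqI)
  fix n show "coeff (pscale scale (pCons a p) f) n
    = coeff (map_poly (scale a) f + pCons 0 (pscale scale p f)) n"
    by (cases n) (simp_all add: coeff_pscale coeff_map_poly sum.atMost_Suc_shift del: sum.atMost_Suc)
qed

lemma pscale_const [simp]: "pscale scale [:a:] [:m:] = [:scale a m:]"
  by (simp add: pscale_pCons map_poly_pCons)

lemma pscale_var: "pscale scale [:0, 1:] f = pCons 0 f"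
proof -
  have "map_poly (scale 1) f = f" "map_poly (scale 0) f = 0"
    by (auto intro!: poly_eqI simp: coeff_map_poly)
  then show ?thesis by (simp add: pscale_pCons)
qed

lemma module_pscale: "module (pscale scale)"
proof
  fix p q :: "'a poly" and f g :: "'b poly"
  show right: "pscale scale p (f + g) = pscale scale p f + pscale scale p g" for p f g
    by (rule poly_eqI) (simp add: coeff_pscale scale_right_distrib sum.distrib)
  show left: "pscale scale (p + q) f = pscale scale p f + pscale scale q f" for p q f
    by (rule poly_eqI) (simp add: coeff_pscale scale_left_distrib sum.distrib)
  show "pscale scale 1 f = f"
    by (rule poly_eqI) (simp add: one_pCons pscale_pCons coeff_map_poly)
  have smult: "pscale scale (smult a q) f = map_poly (scale a) (pscale scale q f)" for a q f
    by (rule poly_eqI) (simp add: coeff_pscale coeff_map_poly scale_sum_right)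
  show "pscale scale p (pscale scale q f) = pscale scale (p * q) f"
  proof (induction p)
    case (pCons a p)
    have "pscale scale (pCons 0 (p * q)) f = pCons 0 (pscale scale (p * q) f)"
      by (rule poly_eqI) (simp add: pscale_pCons coeff_map_poly)
    with pCons show ?case by (simp add: pscale_pCons left smult mult_pCons_left)
  qed simp
qed

end

lemma module_ring_mult: "module ((*) :: 'a::comm_ring_1 \<Rightarrow> 'a \<Rightarrow> 'a)"
  by unfold_locales (simp_all add: algebra_simps)

lemma pscale_mult: "pscale (*) = ((*) :: 'a::comm_ring_1 poly \<Rightarrow> _)"
  by (intro ext poly_eqI) (simp add: module.coeff_pscale[OF module_ring_mult] coeff_mult)

lemma bscale_mult: "bscale (*) = (*)"
  by (simp add: bscale_def pscale_mult)

lemma module_bscale: "module s \<Longrightarrow> module (bscale s)"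
  by (simp add: bscale_def module.module_pscale)

lemma bscale_const [simp]: "module s \<Longrightarrow> bscale s [:[:a:]:] [:[:m:]:] = [:[:s a m:]:]"
  by (simp add: bscale_def module.pscale_const module.module_pscale)

text \<open>
  The homomorphism \<open>\<phi>\<close> is a parameter because sesquilinearity takes this form: the rules
  \<open>f(\<partial>a) = -\<lambda> f(a)\<close> and \<open>f(\<partial>a) = (\<partial> + \<lambda>) f(a)\<close> express semilinearity along \<open>\<partial> \<mapsto> -\<lambda>\<close> and \<open>\<partial> \<mapsto> \<partial> + \<lambda>\<close>.
\<close>

definition semilinear ::
  "('a::comm_ring_1 \<Rightarrow> 'u::ab_group_add \<Rightarrow> 'u) \<Rightarrow> ('b::comm_ring_1 \<Rightarrow> 'w::ab_group_add \<Rightarrow> 'w)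
   \<Rightarrow> ('a \<Rightarrow> 'b) \<Rightarrow> ('u \<Rightarrow> 'w) \<Rightarrow> bool" where
  "semilinear s t \<phi> G \<longleftrightarrow> (\<forall>u v. G (u + v) = G u + G v) \<and> (\<forall>a u. G (s a u) = t (\<phi> a) (G u))"

lemma semilinearD:
  assumes "semilinear s t \<phi> G"
  shows semilinear_0: "G 0 = 0" and semilinear_add: "G (u + v) = G u + G v"
    and semilinear_scale: "G (s a u) = t (\<phi> a) (G u)"
    and semilinear_uminus: "G (- u) = - G u" and semilinear_diff: "G (u - v) = G u - G v"
    and semilinear_sum: "G (sum g I) = (\<Sum>i\<in>I. G (g i))"
proof -
  show add: "\<And>u v. G (u + v) = G u + G v" and "G (s a u) = t (\<phi> a) (G u)"
    using assms by (auto simp: semilinear_def)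
  show 0: "G 0 = 0" using add[of 0 0] by simp
  show u: "G (- x) = - G x" for x
    using add[of x "- x"] 0 by (simp add: eq_neg_iff_add_eq_0 add.commute)
  show "G (u - v) = G u - G v" using add[of u "- v"] u by simp
  show "G (sum g I) = (\<Sum>i\<in>I. G (g i))"
    by (induction I rule: infinite_finite_induct) (simp_all add: 0 add)
qed

lemma semilinear_comp:
  "semilinear s t \<phi> G \<Longrightarrow> semilinear t w \<psi> H \<Longrightarrow> semilinear s w (\<lambda>a. \<psi> (\<phi> a)) (\<lambda>u. H (G u))"
  by (simp add: semilinear_def)

lemma semilinear_plus:
  "module t \<Longrightarrow> semilinear s t \<phi> G \<Longrightarrow> semilinear s t \<phi> H \<Longrightarrow> semilinear s t \<phi> (\<lambda>u. G u + H u)"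
  by (simp add: semilinear_def module.scale_right_distrib)

lemma semilinear_minus:
  "module t \<Longrightarrow> semilinear s t \<phi> G \<Longrightarrow> semilinear s t \<phi> H \<Longrightarrow> semilinear s t \<phi> (\<lambda>u. G u - H u)"
  by (simp add: semilinear_def module.scale_right_diff_distrib)

lemma semilinear_zero: "module t \<Longrightarrow> semilinear s t \<phi> (\<lambda>u. 0)"
  by (simp add: semilinear_def module.scale_zero_right)

lemma semilinear_scaled:
  "module t \<Longrightarrow> semilinear s t \<phi> G \<Longrightarrow> semilinear s t \<phi> (\<lambda>u. t c (G u))"
  by (simp add: semilinear_def module.scale_right_distrib module.scale_scale mult.commute)

lemma semilinear_sums:
  "module t \<Longrightarrow> (\<And>i. i \<in> I \<Longrightarrow> semilinear s t \<phi> (G i)) \<Longrightarrow> semilinear s t \<phi> (\<lambda>u. \<Sum>i\<in>I. G i u)"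
  by (induction I rule: infinite_finite_induct) (simp_all add: semilinear_zero semilinear_plus)

lemma semilinear_map_poly:
  assumes "module s" "module t" "semilinear s t (\<lambda>a. a) G"
  shows "semilinear (pscale s) (pscale t) (\<lambda>p. p) (map_poly G)"
  unfolding semilinear_def
  by (auto intro!: poly_eqI simp: coeff_map_poly semilinearD[OF assms(3)] module.coeff_pscale[OF assms(1)]
      module.coeff_pscale[OF assms(2)])

text \<open>
  Evaluation of a polynomial with module coefficients at a ring element \<open>p\<close>, after its coefficients
  are carried to the target module by \<open>G\<close>. The operations \<open>reflect\<close>, \<open>bsubst\<close> and \<open>lin_ext\<close>
  are instances, so the semilinearity of each of them is a case of \<open>semilinear_meval\<close>.
\<close>

definition meval ::
  "('b::comm_ring_1 \<Rightarrow> 'w::ab_group_add \<Rightarrow> 'w) \<Rightarrow> ('u::ab_group_add \<Rightarrow> 'w) \<Rightarrow> 'b \<Rightarrow> 'u poly \<Rightarrow> 'w" where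
  "meval t G p f = (\<Sum>i\<le>degree f. t (p ^ i) (G (coeff f i)))"

lemma meval_pCons:
  assumes "module t" "G 0 = 0"
  shows "meval t G p (pCons m f) = G m + t p (meval t G p f)"
proof (cases "f = 0")
  case True
  then show ?thesis using assms
    by (simp add: meval_def module.scale_zero_right module.scale_one)
next
  case False
  then show ?thesis using assms
    by (simp add: meval_def sum.atMost_Suc_shift module.scale_one module.scale_sum_right module.scale_scale
      del: sum.atMost_Suc)
qed

lemma meval_0: "module t \<Longrightarrow> G 0 = 0 \<Longrightarrow> meval t G p 0 = 0"
  by (simp add: meval_def module.scale_zero_right)

text \<open>
  By induction on the scalar polynomial: both sides respect multiplication by a constant, where \<open>G\<close> is
  semilinear by assumption, and by the variable, which acts on the target as \<open>p\<close>.
\<close>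

lemma semilinear_meval:
  assumes s: "module s" and t: "module t" and \<phi>: "ring_map \<phi>" and G: "semilinear s t \<phi> G"
  shows "semilinear (pscale s) t (poly_ev \<phi> p) (meval t G p)"
proof -
  note g = semilinearD[OF G]
  note pC = meval_pCons[where G = G, OF t g(1)] meval_0[where G = G, OF t g(1)]
  note md = module.scale_right_distrib[OF t] module.scale_scale[OF t] module.scale_left_distrib[OF t]
    module.scale_zero_left[OF t] module.scale_zero_right[OF t]
  have add: "meval t G p (f + h) = meval t G p f + meval t G p h" for f h
    by (induction f h rule: poly_induct2) (simp_all add: pC g md algebra_simps)
  have sc: "meval t G p (map_poly (s a) f) = t (\<phi> a) (meval t G p f)" for a f
    by (induction f)
       (simp_all add: pC g md map_poly_pCons module.scale_zero_right[OF s] mult.commute)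
  have "meval t G p (pscale s F f) = t (poly_ev \<phi> p F) (meval t G p f)" for F f
    by (induction F) (simp_all add: module.pscale_pCons[OF s] module.pscale_0_left[OF s] pC g md
      poly_ev_pCons[OF \<phi>] add sc)
  with add show ?thesis by (simp add: semilinear_def)
qed

lemma meval_const: "module t \<Longrightarrow> meval t G p [:m:] = G m"
  by (simp add: meval_def module.scale_one)

section \<open>Substitutions for the formal variables\<close>

abbreviation const2 :: "complex \<Rightarrow> complex poly poly" where "const2 z \<equiv> [:[:z:]:]"
abbreviation const3 :: "complex \<Rightarrow> complex poly poly poly" where "const3 z \<equiv> [:[:[:z:]:]:]"

lemma ring_map_id: "ring_map (\<lambda>x. x)" by (simp add: ring_map_def)

lemma ring_map_const_const: "ring_map (\<lambda>a. [:[:a:]:])"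
  using ring_map_comp[OF ring_map_const ring_map_const] .

lemma ring_map_const3: "ring_map const3"
  using ring_map_comp[OF ring_map_const_const ring_map_const] .

lemma poly_ev_var: "ring_map \<phi> \<Longrightarrow> poly_ev \<phi> p [:0, 1:] = p"
  by (simp add: poly_ev_pCons ring_map_0 ring_map_1)

lemma poly_ev_const: "ring_map \<phi> \<Longrightarrow> poly_ev \<phi> p [:a:] = \<phi> a"
  by (simp add: poly_ev_pCons ring_map_0)

text \<open>
  The letters \<open>d\<close>, \<open>l\<close>, \<open>m\<close> stand for the values of \<open>\<partial>\<close>, \<open>\<lambda>\<close>, \<open>\<mu>\<close>. Sesquilinear operations change
  \<open>\<partial>\<close> only; the value of \<open>\<lambda>\<close> and \<open>\<mu>\<close> matters for their exchange.
\<close>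

definition at_del :: "complex poly poly poly \<Rightarrow> complex poly \<Rightarrow> complex poly poly poly" where
  "at_del r = poly_ev const3 r"

definition subst3 where
  "subst3 d l m = poly_ev (poly_ev (at_del d) l) m"

definition subst_del where "subst_del d = subst3 d lam mu"

lemma ring_map_at_del: "ring_map (at_del r)"
  unfolding at_del_def by (rule ring_map_poly_ev[OF ring_map_const3])

lemma at_del_simps [simp]: "at_del r [:z:] = const3 z" "at_del r del0 = r"
  unfolding at_del_def by (simp_all add: poly_ev_const poly_ev_var ring_map_const3)

lemma psubst_poly_ev: "psubst F p q = poly_ev (at_del q) p F"
  by (simp add: psubst_def poly_ev_def[abs_def] at_del_def[abs_def])

lemma ring_map_subst3: "ring_map (subst3 d l m)"
  unfolding subst3_def by (intro ring_map_poly_ev ring_map_at_del)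

lemmas subst3_hom [simp] = ring_mapD[OF ring_map_subst3]

lemma subst3_simps [simp]:
  "subst3 d l m [:[:a:]:] = at_del d a"
  "subst3 d l m lam = l" "subst3 d l m mu = m"
  unfolding subst3_def
  by (simp_all add: poly_ev_const poly_ev_var ring_map_at_del ring_map_poly_ev)

lemma ring_map_psubst: "ring_map (\<lambda>F. psubst F p q)"
  unfolding psubst_poly_ev by (intro ring_map_poly_ev ring_map_at_del)

lemma psubst_simps [simp]: "psubst [:a:] p q = at_del q a" "psubst lam1 p q = p"
  by (simp_all add: psubst_poly_ev poly_ev_const poly_ev_var ring_map_at_del)

lemmas psubst_hom [simp] = ring_mapD[OF ring_map_psubst]

lemma at_del_unique:
  assumes "ring_map \<sigma>" "\<And>z. \<sigma> [:z:] = const3 z" shows "\<sigma> = at_del (\<sigma> del0)"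
  by (rule ring_map_poly_eqI[OF assms(1) ring_map_at_del]) (simp_all add: assms(2))

lemma ring_map_eqI3:
  assumes "ring_map \<sigma>" "ring_map \<tau>" "\<And>z. \<sigma> (const3 z) = \<tau> (const3 z)"
    "\<sigma> del = \<tau> del" "\<sigma> lam = \<tau> lam" "\<sigma> mu = \<tau> mu"
  shows "\<sigma> = \<tau>"
proof -
  have 1: "(\<lambda>a. \<sigma> [:[:a:]:]) = (\<lambda>a. \<tau> [:[:a:]:])"
    by (rule ring_map_poly_eqI) (intro ring_map_comp[OF ring_map_const_const] assms | simp add: assms)+
  have 2: "(\<lambda>a. \<sigma> [:a:]) = (\<lambda>a. \<tau> [:a:])"
    by (rule ring_map_poly_eqI) (intro ring_map_comp[OF ring_map_const] assms | simp add: assms fun_cong[OF 1])+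
  show ?thesis
    by (rule ring_map_poly_eqI) (simp_all add: assms fun_cong[OF 2])
qed

lemma subst3_at_del: "subst3 d l m (at_del r a) = at_del (subst3 d l m r) a"
proof -
  have "(\<lambda>a. subst3 d l m (at_del r a)) = at_del (subst3 d l m (at_del r del0))"
    by (rule at_del_unique) (intro ring_map_comp[OF ring_map_at_del] ring_map_subst3 | simp)+
  then show ?thesis by (simp add: fun_eq_iff)
qed

lemma ring_map_eqI2:
  assumes "ring_map \<sigma>" "ring_map \<tau>" "\<And>z. \<sigma> (const2 z) = \<tau> (const2 z)"
    "\<sigma> del1 = \<tau> del1" "\<sigma> lam1 = \<tau> lam1"
  shows "\<sigma> = \<tau>"
proof -
  have 1: "(\<lambda>a. \<sigma> [:a:]) = (\<lambda>a. \<tau> [:a:])"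
    by (rule ring_map_poly_eqI) (intro ring_map_comp[OF ring_map_const] assms | simp add: assms)+
  show ?thesis
    by (rule ring_map_poly_eqI) (simp_all add: assms fun_cong[OF 1])
qed

lemma subst3_psubst: "subst3 d l m (psubst F p q) = psubst F (subst3 d l m p) (subst3 d l m q)"
proof -
  have "(\<lambda>F. subst3 d l m (psubst F p q)) = (\<lambda>F. psubst F (subst3 d l m p) (subst3 d l m q))"
    by (rule ring_map_eqI2)
       (intro ring_map_comp[OF ring_map_psubst] ring_map_psubst ring_map_subst3 | simp)+
  then show ?thesis by (simp add: fun_eq_iff)
qed

lemma subst3_subst3:
  "subst3 d l m (subst3 d' l' m' q) = subst3 (subst3 d l m d') (subst3 d l m l') (subst3 d l m m') q"
proof -
  have "(\<lambda>q. subst3 d l m (subst3 d' l' m' q)) = subst3 (subst3 d l m d') (subst3 d l m l') (subst3 d l m m')"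
    by (rule ring_map_eqI3) (intro ring_map_comp[OF ring_map_subst3] ring_map_subst3 | simp)+
  then show ?thesis by (simp add: fun_eq_iff)
qed

lemma subst3_id: "subst3 del lam mu = (\<lambda>q. q)"
  by (rule ring_map_eqI3) (intro ring_map_subst3 ring_map_id | simp)+

lemma poly_decomp: "module s \<Longrightarrow> pCons m f = [:m:] + pscale s [:0, 1:] f"
  by (simp add: module.pscale_var)

text \<open>
  The constants generate \<open>M[\<lambda>]\<close> as a module over \<open>\<complex>[\<partial>][\<lambda>]\<close>; this and its analogue in two
  variables below are the principle by which identities of operations are proved.
\<close>

lemma semilinear_poly_eq:
  assumes "module s" "semilinear (pscale s) t \<sigma> G" "semilinear (pscale s) t \<sigma> H"
    "\<And>m. G [:m:] = H [:m:]"
  shows "G f = H f"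
proof (induction f)
  case 0 then show ?case using semilinear_0[OF assms(2)] semilinear_0[OF assms(3)] by simp
next
  case (pCons a f)
  then show ?case
    by (subst (1 2) poly_decomp[OF assms(1)])
       (simp only: semilinear_add[OF assms(2)] semilinear_add[OF assms(3)]
         semilinear_scale[OF assms(2)] semilinear_scale[OF assms(3)] assms(4))
qed

lemma semilinear_const: "module s \<Longrightarrow> semilinear s (pscale s) (\<lambda>a. [:a:]) (\<lambda>m. [:m:])"
  by (simp add: semilinear_def module.pscale_const)

lemma semilinear_const_const: "module s \<Longrightarrow> semilinear s (bscale s) (\<lambda>a. [:[:a:]:]) (\<lambda>m. [:[:m:]:])"
  by (simp add: semilinear_def)

lemma semilinear_poly_poly_eq:
  assumes s: "module s" and G: "semilinear (bscale s) t \<sigma> G" and H: "semilinear (bscale s) t \<sigma> H"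
    and eq: "\<And>m. G [:[:m:]:] = H [:[:m:]:]"
  shows "G u = H u"
proof (rule semilinear_poly_eq[OF module.module_pscale[OF s], of t \<sigma>])
  show "semilinear (pscale (pscale s)) t \<sigma> G" "semilinear (pscale (pscale s)) t \<sigma> H"
    using G H by (simp_all add: bscale_def)
  have c: "semilinear (pscale s) (bscale s) (\<lambda>a. [:a:]) (\<lambda>m. [:m:])"
    unfolding bscale_def using semilinear_const[OF module.module_pscale[OF s]] .
  show "G [:f:] = H [:f:]" for f
    by (rule semilinear_poly_eq[OF s, where G = "\<lambda>f. G [:f:]" and H = "\<lambda>f. H [:f:]"])
       (rule semilinear_comp[OF c G] semilinear_comp[OF c H] eq)+
qed

text \<open>
  This is \<open>semilinear_meval\<close>, once \<open>F \<mapsto> F(p, \<partial>)\<close> is recognized as the homomorphism over \<open>\<complex>[\<partial>]\<close> with \<open>\<nu> \<mapsto> p\<close>.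
\<close>

lemma semilinear_bsubst:
  assumes "module s"
  shows "semilinear (pscale s) (bscale s) (\<lambda>F. psubst F p del) (bsubst s p)"
proof -
  have "bsubst s p = meval (bscale s) (\<lambda>m. [:[:m:]:]) p"
    by (simp add: fun_eq_iff bsubst_def meval_def)
  moreover have "(\<lambda>F. psubst F p del) = poly_ev (\<lambda>a. [:[:a:]:]) p"
    by (rule ring_map_eqI2)
       (intro ring_map_psubst ring_map_poly_ev ring_map_const_const
         | simp add: poly_ev_const poly_ev_var ring_map_const_const)+
  ultimately show ?thesis
    using semilinear_meval[OF assms module_bscale[OF assms] ring_map_const_const
      semilinear_const_const[OF assms]] by metis
qed

lemma bsubst_const: "module s \<Longrightarrow> bsubst s p [:m:] = [:[:m:]:]"
  by (simp add: bsubst_def module.scale_one[OF module_bscale])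

lemma semilinear_reflect_aux:
  assumes "module s"
  shows "semilinear (pscale s) (pscale s) (poly_ev (\<lambda>a. [:a:]) (- lam1 - del1)) (reflect s)"
proof -
  have "reflect s = meval (pscale s) (\<lambda>m. [:m:]) (- lam1 - del1)"
    by (simp add: fun_eq_iff reflect_def meval_def)
  then show ?thesis
    using semilinear_meval[OF assms module.module_pscale[OF assms] ring_map_const
      semilinear_const[OF assms]] by metis
qed

lemma reflect_const: "module s \<Longrightarrow> reflect s [:m:] = [:m:]"
  by (simp add: reflect_def module.scale_one[OF module.module_pscale])

lemma reflect_mult: "reflect (*) = poly_ev (\<lambda>a. [:a:]) (- lam1 - del1)"
proof
  fix F :: "complex poly poly"
  show "reflect (*) F = poly_ev (\<lambda>a. [:a:]) (- lam1 - del1) F"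
    using semilinear_scale[OF semilinear_reflect_aux[OF module_ring_mult], of F 1]
      reflect_const[OF module_ring_mult, of 1]
    by (simp only: pscale_mult one_pCons[symmetric] mult_1_right)
qed

lemmas semilinear_reflect = semilinear_reflect_aux[folded reflect_mult]

lemma ring_map_reflect: "ring_map (reflect (*))"
  unfolding reflect_mult by (rule ring_map_poly_ev[OF ring_map_const])

lemmas reflect_hom [simp] = ring_mapD[OF ring_map_reflect]

lemma reflect_simps [simp]: "reflect (*) [:a:] = [:a:]" "reflect (*) lam1 = - lam1 - del1"
  unfolding reflect_mult by (simp_all add: poly_ev_const poly_ev_var ring_map_const)

lemma reflect_mult_reflect [simp]: "reflect (*) (reflect (*) F) = F"
proof -
  have "reflect (*) (reflect (*) lam1) = lam1"
    unfolding reflect_simps reflect_hom by simp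
  then have "(\<lambda>F. reflect (*) (reflect (*) F)) = (\<lambda>F. F)"
    by (intro ring_map_eqI2 ring_map_comp[OF ring_map_reflect] ring_map_reflect ring_map_id)
       (simp_all only: reflect_simps)
  then show ?thesis by (simp add: fun_eq_iff)
qed

lemma psubst_reflect: "psubst (reflect (*) F) p q = psubst F (- p - q) q"
proof -
  have "psubst (reflect (*) lam1) p q = - p - q"
    unfolding reflect_simps psubst_hom psubst_simps at_del_simps ..
  then have "(\<lambda>F. psubst (reflect (*) F) p q) = (\<lambda>F. psubst F (- p - q) q)"
    by (intro ring_map_eqI2 ring_map_comp[OF ring_map_reflect] ring_map_psubst)
       (simp_all only: reflect_simps psubst_simps)
  then show ?thesis by (simp add: fun_eq_iff)
qed

lemma semilinear_id: "semilinear s s (\<lambda>a. a) (\<lambda>u. u)" by (simp add: semilinear_def)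

text \<open>
  The substitution \<open>\<lambda> \<mapsto> -\<lambda>-\<partial>\<close> is an involution on scalars and fixes constants. This allows to
  pass between \<open>T\<^bsub>\<lambda>\<^esub>\<close> and \<open>T\<^bsub>-\<lambda>-\<partial>\<^esub>\<close> in both directions.
\<close>

lemma reflect_reflect:
  assumes "module s" shows "reflect s (reflect s f) = f"
proof (rule semilinear_poly_eq[OF assms])
  show "semilinear (pscale s) (pscale s) (\<lambda>a. a) (\<lambda>f. reflect s (reflect s f))"
    using semilinear_comp[OF semilinear_reflect semilinear_reflect, OF assms assms]
    unfolding reflect_mult_reflect .
qed (simp_all add: reflect_const semilinear_id assms)

lemma bsubst_reflect:
  assumes "module s" shows "bsubst s p (reflect s f) = bsubst s (- p - del) f"
proof (rule semilinear_poly_eq[OF assms, where f = f])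
  show "semilinear (pscale s) (bscale s) (\<lambda>F. psubst F (- p - del) del) (\<lambda>f. bsubst s p (reflect s f))"
    using semilinear_comp[OF semilinear_reflect semilinear_bsubst, OF assms assms]
    unfolding psubst_reflect .
qed (simp_all add: reflect_const bsubst_const semilinear_bsubst assms)

lemma map_poly_const: "G 0 = 0 \<Longrightarrow> map_poly G [:m:] = [:G m:]"
  by (rule poly_eqI) (simp add: coeff_map_poly coeff_pCons split: nat.split)

lemma bsubst_map_poly:
  assumes "module s" "module t" "semilinear s t (\<lambda>a. a) G"
  shows "bsubst t p (map_poly G f) = map_poly (map_poly G) (bsubst s p f)"
proof (rule semilinear_poly_eq[OF assms(1), where f = f and t = "bscale t" and \<sigma> = "\<lambda>F. psubst F p del"])
  note g = semilinear_map_poly[OF assms]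
  have gg: "semilinear (bscale s) (bscale t) (\<lambda>a. a) (map_poly (map_poly G))"
    unfolding bscale_def by (intro semilinear_map_poly module.module_pscale assms)
  show "semilinear (pscale s) (bscale t) (\<lambda>F. psubst F p del) (\<lambda>f. bsubst t p (map_poly G f))"
    using semilinear_comp[OF g semilinear_bsubst[OF assms(2)]] .
  show "semilinear (pscale s) (bscale t) (\<lambda>F. psubst F p del) (\<lambda>f. map_poly (map_poly G) (bsubst s p f))"
    using semilinear_comp[OF semilinear_bsubst[OF assms(1)] gg] .
  show "bsubst t p (map_poly G [:m:]) = map_poly (map_poly G) (bsubst s p [:m:])" for m
    by (simp add: bsubst_const assms map_poly_const semilinear_0[OF assms(3)])
qed

lemma coeff_pscale_const:
  assumes "module s" shows "coeff (pscale s p [:m:]) n = s (coeff p n) m"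
  by (induction p arbitrary: n)
    (simp_all add: module.pscale_pCons[OF assms] module.pscale_0_left[OF assms]
      module.scale_zero_left[OF assms] module.scale_zero_right[OF assms]
      map_poly_const coeff_pCons split: nat.split)

lemma module_restrict:
  assumes s: "module s" and \<kappa>: "ring_map \<kappa>" shows "module (\<lambda>c. s (\<kappa> c))"
  by unfold_locales (simp_all add: ring_mapD[OF \<kappa>] module.scale_right_distrib[OF s]
    module.scale_left_distrib[OF s] module.scale_scale[OF s] module.scale_one[OF s])

lemma semilinear_poly_ev_iff:
  assumes s: "module s" and t: "module t" and \<kappa>: "ring_map \<kappa>"
  shows "semilinear s t (poly_ev \<kappa> p) f \<longleftrightarrow>
    module_hom (\<lambda>c. s [:c:]) (\<lambda>c. t (\<kappa> c)) f \<and> (\<forall>a. f (s [:0, 1:] a) = t p (f a))"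
proof
  have m: "module (\<lambda>c. s [:c:])" and m': "module (\<lambda>c. t (\<kappa> c))"
    using module_restrict[OF s ring_map_const] module_restrict[OF t \<kappa>] .
  {
    assume "semilinear s t (poly_ev \<kappa> p) f"
    then show "module_hom (\<lambda>c. s [:c:]) (\<lambda>c. t (\<kappa> c)) f \<and> (\<forall>a. f (s [:0, 1:] a) = t p (f a))"
      using m m' by (simp add: module_hom_iff semilinear_def poly_ev_const poly_ev_var \<kappa>)
  next
    assume R: "module_hom (\<lambda>c. s [:c:]) (\<lambda>c. t (\<kappa> c)) f \<and> (\<forall>a. f (s [:0, 1:] a) = t p (f a))"
    then have add: "f (a + b) = f a + f b" and c: "f (s [:z:] a) = t (\<kappa> z) (f a)"
      and d: "f (s [:0, 1:] a) = t p (f a)" for a b z by (simp_all add: module_hom_iff)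
    have z: "f 0 = 0" using add[of 0 0] by simp
    have "f (s q a) = t (poly_ev \<kappa> p q) (f a)" for q a
    proof (induction q arbitrary: a)
      case 0
      then show ?case by (simp add: module.scale_zero_left[OF s] module.scale_zero_left[OF t] z)
    next
      case (pCons b q)
      have "s (pCons b q) a = s [:b:] a + s [:0, 1:] (s q a)"
        by (simp add: module.scale_scale[OF s] module.scale_left_distrib[OF s, symmetric])
      then show ?case
        by (simp add: add c d pCons poly_ev_pCons[OF \<kappa>] module.scale_scale[OF t] module.scale_left_distrib[OF t])
    qed
    with add show "semilinear s t (poly_ev \<kappa> p) f" by (simp add: semilinear_def)
  }
qed

definition left_sub :: "complex poly \<Rightarrow> complex poly poly" where
  "left_sub = poly_ev const2 (- lam1)"

definition right_sub :: "complex poly \<Rightarrow> complex poly poly" where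
  "right_sub = poly_ev const2 (del1 + lam1)"

lemma ring_map_left_right: "ring_map left_sub" "ring_map right_sub"
  unfolding left_sub_def right_sub_def by (intro ring_map_poly_ev ring_map_const_const)+

lemma left_right_simps [simp]:
  "left_sub [:z:] = const2 z" "left_sub del0 = - lam1"
  "right_sub [:z:] = const2 z" "right_sub del0 = del1 + lam1"
  unfolding left_sub_def right_sub_def
  by (simp_all only: poly_ev_const poly_ev_var ring_map_const_const)

lemma left_conformal_linear_iff:
  "module s \<Longrightarrow> module t \<Longrightarrow> left_conformal_linear s t f \<longleftrightarrow> semilinear s (pscale t) left_sub f"
  unfolding left_sub_def
  by (subst semilinear_poly_ev_iff)
     (simp_all add: left_conformal_linear_def clinear_def module.module_pscale ring_map_const_const)

lemma conformal_linear_iff: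
  "module s \<Longrightarrow> module t \<Longrightarrow> conformal_linear s t f \<longleftrightarrow> semilinear s (pscale t) right_sub f"
  unfolding right_sub_def
  by (subst semilinear_poly_ev_iff)
     (simp_all add: conformal_linear_def clinear_def module.module_pscale ring_map_const_const)

lemma psubst_left_sub: "psubst (left_sub F) p q = at_del (- p) F"
proof -
  have "(\<lambda>F. psubst (left_sub F) p q) = at_del (psubst (left_sub del0) p q)"
    by (rule at_del_unique)
       (intro ring_map_comp[OF ring_map_left_right(1)] ring_map_psubst | simp)+
  then show ?thesis
    unfolding left_right_simps psubst_hom psubst_simps at_del_simps by (simp add: fun_eq_iff)
qed

lemma psubst_right_sub: "psubst (right_sub F) p q = at_del (q + p) F"
proof -
  have "(\<lambda>F. psubst (right_sub F) p q) = at_del (psubst (right_sub del0) p q)"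
    by (rule at_del_unique)
       (intro ring_map_comp[OF ring_map_left_right(2)] ring_map_psubst | simp)+
  then show ?thesis
    unfolding left_right_simps psubst_hom psubst_simps at_del_simps by (simp add: fun_eq_iff)
qed

text \<open>
  Since \<open>-(-\<lambda>-\<partial>) = \<partial> + \<lambda>\<close>, the reflection exchanges left conformal linear and conformal linear maps.
\<close>

lemma reflect_left_right:
  "reflect (*) (left_sub F) = right_sub F" "reflect (*) (right_sub F) = left_sub F"
proof -
  have "reflect (*) (left_sub del0) = right_sub del0"
    unfolding left_right_simps reflect_hom reflect_simps by simp
  then have "(\<lambda>F. reflect (*) (left_sub F)) = right_sub"
    by (intro ring_map_poly_eqI ring_map_comp[OF ring_map_left_right(1)] ring_map_left_right ring_map_reflect)
       (simp_all only: left_right_simps reflect_simps)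
  then show 1: "reflect (*) (left_sub F) = right_sub F" for F by (simp add: fun_eq_iff)
  show "reflect (*) (right_sub F) = left_sub F" by (simp flip: 1)
qed

lemma semilinear_bsubst_left:
  assumes "module s" "semilinear u (pscale s) left_sub f"
  shows "semilinear u (bscale s) (at_del (- p)) (\<lambda>a. bsubst s p (f a))"
  using semilinear_comp[OF assms(2) semilinear_bsubst[OF assms(1)]] by (simp add: psubst_left_sub)

lemma semilinear_bsubst_right:
  assumes "module s" "semilinear u (pscale s) right_sub f"
  shows "semilinear u (bscale s) (at_del (del + p)) (\<lambda>a. bsubst s p (f a))"
  using semilinear_comp[OF assms(2) semilinear_bsubst[OF assms(1)]] by (simp add: psubst_right_sub)

lemma lin_ext_meval:
  assumes "module s" "F 0 = 0"
  shows "lin_ext s F = meval (bscale s) (meval (bscale s) F lam) mu"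
proof -
  note b = module_bscale[OF assms(1)]
  show ?thesis
    by (simp add: fun_eq_iff lin_ext_def meval_def module.scale_sum_right[OF b] module.scale_scale[OF b]
      mult.commute)
qed

lemma semilinear_lin_ext:
  assumes "module u" "module s" "semilinear u (bscale s) (at_del r) F"
  shows "semilinear (bscale u) (bscale s) (subst_del r) (lin_ext s F)"
proof -
  note b = module_bscale[OF assms(2)]
  have "semilinear (pscale (pscale u)) (bscale s) (subst_del r) (meval (bscale s) (meval (bscale s) F lam) mu)"
    unfolding subst_del_def subst3_def using assms b
    by (intro semilinear_meval ring_map_poly_ev ring_map_at_del module.module_pscale)
  then show ?thesis
    using lin_ext_meval[where F = F, OF assms(2) semilinear_0[OF assms(3)]] by (simp add: bscale_def)
qed

lemma lin_ext_const: "module s \<Longrightarrow> lin_ext s F [:[:m:]:] = F m"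
  by (simp add: lin_ext_def module.scale_one[OF module_bscale])

lemma semilinear_lin_ext_param:
  assumes "module s" "\<And>a. semilinear v (bscale s) \<sigma> (\<lambda>w. F w a)"
  shows "semilinear v (bscale s) \<sigma> (\<lambda>w. lin_ext s (F w) u)"
  unfolding lin_ext_def by (intro semilinear_sums semilinear_scaled module_bscale assms)

section \<open>Conformal maps and products in two variables\<close>

text \<open>
  Names for the three variables that the simplifier does not see through: the polynomials
  themselves would be normalized to explicit coefficient lists, and sums such as \<open>-\<lambda>-\<mu>-\<partial>\<close> would no longer
  be recognizable as such.
\<close>

definition Del :: "complex poly poly poly" where "Del = del"
definition Lam :: "complex poly poly poly" where "Lam = lam"
definition Mu :: "complex poly poly poly" where "Mu = mu"

lemma ring_map_subst_del: "ring_map (subst_del d)"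
  unfolding subst_del_def by (rule ring_map_subst3)

lemmas subst_del_hom [simp] = ring_mapD[OF ring_map_subst_del]

lemma subst_del_simps [simp]:
  "subst_del d [:[:a:]:] = at_del d a" "subst_del d Del = d" "subst_del d Lam = Lam" "subst_del d Mu = Mu"
  "subst_del d (psubst F p q) = psubst F (subst_del d p) (subst_del d q)"
  "subst_del d (at_del r a) = at_del (subst_del d r) a"
  unfolding subst_del_def Del_def Lam_def Mu_def
  by (simp_all only: subst3_simps at_del_simps subst3_psubst subst3_at_del)

lemma subst_del_Del: "subst_del Del q = q"
  unfolding subst_del_def Del_def by (simp add: subst3_id)

lemma subst_del_subst_del [simp]: "subst_del d (subst_del r q) = subst_del (subst_del d r) q"
  unfolding subst_del_def by (simp only: subst3_subst3 subst3_simps)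

lemmas semilinear_bsubst' = semilinear_bsubst[folded Del_def]
lemmas semilinear_bsubst_right' = semilinear_bsubst_right[folded Del_def]
lemmas bsubst_reflect' = bsubst_reflect[folded Del_def]

lemma capp_const: "module s \<Longrightarrow> capp s f p [:[:a:]:] = bsubst s p (f a)"
  by (simp add: capp_def lin_ext_const)

lemma semilinear_capp_right:
  assumes "module u" "module s" "semilinear u (pscale s) right_sub f"
  shows "semilinear (bscale u) (bscale s) (subst_del (Del + p)) (capp s f p)"
  unfolding capp_def by (intro semilinear_lin_ext semilinear_bsubst_right' assms)

lemma happ_const: "happ h p [:[:a:]:] q = psubst (h a) p q"
  by (simp add: happ_def lin_ext_const module_ring_mult)

lemma semilinear_happ:
  assumes "module u" "semilinear u (*) left_sub h"
  shows "semilinear (bscale u) (*) (subst_del (- p)) (\<lambda>v. happ h p v q)"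
proof -
  have "semilinear u (*) (at_del (- p)) (\<lambda>a. psubst (h a) p q)"
    by (simp add: semilinear_def semilinearD[OF assms(2)] psubst_left_sub)
  then show ?thesis
    using semilinear_lin_ext[OF assms(1) module_ring_mult, of "- p"]
    unfolding happ_def bscale_mult by blast
qed

lemma semilinear_capp2_left:
  assumes "module u" "module s" "\<And>b. semilinear u (pscale s) left_sub (\<lambda>a. f a b)"
  shows "semilinear (bscale u) (bscale s) (subst_del (- p)) (\<lambda>a. capp2 s f p a b)"
  unfolding capp2_def
proof (rule semilinear_lin_ext[OF assms(1,2)])
  show "semilinear u (bscale s) (at_del (- p)) (\<lambda>a. capp s (f a) p b)"
    unfolding capp_def by (intro semilinear_lin_ext_param semilinear_bsubst_left assms)
qed

lemma semilinear_capp2_right: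
  assumes "module v" "module s" "\<And>a. semilinear v (pscale s) right_sub (f a)"
  shows "semilinear (bscale v) (bscale s) (subst_del (Del + p)) (\<lambda>b. capp2 s f p a b)"
  unfolding capp2_def by (intro semilinear_lin_ext_param semilinear_capp_right assms)

lemma capp2_const: "module s \<Longrightarrow> capp2 s f p [:[:a:]:] [:[:b:]:] = bsubst s p (f a b)"
  by (simp add: capp2_def lin_ext_const capp_const)

text \<open>
  Under an operation that replaces \<open>\<partial>\<close> by \<open>r\<close>, the substituted expression matters only up to the
  same replacement. For instance \<open>(T\<^bsub>-\<mu>-\<partial>\<^esub> a)\<^bsub>\<lambda>+\<mu>\<^esub> b = (T\<^bsub>\<lambda>\<^esub> a)\<^bsub>\<lambda>+\<mu>\<^esub> b\<close>, as \<open>\<partial>\<close> acts as \<open>-\<lambda>-\<mu>\<close> on the left factor.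
\<close>

lemma semilinear_bsubst_cong:
  assumes "module s" "semilinear (bscale s) t (subst_del r) G" "subst_del r p = subst_del r p'"
  shows "G (bsubst s p f) = G (bsubst s p' f)"
proof (rule semilinear_poly_eq[OF assms(1), where f = f])
  show "semilinear (pscale s) t (\<lambda>F. psubst F (subst_del r p') r) (\<lambda>f. G (bsubst s p f))"
    "semilinear (pscale s) t (\<lambda>F. psubst F (subst_del r p') r) (\<lambda>f. G (bsubst s p' f))"
    using semilinear_comp[OF semilinear_bsubst'[OF assms(1), of p] assms(2)]
      semilinear_comp[OF semilinear_bsubst'[OF assms(1), of p'] assms(2)] assms(3) by simp_all
qed (simp add: bsubst_const assms)

text \<open>
  The exchange of \<open>\<lambda>\<close> and \<open>\<mu>\<close> on \<open>\<complex>[\<lambda>,\<mu>,\<partial>]\<close> and on \<open>M[\<lambda>,\<mu>]\<close>.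
\<close>

definition swap :: "complex poly poly poly \<Rightarrow> complex poly poly poly" where
  "swap = subst3 del mu lam"

definition swap_module ::
  "(complex poly \<Rightarrow> 'm::ab_group_add \<Rightarrow> 'm) \<Rightarrow> 'm poly poly \<Rightarrow> 'm poly poly" where
  "swap_module s = meval (bscale s) (meval (bscale s) (\<lambda>m. [:[:m:]:]) mu) lam"

lemma ring_map_swap: "ring_map swap"
  unfolding swap_def by (rule ring_map_subst3)

lemmas swap_hom [simp] = ring_mapD[OF ring_map_swap]

lemma at_del_del: "at_del del a = [:[:a:]:]"
  using subst_del_Del[of "[:[:a:]:]"] by (simp only: subst_del_simps Del_def)

lemma swap_simps [simp]:
  "swap [:[:a:]:] = [:[:a:]:]" "swap Del = Del" "swap Lam = Mu" "swap Mu = Lam"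
  "swap (subst_del r q) = subst_del (swap r) (swap q)"
  unfolding swap_def Lam_def Mu_def Del_def subst_del_def
  by (simp_all only: subst3_simps at_del_simps subst3_subst3 at_del_del)

lemma semilinear_swap:
  assumes "module s" shows "semilinear (bscale s) (bscale s) swap (swap_module s)"
proof -
  have "semilinear (pscale (pscale s)) (bscale s) (poly_ev (poly_ev (\<lambda>a. [:[:a:]:]) mu) lam) (swap_module s)"
    unfolding swap_module_def using assms
    by (intro semilinear_meval ring_map_poly_ev ring_map_const_const module.module_pscale
        semilinear_const_const module_bscale)
  moreover have "swap = poly_ev (poly_ev (\<lambda>a. [:[:a:]:]) mu) lam"
    by (simp add: swap_def subst3_def at_del_del[abs_def])
  ultimately show ?thesis by (simp add: bscale_def)
qed

lemma swap_module_const: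
  assumes "module s" shows "swap_module s [:[:m:]:] = [:[:m:]:]"
proof -
  have "meval (bscale s) (\<lambda>m. [:[:m:]:]) mu (0 :: 'a poly) = 0"
    by (simp add: meval_0 module_bscale assms)
  then show ?thesis by (simp add: swap_module_def meval_const module_bscale assms)
qed

lemma swap_bsubst:
  assumes "module s" shows "swap_module s (bsubst s p f) = bsubst s (swap p) f"
proof (rule semilinear_poly_eq[OF assms, where f = f])
  have "swap (psubst F p del) = psubst F (swap p) del" for F
    unfolding swap_def by (simp only: subst3_psubst subst3_simps at_del_simps)
  then show "semilinear (pscale s) (bscale s) (\<lambda>F. psubst F (swap p) del) (\<lambda>f. swap_module s (bsubst s p f))"
    using semilinear_comp[OF semilinear_bsubst[where p = p] semilinear_swap, OF assms assms]
    by (simp only:)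
qed (simp_all add: bsubst_const swap_module_const semilinear_bsubst assms)

lemma swap_swap: "swap (swap q) = q"
proof -
  have "(\<lambda>q. swap (swap q)) = (\<lambda>q. q)"
    unfolding swap_def subst3_subst3 by (simp only: subst3_simps at_del_simps subst3_id)
  then show ?thesis by (simp add: fun_eq_iff)
qed

lemma swap_module_swap_module:
  assumes "module s" shows "swap_module s (swap_module s u) = u"
proof (rule semilinear_poly_poly_eq[OF assms, where u = u])
  show "semilinear (bscale s) (bscale s) (\<lambda>a. a) (\<lambda>u. swap_module s (swap_module s u))"
    using semilinear_comp[OF semilinear_swap semilinear_swap, OF assms assms]
    by (simp only: swap_swap)
qed (simp_all add: semilinear_id swap_module_const assms)

lemma semilinear_swap_swapped:
  assumes "module s" "module t" "semilinear (bscale s) (bscale t) \<sigma> G"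
  shows "semilinear (bscale s) (bscale t) (\<lambda>a. swap (\<sigma> (swap a))) (\<lambda>u. swap_module t (G (swap_module s u)))"
  by (rule semilinear_comp[OF semilinear_comp[OF semilinear_swap[OF assms(1)] assms(3)] semilinear_swap[OF assms(2)]])

text \<open>
  With the exchange applied to the arguments first, both sides are sesquilinear with parameter
  \<open>swap p\<close> in either argument, so constant arguments suffice.
\<close>

lemma swap_capp2:
  assumes s: "module s" and u: "module u" and v: "module v"
    and l: "\<And>b. semilinear u (pscale s) left_sub (\<lambda>a. f a b)"
    and r: "\<And>a. semilinear v (pscale s) right_sub (f a)"
  shows "swap_module s (capp2 s f p a b) = capp2 s f (swap p) (swap_module u a) (swap_module v b)"
proof -
  have 1: "swap_module s (capp2 s f p (swap_module u a) (swap_module v b)) = capp2 s f (swap p) a b" for a b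
  proof (rule semilinear_poly_poly_eq[OF u, where u = a and t = "bscale s" and \<sigma> = "subst_del (- swap p)"])
    show "semilinear (bscale u) (bscale s) (subst_del (- swap p))
      (\<lambda>a. swap_module s (capp2 s f p (swap_module u a) (swap_module v b)))"
      using semilinear_swap_swapped[OF u s semilinear_capp2_left[OF u s l]] by (simp add: swap_swap)
    show "semilinear (bscale u) (bscale s) (subst_del (- swap p)) (\<lambda>a. capp2 s f (swap p) a b)"
      by (rule semilinear_capp2_left[OF u s l])
    show "swap_module s (capp2 s f p (swap_module u [:[:m:]:]) (swap_module v b)) = capp2 s f (swap p) [:[:m:]:] b"
      for m
    proof (rule semilinear_poly_poly_eq[OF v, where u = b and t = "bscale s" and \<sigma> = "subst_del (Del + swap p)"])
      show "semilinear (bscale v) (bscale s) (subst_del (Del + swap p))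
        (\<lambda>b. swap_module s (capp2 s f p (swap_module u [:[:m:]:]) (swap_module v b)))"
        using semilinear_swap_swapped[OF v s semilinear_capp2_right[OF v s r]] by (simp add: swap_swap)
      show "semilinear (bscale v) (bscale s) (subst_del (Del + swap p)) (\<lambda>b. capp2 s f (swap p) [:[:m:]:] b)"
        by (rule semilinear_capp2_right[OF v s r])
    qed (simp add: swap_module_const capp2_const swap_bsubst s u v)
  qed
  show ?thesis
    using 1[of "swap_module u a" "swap_module v b"] by (simp add: swap_module_swap_module u v)
qed

text \<open>
  Left symmetry is stated for elements of the algebra; the defect is defined on all of \<open>M[\<lambda>,\<mu>]\<close> in order
  to make its sesquilinearity expressible.
\<close>

definition ls_defect ::
  "(complex poly \<Rightarrow> 'm::ab_group_add \<Rightarrow> 'm) \<Rightarrow> ('m \<Rightarrow> 'm \<Rightarrow> 'm poly)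
    \<Rightarrow> 'm poly poly \<Rightarrow> 'm poly poly \<Rightarrow> 'm poly poly \<Rightarrow> 'm poly poly" where
  "ls_defect s f u v w =
     (capp2 s f (Lam + Mu) (capp2 s f Lam u v) w - capp2 s f Lam u (capp2 s f Mu v w))
     - (capp2 s f (Lam + Mu) (capp2 s f Mu v u) w - capp2 s f Mu v (capp2 s f Lam u w))"

lemma lsc_algebra_iff:
  "lsc_algebra s f \<longleftrightarrow> module s \<and> conformal_bilinear s s s f \<and>
     (\<forall>a b c. ls_defect s f [:[:a:]:] [:[:b:]:] [:[:c:]:] = 0)"
  by (simp only: lsc_algebra_def Let_def ls_defect_def Lam_def Mu_def right_minus_eq)

lemma conformal_bilinear_iff:
  "module s \<Longrightarrow> module s' \<Longrightarrow> module t \<Longrightarrow> conformal_bilinear s s' t f \<longleftrightarrow>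
     (\<forall>b. semilinear s (pscale t) left_sub (\<lambda>a. f a b)) \<and> (\<forall>a. semilinear s' (pscale t) right_sub (f a))"
  by (simp add: conformal_bilinear_def left_conformal_linear_iff conformal_linear_iff)

context
  fixes s :: "complex poly \<Rightarrow> 'm::ab_group_add \<Rightarrow> 'm" and f
  assumes s: "module s" and f: "conformal_bilinear s s s f"
begin

lemma semilinear_prd:
  "semilinear (bscale s) (bscale s) (subst_del (- p)) (\<lambda>a. capp2 s f p a b)"
  "semilinear (bscale s) (bscale s) (subst_del (Del + p)) (\<lambda>b. capp2 s f p a b)"
  using f s by (auto simp: conformal_bilinear_iff intro!: semilinear_capp2_left semilinear_capp2_right)

lemmas prd_comp_left = semilinear_comp[OF _ semilinear_prd(1), where \<phi> = "subst_del r" for r]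
lemmas prd_comp_right = semilinear_comp[OF _ semilinear_prd(2), where \<phi> = "subst_del r" for r]

text \<open>
  In each of the four terms the homomorphisms of the inner and of the outer product compose to the
  same one; for the first argument, \<open>\<partial>\<close> becomes \<open>-\<lambda>\<close> directly in three of them and via
  \<open>\<partial> \<mapsto> \<partial> + \<mu> \<mapsto> -(\<lambda> + \<mu>) + \<mu>\<close> in \<open>(v\<^bsub>\<mu>\<^esub> u)\<^bsub>\<lambda>+\<mu>\<^esub> w\<close>.
\<close>

lemma semilinear_ls_defect:
  "semilinear (bscale s) (bscale s) (subst_del (- Lam)) (\<lambda>u. ls_defect s f u v w)"
  "semilinear (bscale s) (bscale s) (subst_del (- Mu)) (\<lambda>v. ls_defect s f u v w)"
  "semilinear (bscale s) (bscale s) (subst_del (Del + Lam + Mu)) (\<lambda>w. ls_defect s f u v w)"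
  unfolding ls_defect_def
  using prd_comp_left[OF semilinear_prd(1)[of Lam v], of "Lam + Mu" w]
    prd_comp_left[OF semilinear_prd(2)[of Mu v], of "Lam + Mu" w]
    semilinear_prd(1)[of Lam "capp2 s f Mu v w"]
    prd_comp_right[OF semilinear_prd(1)[of Lam w], of Mu v]
    prd_comp_left[OF semilinear_prd(2)[of Lam u], of "Lam + Mu" w]
    prd_comp_left[OF semilinear_prd(1)[of Mu u], of "Lam + Mu" w]
    semilinear_prd(1)[of Mu "capp2 s f Lam u w"]
    prd_comp_right[OF semilinear_prd(1)[of Mu w], of Lam u]
    semilinear_prd(2)[of "Lam + Mu" "capp2 s f Lam u v"] semilinear_prd(2)[of "Lam + Mu" "capp2 s f Mu v u"]
    prd_comp_right[OF semilinear_prd(2)[of Mu v], of Lam u]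
    prd_comp_right[OF semilinear_prd(2)[of Lam u], of Mu v]
  by (auto intro!: semilinear_minus module_bscale s simp: add_ac)

lemma swap_ls_defect:
  "swap_module s (ls_defect s f u v w) =
    - ls_defect s f (swap_module s v) (swap_module s u) (swap_module s w)"
  using f s
  by (simp add: ls_defect_def semilinear_diff[OF semilinear_swap] conformal_bilinear_iff
     swap_capp2[where u = s and v = s] add.commute)

lemma ls_defect_flip:
  assumes "ls_defect s f [:[:a:]:] [:[:b:]:] [:[:c:]:] = 0"
  shows "ls_defect s f [:[:b:]:] [:[:a:]:] [:[:c:]:] = 0"
  using swap_ls_defect[of "[:[:a:]:]" "[:[:b:]:]" "[:[:c:]:]"] assms s
  by (simp add: swap_module_const semilinear_0[OF semilinear_swap])

end

section \<open>Extending structures and extensions\<close>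

lemma module_hom_semilinear:
  "module s \<Longrightarrow> module t \<Longrightarrow> module_hom s t f \<longleftrightarrow> semilinear s t (\<lambda>c. c) f"
  by (simp add: module_hom_iff semilinear_def)

text \<open>
  A homomorphism into \<open>Cend\<close> is a map of two arguments that is left conformal linear in the first
  and conformal linear in the second one.
\<close>

lemma hom_to_Cend_iff:
  assumes "module s" "module t"
  shows "hom_to_Cend s t F \<longleftrightarrow>
    (\<forall>a. semilinear t (pscale t) right_sub (F a)) \<and> (\<forall>w. semilinear s (pscale t) left_sub (\<lambda>a. F a w))"
proof -
  have "module (\<lambda>c. s [:c:])" "module (\<lambda>c. pscale t [:[:c:]:])"
    using module_restrict[OF assms(1) ring_map_const]
      module_restrict[OF module.module_pscale[OF assms(2)] ring_map_const_const] .
  then have "left_conformal_linear s t (\<lambda>a. F a w) \<longleftrightarrow>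
     (\<forall>a b. F (a + b) w = F a w + F b w) \<and>
     (\<forall>c a. F (s [:c:] a) w = pscale t [:[:c:]:] (F a w)) \<and>
     (\<forall>a. F (s del0 a) w = pscale t (- lam1) (F a w))" for w
    by (simp add: left_conformal_linear_def clinear_def module_hom_iff)
  then show ?thesis
    unfolding hom_to_Cend_def left_conformal_linear_iff[OF assms, symmetric]
      conformal_linear_iff[OF assms(2) assms(2), symmetric]
    by blast
qed

lemma semilinear_reflect_left:
  "module s \<Longrightarrow> semilinear u (pscale s) left_sub f \<Longrightarrow> semilinear u (pscale s) right_sub (\<lambda>a. reflect s (f a))"
  using semilinear_comp[OF _ semilinear_reflect] by (fastforce simp: reflect_left_right)

lemma semilinear_reflect_right:
  "module s \<Longrightarrow> semilinear u (pscale s) right_sub f \<Longrightarrow> semilinear u (pscale s) left_sub (\<lambda>a. reflect s (f a))"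
  using semilinear_comp[OF _ semilinear_reflect] by (fastforce simp: reflect_left_right)

(* Quantifiers over elements of R \<oplus> Q stay unsplit, so that the facts below apply to an element e as rewrite rules. *)
declare split_paired_All [simp del]

locale module_pair =
  fixes sR :: "complex poly \<Rightarrow> 'r::ab_group_add \<Rightarrow> 'r" and pr :: "'r \<Rightarrow> 'r \<Rightarrow> 'r poly"
    and sQ :: "complex poly \<Rightarrow> 'q::ab_group_add \<Rightarrow> 'q"
  assumes pr: "lsc_algebra sR pr" and module_Q: "module sQ"
begin

abbreviation S where "S \<equiv> sum_scale sR sQ"

lemma module_R: "module sR" using pr by (simp add: lsc_algebra_def)

lemma module_S: "module S"
  using module_R module_Q
  by (simp add: module_def sum_scale_def)

lemmas mods = module_R module_Q module_S

lemma linear_Pair: "semilinear sR S (\<lambda>c. c) (\<lambda>a. (a, 0))" "semilinear sQ S (\<lambda>c. c) (\<lambda>y. (0, y))"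
  and linear_fst: "semilinear S sR (\<lambda>c. c) fst" and linear_snd: "semilinear S sQ (\<lambda>c. c) snd"
  by (simp_all add: semilinear_def sum_scale_def module.scale_zero_right mods)

lemma linear_inR: "semilinear (pscale sR) (pscale S) (\<lambda>c. c) inR"
  unfolding inR_def by (intro semilinear_map_poly mods linear_Pair)

lemma linear_inQ: "semilinear (pscale sQ) (pscale S) (\<lambda>c. c) inQ"
  unfolding inQ_def by (intro semilinear_map_poly mods linear_Pair)

lemma linear_map_fst: "semilinear (pscale S) (pscale sR) (\<lambda>c. c) (map_poly fst)"
  by (intro semilinear_map_poly mods linear_fst)

lemma linear_map_snd: "semilinear (pscale S) (pscale sQ) (\<lambda>c. c) (map_poly snd)"
  by (intro semilinear_map_poly mods linear_snd)

lemmas lins [simp] = semilinearD(1-5)[OF linear_inR] semilinearD(1-5)[OF linear_inQ]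

lemma coeff_inR [simp]: "coeff (inR f) n = (coeff f n, 0)" and coeff_inQ [simp]: "coeff (inQ g) n = (0, coeff g n)"
  by (simp_all add: inR_def inQ_def coeff_map_poly zero_prod_def)

lemma map_fst_inR [simp]: "map_poly fst (inR f) = f" "map_poly fst (inQ g) = 0"
  "map_poly snd (inR f) = 0" "map_poly snd (inQ g) = g"
  by (auto intro!: poly_eqI simp: coeff_map_poly)

lemma inR_inQ_eq_iff:
  fixes f f' :: "'r poly" and g g' :: "'q poly"
  shows "inR f + inQ g = inR f' + inQ g' \<longleftrightarrow> f = f' \<and> g = g'"
  (is "?e = ?e' \<longleftrightarrow> _")
proof
  assume "?e = ?e'"
  then have "map_poly fst ?e = map_poly fst ?e'" "map_poly snd ?e = map_poly snd ?e'" by simp_all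
  then show "f = f' \<and> g = g'"
    by (simp_all add: semilinear_add[OF linear_map_fst] semilinear_add[OF linear_map_snd])
qed simp

lemma inR_inQ_decomp: "inR (map_poly fst e) + inQ (map_poly snd e) = e"
  by (rule poly_eqI) (simp add: coeff_map_poly)

text \<open>
  The conformal bilinear products that extend the product of \<open>R\<close>, left-symmetric or not: the block and
  generator decompositions hold before left symmetry is imposed, and left symmetry is
  transported along them afterwards.
\<close>

definition extending_products where
  "extending_products = {m. conformal_bilinear S S S m \<and> (\<forall>a b. m (a, 0) (b, 0) = inR (pr a b))}"

lemma extensions_iff: "m \<in> extensions sR pr sQ \<longleftrightarrow> m \<in> extending_products \<and> lsc_algebra S m"
  by (auto simp: extensions_def extending_products_def lsc_algebra_def)

lemma extending_products_semilinear:
  assumes "m \<in> extending_products"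
  shows "semilinear S (pscale S) left_sub (\<lambda>e. m e f)" "semilinear S (pscale S) right_sub (m e)"
  using assms conformal_bilinear_iff[OF module_S module_S module_S, of m]
  unfolding extending_products_def by blast+

lemma pr_semilinear:
  "semilinear sR (pscale sR) left_sub (\<lambda>a. pr a b)" "semilinear sR (pscale sR) right_sub (pr a)"
  using pr conformal_bilinear_iff[OF module_R module_R module_R, of pr] by (auto simp: lsc_algebra_def)

lemma extending_products_split:
  assumes "m \<in> extending_products"
  shows "m (a, y) (b, z) = m (a, 0) (b, 0) + m (a, 0) (0, z) + m (0, y) (b, 0) + m (0, y) (0, z)"
proof -
  note l = semilinear_add[OF extending_products_semilinear(1)[OF assms], of "(a, 0)" "(0, y)"]
    and r = semilinear_add[OF extending_products_semilinear(2)[OF assms], of _ "(b, 0)" "(0, z)"]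
  show ?thesis using l r by simp
qed

lemma extending_datum_iff:
  "extending_datum sR sQ \<Omega> \<longleftrightarrow>
    (\<forall>a. semilinear sQ (pscale sQ) right_sub (e_l \<Omega> a)) \<and> (\<forall>w. semilinear sR (pscale sQ) left_sub (\<lambda>a. e_l \<Omega> a w)) \<and>
    (\<forall>a. semilinear sQ (pscale sQ) right_sub (e_r \<Omega> a)) \<and> (\<forall>w. semilinear sR (pscale sQ) left_sub (\<lambda>a. e_r \<Omega> a w)) \<and>
    (\<forall>a. semilinear sR (pscale sR) right_sub (e_phi \<Omega> a)) \<and> (\<forall>w. semilinear sQ (pscale sR) left_sub (\<lambda>a. e_phi \<Omega> a w)) \<and>
    (\<forall>a. semilinear sR (pscale sR) right_sub (e_psi \<Omega> a)) \<and> (\<forall>w. semilinear sQ (pscale sR) left_sub (\<lambda>a. e_psi \<Omega> a w)) \<and>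
    (\<forall>b. semilinear sQ (pscale sR) left_sub (\<lambda>a. e_g \<Omega> a b)) \<and> (\<forall>a. semilinear sQ (pscale sR) right_sub (e_g \<Omega> a)) \<and>
    (\<forall>b. semilinear sQ (pscale sQ) left_sub (\<lambda>a. e_circ \<Omega> a b)) \<and> (\<forall>a. semilinear sQ (pscale sQ) right_sub (e_circ \<Omega> a))"
  by (simp add: extending_datum_def hom_to_Cend_iff conformal_bilinear_iff mods conj_ac)

lemma natural_prod_blocks:
  assumes "extending_datum sR sQ \<Omega>"
  shows "natural_prod sR pr sQ \<Omega> (a, 0) (b, 0) = inR (pr a b)"
    "natural_prod sR pr sQ \<Omega> (a, 0) (0, z) = inR (reflect sR (e_psi \<Omega> z a)) + inQ (e_l \<Omega> a z)"
    "natural_prod sR pr sQ \<Omega> (0, y) (b, 0) = inR (e_phi \<Omega> y b) + inQ (reflect sQ (e_r \<Omega> b y))"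
    "natural_prod sR pr sQ \<Omega> (0, y) (0, z) = inR (e_g \<Omega> y z) + inQ (e_circ \<Omega> y z)"
proof -
  have z: "e_phi \<Omega> 0 b = 0" "e_phi \<Omega> y 0 = 0" "e_psi \<Omega> 0 b = 0" "e_psi \<Omega> y 0 = 0"
    "e_l \<Omega> 0 y = 0" "e_l \<Omega> a 0 = 0" "e_r \<Omega> 0 y = 0" "e_r \<Omega> a 0 = 0"
    "e_g \<Omega> 0 y = 0" "e_g \<Omega> y 0 = 0" "e_circ \<Omega> 0 y = 0" "e_circ \<Omega> y 0 = 0" for a b y
    using assms unfolding extending_datum_iff by (auto dest: semilinear_0 spec)
  note p = semilinear_0[OF pr_semilinear(1)] semilinear_0[OF pr_semilinear(2)]
    semilinear_0[OF semilinear_reflect[OF module_R]] semilinear_0[OF semilinear_reflect[OF module_Q]]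
  show "natural_prod sR pr sQ \<Omega> (a, 0) (b, 0) = inR (pr a b)"
    "natural_prod sR pr sQ \<Omega> (a, 0) (0, z) = inR (reflect sR (e_psi \<Omega> z a)) + inQ (e_l \<Omega> a z)"
    "natural_prod sR pr sQ \<Omega> (0, y) (b, 0) = inR (e_phi \<Omega> y b) + inQ (reflect sQ (e_r \<Omega> b y))"
    "natural_prod sR pr sQ \<Omega> (0, y) (0, z) = inR (e_g \<Omega> y z) + inQ (e_circ \<Omega> y z)"
    by (simp_all add: natural_prod_def z p Let_def)
qed

lemma natural_prod_extending:
  assumes \<Omega>: "extending_datum sR sQ \<Omega>"
  shows "natural_prod sR pr sQ \<Omega> \<in> extending_products"
proof -
  have l: "semilinear sQ (pscale sR) left_sub (\<lambda>y. e_phi \<Omega> y b)"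
      "semilinear sR (pscale sR) left_sub (\<lambda>a. reflect sR (e_psi \<Omega> z a))"
      "semilinear sQ (pscale sR) left_sub (\<lambda>y. e_g \<Omega> y z)"
      "semilinear sQ (pscale sQ) left_sub (\<lambda>y. e_circ \<Omega> y z)"
      "semilinear sR (pscale sQ) left_sub (\<lambda>a. e_l \<Omega> a z)"
      "semilinear sQ (pscale sQ) left_sub (\<lambda>y. reflect sQ (e_r \<Omega> b y))"
    and r: "semilinear sR (pscale sR) right_sub (\<lambda>b. e_phi \<Omega> y b)"
      "semilinear sQ (pscale sR) right_sub (\<lambda>z. reflect sR (e_psi \<Omega> z a))"
      "semilinear sQ (pscale sR) right_sub (\<lambda>z. e_g \<Omega> y z)"
      "semilinear sQ (pscale sQ) right_sub (\<lambda>z. e_circ \<Omega> y z)"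
      "semilinear sQ (pscale sQ) right_sub (\<lambda>z. e_l \<Omega> a z)"
      "semilinear sR (pscale sQ) right_sub (\<lambda>b. reflect sQ (e_r \<Omega> b y))" for a b y z
    using \<Omega> unfolding extending_datum_iff
    by (simp_all add: semilinear_reflect_left semilinear_reflect_right mods)
  note F = semilinear_comp[OF linear_fst] and G = semilinear_comp[OF linear_snd]
  note R = semilinear_comp[OF _ linear_inR] and Q = semilinear_comp[OF _ linear_inQ]
  note plusS = semilinear_plus[OF module.module_pscale[OF module_S]]
    and plusR = semilinear_plus[OF module.module_pscale[OF module_R]]
    and plusQ = semilinear_plus[OF module.module_pscale[OF module_Q]]
  have 1: "semilinear S (pscale S) left_sub (\<lambda>e. natural_prod sR pr sQ \<Omega> e f)" for f
    unfolding natural_prod_def Let_def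
    by (rule plusS[OF R[OF plusR[OF plusR[OF plusR[OF F[OF pr_semilinear(1)] G[OF l(1)]] F[OF l(2)]] G[OF l(3)]]]
        Q[OF plusQ[OF plusQ[OF G[OF l(4)] F[OF l(5)]] G[OF l(6)]]]])
  have 2: "semilinear S (pscale S) right_sub (\<lambda>f. natural_prod sR pr sQ \<Omega> e f)" for e
    unfolding natural_prod_def Let_def
    by (rule plusS[OF R[OF plusR[OF plusR[OF plusR[OF F[OF pr_semilinear(2)] F[OF r(1)]] G[OF r(2)]] G[OF r(3)]]]
        Q[OF plusQ[OF plusQ[OF G[OF r(4)] G[OF r(5)]] F[OF r(6)]]]])
  show ?thesis
    by (simp add: extending_products_def conformal_bilinear_iff mods 1 2 natural_prod_blocks(1)[OF \<Omega>])
qed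

text \<open>
  The datum is read off from the \<open>R\<close>- and \<open>Q\<close>-components of the blocks \<open>R \<times> Q\<close>, \<open>Q \<times> R\<close>, \<open>Q \<times> Q\<close>. The
  parameters \<open>\<psi>\<close> and \<open>r\<close> are reflected because they enter the product at \<open>-\<lambda>-\<partial>\<close>.
\<close>

lemma natural_prod_onto:
  assumes m: "m \<in> extending_products"
  obtains \<Omega> where "extending_datum sR sQ \<Omega>" "natural_prod sR pr sQ \<Omega> = m"
proof -
  define \<Omega> where "\<Omega> = \<lparr>
    e_phi = \<lambda>y b. map_poly fst (m (0, y) (b, 0)),
    e_psi = \<lambda>y a. reflect sR (map_poly fst (m (a, 0) (0, y))),
    e_l = \<lambda>a y. map_poly snd (m (a, 0) (0, y)),
    e_r = \<lambda>b y. reflect sQ (map_poly snd (m (0, y) (b, 0))),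
    e_g = \<lambda>y z. map_poly fst (m (0, y) (0, z)),
    e_circ = \<lambda>y z. map_poly snd (m (0, y) (0, z)) \<rparr>"
  note l = extending_products_semilinear(1)[OF m] and r = extending_products_semilinear(2)[OF m]
  note l1 = semilinear_comp[OF linear_Pair(1) l] semilinear_comp[OF linear_Pair(2) l]
    semilinear_comp[OF linear_Pair(1) r] semilinear_comp[OF linear_Pair(2) r]
  note l2 = l1[THEN semilinear_comp, OF linear_map_fst] l1[THEN semilinear_comp, OF linear_map_snd]
  have d: "extending_datum sR sQ \<Omega>"
    unfolding extending_datum_iff \<Omega>_def
    by (simp add: l2 semilinear_reflect_left semilinear_reflect_right mods)
  have "natural_prod sR pr sQ \<Omega> (a, y) (b, z) = m (a, y) (b, z)" for a y b z
  proof -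
    have "natural_prod sR pr sQ \<Omega> (a, 0) (b, 0) = m (a, 0) (b, 0)"
      using m by (simp add: natural_prod_blocks[OF d] extending_products_def)
    moreover have "natural_prod sR pr sQ \<Omega> (a, 0) (0, z) = m (a, 0) (0, z)"
      "natural_prod sR pr sQ \<Omega> (0, y) (b, 0) = m (0, y) (b, 0)"
      "natural_prod sR pr sQ \<Omega> (0, y) (0, z) = m (0, y) (0, z)"
      unfolding natural_prod_blocks[OF d]
      by (simp_all add: \<Omega>_def reflect_reflect mods inR_inQ_decomp)
    ultimately show ?thesis
      using extending_products_split[OF natural_prod_extending[OF d], of a y b z] extending_products_split[OF m, of a y b z]
      by simp
  qed
  then have "natural_prod sR pr sQ \<Omega> = m" by (auto simp: fun_eq_iff)
  with d that show ?thesis by blast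
qed

lemma natural_prod_image: "natural_prod sR pr sQ ` ext_structures sR pr sQ = extensions sR pr sQ"
proof
  show "natural_prod sR pr sQ ` ext_structures sR pr sQ \<subseteq> extensions sR pr sQ"
    by (auto simp: ext_structures_def extensions_iff natural_prod_extending)
  show "extensions sR pr sQ \<subseteq> natural_prod sR pr sQ ` ext_structures sR pr sQ"
  proof
    fix m assume "m \<in> extensions sR pr sQ"
    then have "m \<in> extending_products" "lsc_algebra S m" by (simp_all add: extensions_iff)
    then show "m \<in> natural_prod sR pr sQ ` ext_structures sR pr sQ"
      by (metis (mono_tags, lifting) natural_prod_onto ext_structures_def mem_Collect_eq image_eqI)
  qed
qed

definition triangular :: "('q \<Rightarrow> 'r) \<Rightarrow> ('q \<Rightarrow> 'q) \<Rightarrow> 'r \<times> 'q \<Rightarrow> 'r \<times> 'q" where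
  "triangular u v e = (fst e + u (snd e), v (snd e))"

lemma linear_triangular:
  "semilinear S S (\<lambda>c. c) (triangular u v) \<longleftrightarrow> semilinear sQ sR (\<lambda>c. c) u \<and> semilinear sQ sQ (\<lambda>c. c) v"
proof
  assume *: "semilinear S S (\<lambda>c. c) (triangular u v)"
  have "(\<lambda>y. fst (triangular u v (0, y))) = u" "(\<lambda>y. snd (triangular u v (0, y))) = v"
    by (simp_all add: triangular_def)
  then show "semilinear sQ sR (\<lambda>c. c) u \<and> semilinear sQ sQ (\<lambda>c. c) v"
    using semilinear_comp[OF semilinear_comp[OF linear_Pair(2) *] linear_fst]
      semilinear_comp[OF semilinear_comp[OF linear_Pair(2) *] linear_snd] by simp
next
  assume "semilinear sQ sR (\<lambda>c. c) u \<and> semilinear sQ sQ (\<lambda>c. c) v"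
  then show "semilinear S S (\<lambda>c. c) (triangular u v)"
    by (auto simp: semilinear_def triangular_def sum_scale_def module.scale_right_distrib module_R)
qed

lemma bij_triangular: "bij (triangular u v) \<longleftrightarrow> bij v"
proof
  assume b: "bij (triangular u v)"
  have "v y = v z \<Longrightarrow> y = z" for y z
    using bij_is_inj[OF b, THEN injD, of "(- u y, y)" "(- u z, z)"] by (simp add: triangular_def)
  moreover have "\<exists>y. z = v y" for z
    using surjD[OF bij_is_surj[OF b], of "(0, z)"] by (auto simp: triangular_def)
  ultimately show "bij v" by (auto simp: bij_def inj_def surj_def)
next
  assume b: "bij v"
  have "triangular u v (a - u (inv v y), inv v y) = (a, y)" for a y
    using b by (simp add: triangular_def bij_is_surj surj_f_inv_f)
  then have "surj (triangular u v)" by (metis surjI surj_def surj_pair)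
  moreover have "inj (triangular u v)"
    by (auto simp: triangular_def intro!: injI dest!: injD[OF bij_is_inj[OF b]])
  ultimately show "bij (triangular u v)" by (simp add: bij_def)
qed

lemma stabilizing_triangular:
  assumes "semilinear S S (\<lambda>c. c) \<phi>" "\<And>a. \<phi> (a, 0) = (a, 0)"
  shows "\<phi> = triangular (\<lambda>y. fst (\<phi> (0, y))) (\<lambda>y. snd (\<phi> (0, y)))"
proof
  fix e show "\<phi> e = triangular (\<lambda>y. fst (\<phi> (0, y))) (\<lambda>y. snd (\<phi> (0, y))) e"
    using semilinear_add[OF assms(1), of "(fst e, 0)" "(0, snd e)"] assms(2)[of "fst e"]
    by (simp add: triangular_def prod_eq_iff)
qed

lemma map_triangular:
  assumes "semilinear sQ sR (\<lambda>c. c) u" "semilinear sQ sQ (\<lambda>c. c) v"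
  shows "map_poly (triangular u v) (inR f + inQ g) = inR (f + map_poly u g) + inQ (map_poly v g)"
proof -
  have "triangular u v 0 = 0"
    by (simp add: triangular_def semilinear_0[OF assms(1)] semilinear_0[OF assms(2)] zero_prod_def)
  then show ?thesis by (intro poly_eqI) (simp add: coeff_map_poly triangular_def
    semilinear_0[OF assms(1)] semilinear_0[OF assms(2)])
qed

text \<open>
  Compatibility with the products is additive in both arguments, hence can be tested on the blocks; on
  \<open>R \<times> R\<close> it is automatic, and the two components of the other three blocks are the six conditions that
  define the equivalence of extending structures.
\<close>

lemma stabilizing_iso_triangular_iff:
  assumes \<Omega>: "extending_datum sR sQ \<Omega>" and \<Omega>': "extending_datum sR sQ \<Omega>'"
  shows "stabilizing_iso sR sQ (natural_prod sR pr sQ \<Omega>) (natural_prod sR pr sQ \<Omega>') (triangular u v)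
    \<longleftrightarrow> ext_equiv_via sR pr sQ \<Omega> \<Omega>' u v"
proof (cases "semilinear sQ sR (\<lambda>c. c) u \<and> semilinear sQ sQ (\<lambda>c. c) v")
  case False
  then show ?thesis
    by (auto simp: stabilizing_iso_def ext_equiv_via_def module_hom_semilinear mods linear_triangular)
next
  case True
  let ?m = "natural_prod sR pr sQ \<Omega>" and ?m' = "natural_prod sR pr sQ \<Omega>'" and ?\<phi> = "triangular u v"
  note m = natural_prod_extending[OF \<Omega>] and m' = natural_prod_extending[OF \<Omega>']
  note b = natural_prod_blocks[OF \<Omega>] natural_prod_blocks[OF \<Omega>']
  note t = map_triangular[OF True[THEN conjunct1] True[THEN conjunct2]]
  have t0: "u 0 = 0" "v 0 = 0" "map_poly u 0 = 0" "map_poly v 0 = 0"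
    using True by (auto dest: semilinear_0)
  have \<phi>: "?\<phi> (a, 0) = (a, 0)" "?\<phi> (0, y) = (u y, v y)" for a y by (simp_all add: triangular_def t0)
  have lin: "semilinear (pscale S) (pscale S) (\<lambda>c. c) (map_poly ?\<phi>)"
    using True by (intro semilinear_map_poly mods) (simp add: linear_triangular)
  have z: "(inR f :: ('r \<times> 'q) poly) = inR f + inQ 0" for f by simp
  have R: "map_poly ?\<phi> (?m (a, 0) (b, 0)) = ?m' (?\<phi> (a, 0)) (?\<phi> (b, 0))" for a b
    unfolding \<phi> b by (subst z) (simp only: t t0, simp)
  have RQ: "map_poly ?\<phi> (?m (a, 0) (0, y)) = ?m' (?\<phi> (a, 0)) (?\<phi> (0, y)) \<longleftrightarrow>
      reflect sR (e_psi \<Omega> y a) + map_poly u (e_l \<Omega> a y) = pr a (u y) + reflect sR (e_psi \<Omega>' (v y) a) \<and>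
      map_poly v (e_l \<Omega> a y) = e_l \<Omega>' a (v y)" for a y
  proof -
    have "?m' (a, 0) (u y, v y) = inR (pr a (u y) + reflect sR (e_psi \<Omega>' (v y) a)) + inQ (e_l \<Omega>' a (v y))"
      using semilinear_add[OF extending_products_semilinear(2)[OF m'], of "(a, 0)" "(u y, 0)" "(0, v y)"]
      by (simp add: b)
    then show ?thesis unfolding \<phi> b t by (simp only: inR_inQ_eq_iff)
  qed
  have QR: "map_poly ?\<phi> (?m (0, y) (a, 0)) = ?m' (?\<phi> (0, y)) (?\<phi> (a, 0)) \<longleftrightarrow>
      e_phi \<Omega> y a + map_poly u (reflect sQ (e_r \<Omega> a y)) = pr (u y) a + e_phi \<Omega>' (v y) a \<and>
      map_poly v (reflect sQ (e_r \<Omega> a y)) = reflect sQ (e_r \<Omega>' a (v y))" for a y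
  proof -
    have "?m' (u y, v y) (a, 0) = inR (pr (u y) a + e_phi \<Omega>' (v y) a) + inQ (reflect sQ (e_r \<Omega>' a (v y)))"
      using semilinear_add[OF extending_products_semilinear(1)[OF m'], of "(u y, 0)" "(0, v y)" "(a, 0)"]
      by (simp add: b)
    then show ?thesis unfolding \<phi> b t by (simp only: inR_inQ_eq_iff)
  qed
  have QQ: "map_poly ?\<phi> (?m (0, y) (0, z)) = ?m' (?\<phi> (0, y)) (?\<phi> (0, z)) \<longleftrightarrow>
      e_g \<Omega> y z + map_poly u (e_circ \<Omega> y z)
          = pr (u y) (u z) + e_phi \<Omega>' (v y) (u z) + reflect sR (e_psi \<Omega>' (v z) (u y)) + e_g \<Omega>' (v y) (v z) \<and>
      map_poly v (e_circ \<Omega> y z)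
          = reflect sQ (e_r \<Omega>' (u z) (v y)) + e_l \<Omega>' (u y) (v z) + e_circ \<Omega>' (v y) (v z)" for y z
  proof -
    have "?m' (u y, v y) (u z, v z) =
      inR (pr (u y) (u z) + e_phi \<Omega>' (v y) (u z) + reflect sR (e_psi \<Omega>' (v z) (u y)) + e_g \<Omega>' (v y) (v z))
      + inQ (reflect sQ (e_r \<Omega>' (u z) (v y)) + e_l \<Omega>' (u y) (v z) + e_circ \<Omega>' (v y) (v z))"
      by (simp add: extending_products_split[OF m', of "u y" "v y" "u z" "v z"] b)
    then show ?thesis unfolding \<phi> b t by (simp only: inR_inQ_eq_iff)
  qed
  have "(\<forall>e f. map_poly ?\<phi> (?m e f) = ?m' (?\<phi> e) (?\<phi> f)) \<longleftrightarrow>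
    (\<forall>a y. map_poly ?\<phi> (?m (a, 0) (0, y)) = ?m' (?\<phi> (a, 0)) (?\<phi> (0, y))) \<and>
    (\<forall>a y. map_poly ?\<phi> (?m (0, y) (a, 0)) = ?m' (?\<phi> (0, y)) (?\<phi> (a, 0))) \<and>
    (\<forall>y z. map_poly ?\<phi> (?m (0, y) (0, z)) = ?m' (?\<phi> (0, y)) (?\<phi> (0, z)))"
    (is "_ \<longleftrightarrow> ?gens")
  proof
    assume g: ?gens
    have add: "?\<phi> (a, y) = ?\<phi> (a, 0) + ?\<phi> (0, y)" for a y by (simp add: triangular_def t0)
    have "map_poly ?\<phi> (?m (a, y) (b, z)) = ?m' (?\<phi> (a, y)) (?\<phi> (b, z))" for a y b z
      unfolding extending_products_split[OF m, of a y b z] add[of a y] add[of b z]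
        semilinear_add[OF lin] semilinear_add[OF extending_products_semilinear(1)[OF m']]
        semilinear_add[OF extending_products_semilinear(2)[OF m']]
      using g R by simp
    then show "\<forall>e f. map_poly ?\<phi> (?m e f) = ?m' (?\<phi> e) (?\<phi> f)" by auto
  qed simp
  then show ?thesis
    unfolding stabilizing_iso_def ext_equiv_via_def RQ QR QQ
    using True by (auto simp: module_hom_semilinear mods linear_triangular bij_triangular \<phi>)
qed

text \<open>
  Every isomorphism that fixes \<open>R\<close> is triangular, and its diagonal part \<open>v\<close> is the map that it induces on
  \<open>Q\<close>; so co-stabilizing isomorphisms are those with \<open>v = id\<close>.
\<close>

lemma ext_rel_iff:
  assumes \<Omega>: "\<Omega> \<in> ext_structures sR pr sQ" and \<Omega>': "\<Omega>' \<in> ext_structures sR pr sQ"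
  defines "m \<equiv> natural_prod sR pr sQ \<Omega>" and "m' \<equiv> natural_prod sR pr sQ \<Omega>'"
  shows "(\<Omega>, \<Omega>') \<in> ext_eq sR pr sQ \<longleftrightarrow> (m, m') \<in> cext_eq sR pr sQ"
    and "(\<Omega>, \<Omega>') \<in> ext_approx sR pr sQ \<longleftrightarrow> (m, m') \<in> cext_approx sR pr sQ"
proof -
  have d: "extending_datum sR sQ \<Omega>" "extending_datum sR sQ \<Omega>'"
    using \<Omega> \<Omega>' by (simp_all add: ext_structures_def)
  have m: "m \<in> extensions sR pr sQ" "m' \<in> extensions sR pr sQ"
    using \<Omega> \<Omega>' natural_prod_image unfolding m_def m'_def by auto
  note tri = stabilizing_iso_triangular_iff[OF d, folded m_def m'_def]
  have form: "\<exists>u v. \<phi> = triangular u v" if "stabilizing_iso sR sQ m m' \<phi>" for \<phi>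
    using stabilizing_triangular that by (metis stabilizing_iso_def module_hom_semilinear module_S)
  have "(\<exists>u v. ext_equiv_via sR pr sQ \<Omega> \<Omega>' u v) \<longleftrightarrow> (\<exists>\<phi>. stabilizing_iso sR sQ m m' \<phi>)"
    using tri form by metis
  then show "(\<Omega>, \<Omega>') \<in> ext_eq sR pr sQ \<longleftrightarrow> (m, m') \<in> cext_eq sR pr sQ"
    using \<Omega> \<Omega>' m by (simp add: ext_eq_def cext_eq_def)
  have "snd \<circ> triangular u v = snd \<longleftrightarrow> v = id" for u v
    by (simp add: fun_eq_iff triangular_def split_paired_All)
  then have "(\<exists>u. ext_equiv_via sR pr sQ \<Omega> \<Omega>' u id) \<longleftrightarrow> (\<exists>\<phi>. stabilizing_iso sR sQ m m' \<phi> \<and> snd \<circ> \<phi> = snd)"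
    using tri form by metis
  then show "(\<Omega>, \<Omega>') \<in> ext_approx sR pr sQ \<longleftrightarrow> (m, m') \<in> cext_approx sR pr sQ"
    using \<Omega> \<Omega>' m by (simp add: ext_approx_def cext_approx_def)
qed

lemma stabilizing_iso_refl: "stabilizing_iso sR sQ m m id"
  by (simp add: stabilizing_iso_def module_hom_semilinear mods semilinear_def)

lemma stabilizing_iso_trans:
  assumes "stabilizing_iso sR sQ m m' \<phi>" "stabilizing_iso sR sQ m' m'' \<psi>"
  shows "stabilizing_iso sR sQ m m'' (\<psi> \<circ> \<phi>)"
proof -
  have l: "semilinear S S (\<lambda>c. c) \<phi>" "semilinear S S (\<lambda>c. c) \<psi>"
    using assms by (auto simp: stabilizing_iso_def module_hom_semilinear mods)
  have "map_poly (\<psi> \<circ> \<phi>) f = map_poly \<psi> (map_poly \<phi> f)" for f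
    by (rule poly_eqI) (simp add: coeff_map_poly semilinear_0[OF l(1)] semilinear_0[OF l(2)])
  moreover have "semilinear S S (\<lambda>c. c) (\<psi> \<circ> \<phi>)"
    using semilinear_comp[OF l] by (simp only: comp_def)
  moreover have "bij (\<psi> \<circ> \<phi>)"
    using assms by (intro bij_comp) (simp_all add: stabilizing_iso_def)
  ultimately show ?thesis
    using assms unfolding stabilizing_iso_def module_hom_semilinear[OF module_S module_S]
    by simp
qed

lemma stabilizing_iso_sym:
  assumes "stabilizing_iso sR sQ m m' \<phi>"
  shows "stabilizing_iso sR sQ m' m (inv \<phi>)"
proof -
  have l: "semilinear S S (\<lambda>c. c) \<phi>" and b: "bij \<phi>" and z: "\<phi> (a, 0) = (a, 0)"
    and h: "map_poly \<phi> (m e f) = m' (\<phi> e) (\<phi> f)" for a e f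
    using assms by (auto simp: stabilizing_iso_def module_hom_semilinear mods)
  have i: "\<phi> (inv \<phi> e) = e" "inv \<phi> (\<phi> e) = e" for e
    using b by (simp_all add: bij_is_surj surj_f_inv_f bij_is_inj)
  have l': "semilinear S S (\<lambda>c. c) (inv \<phi>)"
    unfolding semilinear_def by (metis i semilinear_add[OF l] semilinear_scale[OF l])
  have "map_poly (inv \<phi>) (map_poly \<phi> f) = f" for f
    by (rule poly_eqI) (simp add: coeff_map_poly semilinear_0[OF l] semilinear_0[OF l'] i)
  then have "map_poly (inv \<phi>) (m' e f) = m (inv \<phi> e) (inv \<phi> f)" for e f
    using h[of "inv \<phi> e" "inv \<phi> f"] by (metis i(1))
  moreover have "inv \<phi> (a, 0) = (a, 0)" for a using i(2)[of "(a, 0)"] z by simp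
  ultimately show ?thesis
    using l' b by (simp add: stabilizing_iso_def module_hom_semilinear mods bij_imp_bij_inv)
qed

lemma equiv_cext:
  "equiv (extensions sR pr sQ) (cext_eq sR pr sQ)"
  "equiv (extensions sR pr sQ) (cext_approx sR pr sQ)"
proof -
  have s: "snd \<circ> inv \<phi> = snd" if "snd \<circ> \<phi> = snd" "stabilizing_iso sR sQ m m' \<phi>"
    for \<phi> :: "'r \<times> 'q \<Rightarrow> 'r \<times> 'q" and m m'
    using that by (auto simp: stabilizing_iso_def fun_eq_iff bij_is_surj surj_f_inv_f)
      (metis bij_is_surj surj_f_inv_f snd_conv)
  show "equiv (extensions sR pr sQ) (cext_eq sR pr sQ)"
    using stabilizing_iso_refl stabilizing_iso_sym stabilizing_iso_trans
    by (intro equivI) (fastforce simp: cext_eq_def refl_on_def sym_def trans_def)+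
  show "equiv (extensions sR pr sQ) (cext_approx sR pr sQ)"
  proof (intro equivI)
    show "refl_on (extensions sR pr sQ) (cext_approx sR pr sQ)"
      using stabilizing_iso_refl by (fastforce simp: cext_approx_def refl_on_def)
    show "sym (cext_approx sR pr sQ)"
      using stabilizing_iso_sym s by (fastforce simp: cext_approx_def sym_def)
    show "trans (cext_approx sR pr sQ)"
      unfolding cext_approx_def trans_def
    proof clarify
      fix m m' m'' \<phi> \<psi>
      assume "stabilizing_iso sR sQ m m' \<phi>" "snd \<circ> \<phi> = snd" "stabilizing_iso sR sQ m' m'' \<psi>" "snd \<circ> \<psi> = snd"
      then show "\<exists>\<phi>. stabilizing_iso sR sQ m m'' \<phi> \<and> snd \<circ> \<phi> = snd"
        using stabilizing_iso_trans by (metis comp_assoc)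
    qed
  qed (auto simp: cext_approx_def)
qed

end

section \<open>Quotients by preimages of equivalence relations\<close>

lemma bij_betw_quotients:
  assumes s: "equiv B s" and f: "f ` A = B"
    and r: "r = {(a, a'). a \<in> A \<and> a' \<in> A \<and> (f a, f a') \<in> s}"
  shows "equiv A r" and "\<exists>F. bij_betw F (A // r) (B // s) \<and> (\<forall>a\<in>A. F (r `` {a}) = s `` {f a})"
proof -
  have fB: "a \<in> A \<Longrightarrow> f a \<in> B" for a using f by blast
  show e: "equiv A r"
  proof (intro equivI)
    show "r \<subseteq> A \<times> A" by (auto simp: r)
    show "refl_on A r" using s fB by (auto simp: r refl_on_def equiv_def)
    show "sym r" using s by (auto simp: r equiv_def intro!: symI dest: symD)
    show "trans r" using s by (auto simp: r equiv_def intro!: transI dest: transD)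
  qed
  have cong: "r `` {a} = r `` {a'} \<longleftrightarrow> s `` {f a} = s `` {f a'}" if "a \<in> A" "a' \<in> A" for a a'
    using that eq_equiv_class_iff[OF e that] eq_equiv_class_iff[OF s fB fB, OF that] by (simp add: r)
  define F where "F X = s `` {f (SOME a. a \<in> A \<and> r `` {a} = X)}" for X
  have F: "F (r `` {a}) = s `` {f a}" if "a \<in> A" for a
  proof -
    have "(SOME a'. a' \<in> A \<and> r `` {a'} = r `` {a}) \<in> A \<and> r `` {SOME a'. a' \<in> A \<and> r `` {a'} = r `` {a}} = r `` {a}"
      by (rule someI_ex) (use that in blast)
    with cong that show ?thesis unfolding F_def by blast
  qed
  have "bij_betw F (A // r) (B // s)"
    unfolding bij_betw_def
  proof
    show "inj_on F (A // r)"
    proof (rule inj_onI)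
      fix X Y assume "X \<in> A // r" "Y \<in> A // r" and FXY: "F X = F Y"
      then obtain a b where "X = r `` {a}" "a \<in> A" "Y = r `` {b}" "b \<in> A"
        by (auto elim!: quotientE)
      with FXY F cong show "X = Y" by simp
    qed
    have "F ` (A // r) = (\<lambda>a. F (r `` {a})) ` A" by (auto simp: quotient_def)
    also have "\<dots> = (\<lambda>b. s `` {b}) ` f ` A" by (simp add: F image_image)
    also have "\<dots> = B // s" by (auto simp: f quotient_def)
    finally show "F ` (A // r) = B // s" .
  qed
  with F show "\<exists>F. bij_betw F (A // r) (B // s) \<and> (\<forall>a\<in>A. F (r `` {a}) = s `` {f a})" by blast
qed

section \<open>Products on an extension by a free module of rank one\<close>

lemma semilinear_act: "module s \<Longrightarrow> semilinear (*) s (\<lambda>c. c) (\<lambda>p. s p m)"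
  by (simp add: semilinear_def module.scale_left_distrib module.scale_scale)

lemma left_conformal_linear_ring_iff:
  "left_conformal_linear sR (*) h \<longleftrightarrow> semilinear sR (*) left_sub h" if "module sR"
  using left_conformal_linear_iff[OF that module_ring_mult] by (simp add: pscale_mult)

locale flag_extension = module_pair sR pr sQ
  for sR :: "complex poly \<Rightarrow> 'r::ab_group_add \<Rightarrow> 'r" and pr :: "'r \<Rightarrow> 'r \<Rightarrow> 'r poly"
    and sQ :: "complex poly \<Rightarrow> 'q::ab_group_add \<Rightarrow> 'q" +
  fixes V :: "'r set" and x :: 'q
  assumes gen_V: "freely_generated_by sR V" and free_x: "free_rank_one sQ x"
begin

lemma x_cancel: "sQ p x = 0 \<longleftrightarrow> p = 0"
proof
  assume p: "sQ p x = 0"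
  show "p = 0"
  proof (rule ccontr)
    assume "p \<noteq> 0"
    with p have "finite {x} \<and> {x} \<subseteq> {x} \<and> (\<Sum>v\<in>{x}. sQ p v) = 0 \<and> (\<exists>v\<in>{x}. p \<noteq> 0)" by simp
    then have "module.dependent sQ {x}"
      unfolding module.dependent_explicit[OF module_Q] by (intro exI[of _ "{x}"] exI[of _ "\<lambda>_. p"])
    with free_x show False by (simp add: free_rank_one_def)
  qed
qed (simp add: module.scale_zero_left[OF module_Q])

lemma ex_coord: "\<exists>p. sQ p x = y"
  using free_x module.span_singleton[OF module_Q, of x] unfolding free_rank_one_def by (metis UNIV_I imageE)

definition coord :: "'q \<Rightarrow> complex poly" where "coord y = (SOME p. sQ p x = y)"

lemma coord: "sQ (coord y) x = y"
  unfolding coord_def using someI_ex[OF ex_coord] .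

lemma coord_eq: "sQ p x = y \<Longrightarrow> coord y = p"
  using coord[of y] x_cancel[of "coord y - p"] by (simp add: module.scale_left_diff_distrib[OF module_Q])

lemma linear_coord: "semilinear sQ (*) (\<lambda>c. c) coord"
  unfolding semilinear_def
proof (intro conjI allI)
  show "coord (y + z) = coord y + coord z" for y z
    by (rule coord_eq) (simp add: module.scale_left_distrib[OF module_Q] coord)
  show "coord (sQ a y) = a * coord y" for a y
    by (rule coord_eq) (simp add: module.scale_scale[OF module_Q, symmetric] coord)
qed

lemma coord_x: "coord x = 1" by (rule coord_eq) (simp add: module.scale_one[OF module_Q])

lemma V_induct:
  assumes "\<And>a. a \<in> V \<Longrightarrow> P a" "\<And>a b. P a \<Longrightarrow> P b \<Longrightarrow> P (a + b)" "\<And>p a. P a \<Longrightarrow> P (sR p a)"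
  shows "P a"
proof -
  obtain f where f: "\<forall>i. coeff f i \<in> V" "a = (\<Sum>i\<le>degree f. sR (del0 ^ i) (coeff f i))"
    using gen_V unfolding freely_generated_by_def bij_betw_def by (blast dest: equalityD2)
  have "P (\<Sum>i\<le>n. sR (del0 ^ i) (coeff f i))" for n
    by (induction n) (use f(1) assms in \<open>simp_all\<close>)
  with f(2) show ?thesis by simp
qed

lemma semilinear_eq_V:
  assumes "semilinear sR t \<phi> G" "semilinear sR t \<phi> H" "\<And>a. a \<in> V \<Longrightarrow> G a = H a"
  shows "G a = H a"
  by (induction a rule: V_induct)
    (simp_all add: assms(3) semilinear_add[OF assms(1)] semilinear_add[OF assms(2)]
      semilinear_scale[OF assms(1)] semilinear_scale[OF assms(2)])

lemma pair_decomp: "(a, y) = (a, 0) + S (coord y) (0, x)"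
  by (simp add: sum_scale_def coord module.scale_zero_right[OF module_R])

lemma semilinear_eq_gens:
  assumes "semilinear S t \<phi> G" "semilinear S t \<phi> H" "\<And>a. G (a, 0) = H (a, 0)" "G (0, x) = H (0, x)"
  shows "G e = H e"
proof (cases e)
  case (Pair a y)
  show ?thesis unfolding Pair pair_decomp[of a y]
    by (simp only: assms(3,4) semilinear_add[OF assms(1)] semilinear_add[OF assms(2)]
      semilinear_scale[OF assms(1)] semilinear_scale[OF assms(2)])
qed

text \<open>
  The element \<open>f + p x\<close> of \<open>(R \<oplus> \<complex>[\<partial>]x)[\<lambda>]\<close>. Every element has this form with unique \<open>f\<close> and \<open>p\<close>.
\<close>

definition comb :: "'r poly \<Rightarrow> complex poly poly \<Rightarrow> ('r \<times> 'q) poly" where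
  "comb f p = inR f + inQ (pscale sQ p [:x:])"

lemma inQ_const: "inQ [:y:] = [:(0, y):]"
  by (rule poly_eqI) (simp add: coeff_pCons zero_prod_def split: nat.split)

lemma comb_pscale: "comb f p = inR f + pscale S p [:(0, x):]"
  unfolding comb_def by (simp add: inQ_const)

lemma comb_eq_iff: "comb f p = comb f' p' \<longleftrightarrow> f = f' \<and> p = p'"
proof -
  have "pscale sQ p [:x:] = pscale sQ p' [:x:] \<longleftrightarrow> p = p'"
  proof
    assume eq: "pscale sQ p [:x:] = pscale sQ p' [:x:]"
    have "coeff p n = coeff p' n" for n
      using eq coord_eq by (metis coeff_pscale_const[OF module_Q])
    then show "p = p'" by (rule poly_eqI)
  qed simp
  then show ?thesis by (simp only: comb_def inR_inQ_eq_iff)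
qed

lemma comb_add: "comb f p + comb f' p' = comb (f + f') (p + p')"
  by (simp add: comb_pscale module.scale_left_distrib[OF module.module_pscale[OF module_S]])

lemma comb_scale: "pscale S q (comb f p) = comb (pscale sR q f) (q * p)"
  by (simp add: comb_pscale module.scale_right_distrib[OF module.module_pscale[OF module_S]]
    module.scale_scale[OF module.module_pscale[OF module_S]])

lemma ex_comb: "\<exists>f p. e = comb f p"
proof -
  have "pscale sQ (map_poly coord g) [:x:] = g" for g
  proof (rule semilinear_poly_eq[OF module_Q, where t = "pscale sQ" and \<sigma> = "\<lambda>c. c" and f = g])
    show "semilinear (pscale sQ) (pscale sQ) (\<lambda>c. c) (\<lambda>g. pscale sQ (map_poly coord g) [:x:])"
      using semilinear_comp[OF semilinear_map_poly[OF module_Q module_ring_mult linear_coord, unfolded pscale_mult]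
        semilinear_act[OF module.module_pscale[OF module_Q]]] .
  qed (simp_all add: semilinear_id map_poly_const semilinear_0[OF linear_coord]
      module.pscale_const[OF module_Q] coord)
  then show ?thesis unfolding comb_def using inR_inQ_decomp[of e] by metis
qed

lemma semilinear_comb:
  assumes "semilinear s (pscale sR) \<phi> F" "semilinear s (*) \<phi> G"
  shows "semilinear s (pscale S) \<phi> (\<lambda>a. comb (F a) (G a))"
  by (simp add: semilinear_def comb_add comb_scale semilinearD[OF assms(1)] semilinearD[OF assms(2)])

text \<open>
  A flag datum apart from the ten equations.
\<close>

definition flag_maps :: "'r flag \<Rightarrow> bool" where
  "flag_maps d \<longleftrightarrow> semilinear sR (*) left_sub (f_h d) \<and> semilinear sR (*) left_sub (f_k d) \<and>
     semilinear sR (pscale sR) right_sub (f_D d) \<and> semilinear sR (pscale sR) right_sub (f_T d)"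

lemma FLC_iff:
  "d \<in> FLC sR pr V \<longleftrightarrow> flag_maps d \<and> (\<forall>a\<in>V. \<forall>b\<in>V. flag_equations sR pr d [:[:a:]:] [:[:b:]:])"
  by (simp add: FLC_def flag_maps_def left_conformal_linear_ring_iff conformal_linear_iff module_R conj_ac)

text \<open>
  The product relations of \<open>LC\<close>, required for all \<open>a \<in> R\<close>: the parameter \<open>\<omega>\<close> of an equivalence
  is an arbitrary element of \<open>R\<close>, and its products with \<open>x\<close> are needed.
\<close>

definition flag_prod :: "'r flag \<Rightarrow> ('r \<times> 'q \<Rightarrow> 'r \<times> 'q \<Rightarrow> ('r \<times> 'q) poly) \<Rightarrow> bool" where
  "flag_prod d m \<longleftrightarrow> m \<in> extending_products \<and>
     (\<forall>a. m (a, 0) (0, x) = comb (reflect sR (f_T d a)) (f_h d a)) \<and>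
     (\<forall>a. m (0, x) (a, 0) = comb (f_D d a) (reflect (*) (f_k d a))) \<and>
     m (0, x) (0, x) = comb (f_M d) (f_P d)"

lemma flag_maps_left_right:
  assumes "flag_maps d"
  shows "semilinear sR (pscale S) left_sub (\<lambda>a. comb (reflect sR (f_T d a)) (f_h d a))"
    "semilinear sR (pscale S) right_sub (\<lambda>a. comb (f_D d a) (reflect (*) (f_k d a)))"
proof -
  have "semilinear sR (*) right_sub (\<lambda>a. reflect (*) (f_k d a))"
    using semilinear_reflect_left[OF module_ring_mult, of sR "f_k d"] assms
    by (simp add: flag_maps_def pscale_mult)
  then show "semilinear sR (pscale S) left_sub (\<lambda>a. comb (reflect sR (f_T d a)) (f_h d a))"
    "semilinear sR (pscale S) right_sub (\<lambda>a. comb (f_D d a) (reflect (*) (f_k d a)))"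
    using assms by (auto simp: flag_maps_def intro!: semilinear_comb semilinear_reflect_right module_R)
qed

lemma extending_products_generator_maps:
  assumes "m \<in> extending_products"
  shows "semilinear sR (pscale S) left_sub (\<lambda>a. m (a, 0) e)" "semilinear sR (pscale S) right_sub (\<lambda>a. m e (a, 0))"
  using semilinear_comp[OF linear_Pair(1) extending_products_semilinear(1)[OF assms]]
    semilinear_comp[OF linear_Pair(1) extending_products_semilinear(2)[OF assms]] by simp_all

lemma is_LC_iff:
  assumes d: "flag_maps d"
  shows "is_LC sR pr V sQ x d m \<longleftrightarrow> lsc_algebra S m \<and> flag_prod d m"
proof -
  note l = flag_maps_left_right[OF d]
  have "(\<forall>a\<in>V. m (a, 0) (0, x) = comb (reflect sR (f_T d a)) (f_h d a)) \<longleftrightarrow>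
      (\<forall>a. m (a, 0) (0, x) = comb (reflect sR (f_T d a)) (f_h d a))"
    "(\<forall>a\<in>V. m (0, x) (a, 0) = comb (f_D d a) (reflect (*) (f_k d a))) \<longleftrightarrow>
      (\<forall>a. m (0, x) (a, 0) = comb (f_D d a) (reflect (*) (f_k d a)))" if m: "m \<in> extending_products"
    using semilinear_eq_V[OF extending_products_generator_maps(1)[OF m] l(1)]
      semilinear_eq_V[OF extending_products_generator_maps(2)[OF m] l(2)] by blast+
  then show ?thesis
    unfolding is_LC_def comb_def[symmetric] flag_prod_def extensions_iff by blast
qed

text \<open>
  Both sides of the compatibility condition are sesquilinear in either argument. Besides isomorphisms, the
  case \<open>\<phi> = id\<close> shows that a product is determined by its values on generators.
\<close>

lemma hom_on_gens:
  assumes m: "m \<in> extending_products" and m': "m' \<in> extending_products" and \<phi>: "semilinear S S (\<lambda>c. c) \<phi>" "\<And>a. \<phi> (a, 0) = (a, 0)"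
  shows "(\<forall>e f. map_poly \<phi> (m e f) = m' (\<phi> e) (\<phi> f)) \<longleftrightarrow>
    (\<forall>a\<in>V. map_poly \<phi> (m (a, 0) (0, x)) = m' (a, 0) (\<phi> (0, x))) \<and>
    (\<forall>a\<in>V. map_poly \<phi> (m (0, x) (a, 0)) = m' (\<phi> (0, x)) (a, 0)) \<and>
    map_poly \<phi> (m (0, x) (0, x)) = m' (\<phi> (0, x)) (\<phi> (0, x))" (is "?all \<longleftrightarrow> ?gens")
proof
  assume ?all then show ?gens using \<phi>(2) by metis
next
  assume g: ?gens
  note lin = semilinear_map_poly[OF module_S module_S \<phi>(1)]
  have lG: "semilinear S (pscale S) left_sub (\<lambda>e. map_poly \<phi> (m e f))"
    and rG: "semilinear S (pscale S) right_sub (\<lambda>f. map_poly \<phi> (m e f))"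
    and lH: "semilinear S (pscale S) left_sub (\<lambda>e. m' (\<phi> e) f)"
    and rH: "semilinear S (pscale S) right_sub (\<lambda>f. m' e (\<phi> f))" for e f
    using semilinear_comp[OF extending_products_semilinear(1)[OF m] lin] semilinear_comp[OF extending_products_semilinear(2)[OF m] lin]
      semilinear_comp[OF \<phi>(1) extending_products_semilinear(1)[OF m']] semilinear_comp[OF \<phi>(1) extending_products_semilinear(2)[OF m']]
    by simp_all
  note P = semilinear_comp[OF linear_Pair(1)]
  have RR: "map_poly \<phi> (m (a, 0) (b, 0)) = m' (\<phi> (a, 0)) (\<phi> (b, 0))" for a b
  proof -
    have "map_poly \<phi> (inR f) = inR f" for f
      by (rule poly_eqI) (simp add: coeff_map_poly semilinear_0[OF \<phi>(1)] \<phi>(2))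
    then show ?thesis using m m' by (simp add: extending_products_def \<phi>(2))
  qed
  have RX: "map_poly \<phi> (m (a, 0) (0, x)) = m' (\<phi> (a, 0)) (\<phi> (0, x))" for a
    by (rule semilinear_eq_V[OF P[OF lG] P[OF lH]]) (use g in \<open>simp add: \<phi>(2)\<close>)
  have XR: "map_poly \<phi> (m (0, x) (a, 0)) = m' (\<phi> (0, x)) (\<phi> (a, 0))" for a
    by (rule semilinear_eq_V[OF P[OF rG] P[OF rH]]) (use g in \<open>simp add: \<phi>(2)\<close>)
  have 1: "map_poly \<phi> (m e (b, 0)) = m' (\<phi> e) (\<phi> (b, 0))" for e b
    by (rule semilinear_eq_gens[OF lG lH]) (rule RR XR)+
  have 2: "map_poly \<phi> (m e (0, x)) = m' (\<phi> e) (\<phi> (0, x))" for e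
    by (rule semilinear_eq_gens[OF lG lH]) (use RX g in auto)
  have "map_poly \<phi> (m e f) = m' (\<phi> e) (\<phi> f)" for e f
    by (rule semilinear_eq_gens[OF rG rH]) (rule 1 2)+
  then show ?all by blast
qed

lemma flag_prod_unique:
  assumes "flag_prod d m" "flag_prod d m'" shows "m = m'"
proof -
  have "\<forall>e f. map_poly id (m e f) = m' (id e) (id f)"
    by (subst hom_on_gens) (use assms in \<open>simp_all add: flag_prod_def semilinear_def map_poly_id\<close>)
  then show ?thesis by (simp add: map_poly_id fun_eq_iff)
qed

text \<open>
  The sesquilinear extension of the prescribed values: for \<open>e = a + p x\<close> and \<open>f = b + q x\<close> one expands the
  product and moves \<open>p\<close> out as \<open>p(-\<lambda>)\<close> and \<open>q\<close> as \<open>q(\<partial> + \<lambda>)\<close>.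
\<close>

lemma ex_flag_prod:
  assumes d: "flag_maps d" shows "\<exists>m. flag_prod d m"
proof -
  define m where "m e f = inR (pr (fst e) (fst f))
     + pscale S (left_sub (coord (snd e))) (comb (f_D d (fst f)) (reflect (*) (f_k d (fst f))))
     + pscale S (right_sub (coord (snd f))) (comb (reflect sR (f_T d (fst e))) (f_h d (fst e)))
     + pscale S (left_sub (coord (snd e)) * right_sub (coord (snd f))) (comb (f_M d) (f_P d))" for e f
  note mS = module.module_pscale[OF module_S]
  note l = flag_maps_left_right[OF d]
  have act: "semilinear S (pscale S) left_sub (\<lambda>e. pscale S (left_sub (coord (snd e))) y)"
    "semilinear S (pscale S) right_sub (\<lambda>e. pscale S (right_sub (coord (snd e))) y)" for y
    by (simp_all add: semilinear_def sum_scale_def semilinearD[OF linear_coord]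
      ring_mapD[OF ring_map_left_right(1)] ring_mapD[OF ring_map_left_right(2)]
      module.scale_left_distrib[OF mS] module.scale_scale[OF mS])
  have act2: "pscale S (p * q) y = pscale S p (pscale S q y)" for p q y
    by (simp add: module.scale_scale[OF mS])
  have 1: "semilinear S (pscale S) left_sub (\<lambda>e. m e f)" for f
    unfolding m_def
    by (intro semilinear_plus[OF mS] act semilinear_scaled[OF mS, where G = "\<lambda>e. comb (reflect sR (f_T d (fst e))) (f_h d (fst e))"]
        semilinear_comp[OF linear_fst l(1)] semilinear_comp[OF semilinear_comp[OF linear_fst pr_semilinear(1)] linear_inR])
      (simp only: act2 act)
  have 2: "semilinear S (pscale S) right_sub (\<lambda>f. m e f)" for e
    unfolding m_def
    by (intro semilinear_plus[OF mS] act semilinear_scaled[OF mS, where G = "\<lambda>f. comb (f_D d (fst f)) (reflect (*) (f_k d (fst f)))"]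
        semilinear_comp[OF linear_fst l(2)] semilinear_comp[OF semilinear_comp[OF linear_fst pr_semilinear(2)] linear_inR])
      (simp only: act2 mult.commute[of "left_sub _"] act)
  have z: "comb 0 0 = 0" by (simp add: comb_pscale module.scale_zero_left[OF mS])
  have z': "f_D d 0 = 0" "f_T d 0 = 0" "f_h d 0 = 0" "f_k d 0 = 0" "reflect sR 0 = 0"
    using d by (auto simp: flag_maps_def intro: semilinear_0 semilinear_0[OF semilinear_reflect[OF module_R]])
  have "m (a, 0) (b, 0) = inR (pr a b)" "m (a, 0) (0, x) = comb (reflect sR (f_T d a)) (f_h d a)"
    "m (0, x) (a, 0) = comb (f_D d a) (reflect (*) (f_k d a))" "m (0, x) (0, x) = comb (f_M d) (f_P d)" for a b
    by (simp_all add: m_def semilinear_0[OF linear_coord] coord_x z z'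
      ring_mapD(1,2)[OF ring_map_left_right(1)] ring_mapD(1,2)[OF ring_map_left_right(2)]
      module.scale_zero_left[OF mS] module.scale_zero_right[OF mS] module.scale_one[OF mS]
      semilinear_0[OF pr_semilinear(1)] semilinear_0[OF pr_semilinear(2)])
  then have "flag_prod d m"
    using 1 2 by (simp add: flag_prod_def extending_products_def conformal_bilinear_iff mods)
  then show "\<exists>m. flag_prod d m" by (rule exI[of _ m])
qed

lemma ex_flag:
  assumes m: "m \<in> extending_products"
  obtains d where "flag_maps d" "flag_prod d m"
proof -
  define R where "R e = (SOME f. \<exists>p. e = comb f p)" for e
  define Q where "Q e = (SOME p. \<exists>f. e = comb f p)" for e
  have RQ: "R (comb f p) = f" "Q (comb f p) = p" for f p
    unfolding R_def Q_def by (auto simp: comb_eq_iff)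
  have lin: "semilinear (pscale S) (pscale sR) (\<lambda>c. c) R" "semilinear (pscale S) (*) (\<lambda>c. c) Q"
  proof -
    have "R (e + e') = R e + R e' \<and> Q (e + e') = Q e + Q e'" for e e'
      using ex_comb[of e] ex_comb[of e'] by (auto simp: comb_add RQ)
    moreover have "R (pscale S q e) = pscale sR q (R e) \<and> Q (pscale S q e) = q * Q e" for q e
      using ex_comb[of e] by (auto simp: comb_scale RQ)
    ultimately show "semilinear (pscale S) (pscale sR) (\<lambda>c. c) R" "semilinear (pscale S) (*) (\<lambda>c. c) Q"
      by (simp_all add: semilinear_def)
  qed
  have dec: "comb (R e) (Q e) = e" for e using ex_comb[of e] by (auto simp: RQ)
  define d where "d = \<lparr> f_h = \<lambda>a. Q (m (a, 0) (0, x)), f_k = \<lambda>a. reflect (*) (Q (m (0, x) (a, 0))),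
    f_D = \<lambda>a. R (m (0, x) (a, 0)), f_T = \<lambda>a. reflect sR (R (m (a, 0) (0, x))),
    f_M = R (m (0, x) (0, x)), f_P = Q (m (0, x) (0, x)) \<rparr>"
  note g = extending_products_generator_maps[OF m]
  have "semilinear sR (*) left_sub (\<lambda>a. reflect (*) (Q (m (0, x) (a, 0))))"
    using semilinear_reflect_right[OF module_ring_mult, of sR "\<lambda>a. Q (m (0, x) (a, 0))"]
      semilinear_comp[OF g(2) lin(2)] by (simp add: pscale_mult)
  moreover have "semilinear sR (pscale sR) right_sub (\<lambda>a. reflect sR (R (m (a, 0) (0, x))))"
    using semilinear_reflect_left[OF module_R semilinear_comp[OF g(1) lin(1)]] .
  ultimately have "flag_maps d"
    using semilinear_comp[OF g(1) lin(2)] semilinear_comp[OF g(2) lin(1)]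
    by (simp add: flag_maps_def d_def)
  moreover have "flag_prod d m"
    using m by (simp add: flag_prod_def d_def reflect_reflect module_R dec)
  ultimately show ?thesis using that by blast
qed

end

context flag_extension
begin

text \<open>
  The element \<open>u + q x\<close> of \<open>(R \<oplus> \<complex>[\<partial>]x)[\<lambda>,\<mu>]\<close>, in which iterated products are computed.
\<close>

definition comb2 :: "'r poly poly \<Rightarrow> complex poly poly poly \<Rightarrow> ('r \<times> 'q) poly poly" where
  "comb2 u q = map_poly inR u + bscale S q [:[:(0, x):]:]"

lemma linear_inR2: "semilinear (bscale sR) (bscale S) (\<lambda>c. c) (map_poly inR)"
  unfolding bscale_def by (intro semilinear_map_poly module.module_pscale mods linear_inR)

lemma linear_inQ2: "semilinear (bscale sQ) (bscale S) (\<lambda>c. c) (map_poly inQ)"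
  unfolding bscale_def by (intro semilinear_map_poly module.module_pscale mods linear_inQ)

lemma inR_const: "inR [:a:] = [:(a, 0):]"
  by (rule poly_eqI) (simp add: coeff_pCons zero_prod_def split: nat.split)

lemma inR2_const: "(map_poly inR [:[:a:]:] :: ('r \<times> 'q) poly poly) = [:[:(a, 0):]:]"
  by (simp add: map_poly_const inR_const)

lemma bscale_x_eq: "bscale S q [:[:(0, x):]:] = map_poly inQ (bscale sQ q [:[:x:]:])"
  by (simp add: semilinear_scale[OF linear_inQ2] map_poly_const inQ_const)

lemma comb2_eq_iff: "comb2 u q = comb2 u' q' \<longleftrightarrow> u = u' \<and> q = q'"
proof
  have c: "coeff (comb2 u q) n = comb (coeff u n) (coeff q n)" for u q n
    unfolding comb2_def bscale_x_eq
    by (simp add: coeff_map_poly comb_def bscale_def coeff_pscale_const module.module_pscale module_Q)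
  assume "comb2 u q = comb2 u' q'"
  then have "coeff u n = coeff u' n \<and> coeff q n = coeff q' n" for n by (metis c comb_eq_iff)
  then show "u = u' \<and> q = q'" by (auto intro: poly_eqI)
qed simp

lemmas module_S2 = module_bscale[OF module_S]

lemma comb2_plus: "comb2 u q + comb2 u' q' = comb2 (u + u') (q + q')"
  by (simp add: comb2_def semilinear_add[OF linear_inR2] module.scale_left_distrib[OF module_S2])

lemma comb2_minus: "comb2 u q - comb2 u' q' = comb2 (u - u') (q - q')"
  by (simp add: comb2_def semilinear_diff[OF linear_inR2] module.scale_left_diff_distrib[OF module_S2])

lemma comb2_scale: "bscale S p (comb2 u q) = comb2 (bscale sR p u) (p * q)"
  by (simp add: comb2_def semilinear_scale[OF linear_inR2] module.scale_right_distrib[OF module_S2]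
    module.scale_scale[OF module_S2])

lemma comb2_0: "comb2 0 0 = 0"
  by (simp add: comb2_def semilinear_0[OF linear_inR2] module.scale_zero_left[OF module_S2])

lemma comb2_R: "[:[:(a, 0):]:] = comb2 [:[:a:]:] 0"
  by (simp add: comb2_def inR2_const module.scale_zero_left[OF module_S2])

lemma comb2_X: "[:[:(0, x):]:] = comb2 0 1"
  by (simp add: comb2_def semilinear_0[OF linear_inR2] module.scale_one[OF module_S2])

lemma semilinear_comb2:
  assumes "semilinear s (bscale sR) \<phi> F" "semilinear s (*) \<phi> G"
  shows "semilinear s (bscale S) \<phi> (\<lambda>a. comb2 (F a) (G a))"
  by (simp add: semilinear_def comb2_plus comb2_scale semilinearD[OF assms(1)] semilinearD[OF assms(2)])

lemma bsubst_inR: "bsubst S p (inR f) = map_poly inR (bsubst sR p f)"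
  using bsubst_map_poly[OF module_R module_S linear_Pair(1)] by (simp add: inR_def[abs_def])

lemma bsubst_comb: "bsubst S p (comb f F) = comb2 (bsubst sR p f) (psubst F p Del)"
  by (simp add: comb_pscale comb2_def semilinear_add[OF semilinear_bsubst'[OF module_S]]
    semilinear_scale[OF semilinear_bsubst'[OF module_S]] bsubst_inR bsubst_const[OF module_S])

lemma pr_bilinear: "conformal_bilinear sR sR sR pr" using pr by (simp add: lsc_algebra_def)

lemmas prdR_semilinear = semilinear_prd[OF module_R pr_bilinear]

lemma flag_semilinear:
  assumes "flag_maps d"
  shows "semilinear (bscale sR) (bscale sR) (subst_del (Del + p)) (capp sR (f_D d) p)"
    "semilinear (bscale sR) (bscale sR) (subst_del (Del + p)) (capp sR (f_T d) p)"
    "semilinear (bscale sR) (*) (subst_del (- p)) (\<lambda>u. happ (f_h d) p u q)"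
    "semilinear (bscale sR) (*) (subst_del (- p)) (\<lambda>u. happ (f_k d) p u q)"
  using assms by (simp_all add: flag_maps_def semilinear_capp_right semilinear_happ module_R)

context
  fixes d m assumes d: "flag_maps d" and m: "flag_prod d m"
begin

abbreviation "prd \<equiv> capp2 S m"

lemma m_extending: "m \<in> extending_products" using m by (simp add: flag_prod_def)

lemma m_bilinear: "conformal_bilinear S S S m" using m_extending by (simp add: extending_products_def)

lemmas prd_semilinear = semilinear_prd[OF module_S m_bilinear]

lemma prd_RR: "prd p (map_poly inR u) (map_poly inR v) = map_poly inR (capp2 sR pr p u v)"
proof (rule semilinear_poly_poly_eq[OF module_R, where u = u and t = "bscale S" and \<sigma> = "subst_del (- p)"])
  show "semilinear (bscale sR) (bscale S) (subst_del (- p)) (\<lambda>u. prd p (map_poly inR u) (map_poly inR v))"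
    by (rule semilinear_comp[OF linear_inR2 prd_semilinear(1)])
  show "semilinear (bscale sR) (bscale S) (subst_del (- p)) (\<lambda>u. map_poly inR (capp2 sR pr p u v))"
    by (rule semilinear_comp[OF prdR_semilinear(1) linear_inR2])
  fix a
  show "prd p (map_poly inR [:[:a:]:]) (map_poly inR v) = map_poly inR (capp2 sR pr p [:[:a:]:] v)"
  proof (rule semilinear_poly_poly_eq[OF module_R, where u = v and t = "bscale S" and \<sigma> = "subst_del (Del + p)"])
    show "semilinear (bscale sR) (bscale S) (subst_del (Del + p)) (\<lambda>v. prd p (map_poly inR [:[:a:]:]) (map_poly inR v))"
      by (rule semilinear_comp[OF linear_inR2 prd_semilinear(2)])
    show "semilinear (bscale sR) (bscale S) (subst_del (Del + p)) (\<lambda>v. map_poly inR (capp2 sR pr p [:[:a:]:] v))"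
      by (rule semilinear_comp[OF prdR_semilinear(2) linear_inR2])
    show "prd p (map_poly inR [:[:a:]:]) (map_poly inR [:[:b:]:]) = map_poly inR (capp2 sR pr p [:[:a:]:] [:[:b:]:])" for b
      using m_extending
      by (simp only: inR2_const capp2_const[OF module_S] capp2_const[OF module_R] extending_products_def
        mem_Collect_eq bsubst_inR)
  qed
qed

lemma prd_RX:
  "prd p (map_poly inR u) [:[:(0, x):]:] = comb2 (capp sR (f_T d) (- p - Del) u) (happ (f_h d) p u Del)"
proof (rule semilinear_poly_poly_eq[OF module_R, where u = u and t = "bscale S" and \<sigma> = "subst_del (- p)"])
  show "semilinear (bscale sR) (bscale S) (subst_del (- p)) (\<lambda>u. prd p (map_poly inR u) [:[:(0, x):]:])"
    by (rule semilinear_comp[OF linear_inR2 prd_semilinear(1)])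
  show "semilinear (bscale sR) (bscale S) (subst_del (- p))
     (\<lambda>u. comb2 (capp sR (f_T d) (- p - Del) u) (happ (f_h d) p u Del))"
    using flag_semilinear(2)[OF d, of "- p - Del"] by (intro semilinear_comb2 flag_semilinear(3)[OF d]) simp
  show "prd p (map_poly inR [:[:a:]:]) [:[:(0, x):]:]
      = comb2 (capp sR (f_T d) (- p - Del) [:[:a:]:]) (happ (f_h d) p [:[:a:]:] Del)" for a
    using m unfolding flag_prod_def
    by (simp add: inR2_const capp2_const module_S bsubst_comb capp_const module_R happ_const bsubst_reflect')
qed

lemma prd_XR:
  "prd p [:[:(0, x):]:] (map_poly inR u) = comb2 (capp sR (f_D d) p u) (happ (f_k d) (- p - Del) u Del)"
proof (rule semilinear_poly_poly_eq[OF module_R, where u = u and t = "bscale S" and \<sigma> = "subst_del (Del + p)"])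
  show "semilinear (bscale sR) (bscale S) (subst_del (Del + p)) (\<lambda>u. prd p [:[:(0, x):]:] (map_poly inR u))"
    by (rule semilinear_comp[OF linear_inR2 prd_semilinear(2)])
  show "semilinear (bscale sR) (bscale S) (subst_del (Del + p))
     (\<lambda>u. comb2 (capp sR (f_D d) p u) (happ (f_k d) (- p - Del) u Del))"
    using flag_semilinear(4)[OF d, of "- p - Del" Del]
    by (intro semilinear_comb2 flag_semilinear(1)[OF d]) (simp add: add.commute)
  show "prd p [:[:(0, x):]:] (map_poly inR [:[:a:]:])
      = comb2 (capp sR (f_D d) p [:[:a:]:]) (happ (f_k d) (- p - Del) [:[:a:]:] Del)" for a
    using m unfolding flag_prod_def
    by (simp add: inR2_const capp2_const module_S bsubst_comb capp_const module_R happ_const psubst_reflect)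
qed

lemma prd_XX: "prd p [:[:(0, x):]:] [:[:(0, x):]:] = comb2 (bsubst sR p (f_M d)) (psubst (f_P d) p Del)"
  using m unfolding flag_prod_def by (simp add: capp2_const module_S bsubst_comb)

text \<open>
  The multiplication table in two variables. Together with the rules for sums it reduces every iterated
  product of generators to the form \<open>u + q x\<close>, in exactly the terms of the flag equations.
\<close>

lemma prd_comb2:
  "prd p (comb2 u q) (comb2 v q') =
     comb2 (capp2 sR pr p u v + bscale sR (subst_del (Del + p) q') (capp sR (f_T d) (- p - Del) u)
        + bscale sR (subst_del (- p) q) (capp sR (f_D d) p v)
        + bscale sR (subst_del (- p) q * subst_del (Del + p) q') (bsubst sR p (f_M d)))
      (subst_del (Del + p) q' * happ (f_h d) p u Del + subst_del (- p) q * happ (f_k d) (- p - Del) v Del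
        + subst_del (- p) q * subst_del (Del + p) q' * psubst (f_P d) p Del)"
proof -
  note l = prd_semilinear(1) and r = prd_semilinear(2)
  have R: "map_poly inR u = comb2 u 0" for u :: "'r poly poly"
    by (simp add: comb2_def module.scale_zero_left[OF module_S2])
  have "prd p (comb2 u q) (comb2 v q') = prd p (map_poly inR u) (map_poly inR v)
    + bscale S (subst_del (Del + p) q') (prd p (map_poly inR u) [:[:(0, x):]:])
    + bscale S (subst_del (- p) q) (prd p [:[:(0, x):]:] (map_poly inR v))
    + bscale S (subst_del (- p) q * subst_del (Del + p) q') (prd p [:[:(0, x):]:] [:[:(0, x):]:])"
    unfolding comb2_def
    by (simp add: semilinear_add[OF l] semilinear_add[OF r] semilinear_scale[OF l] semilinear_scale[OF r]
      module.scale_scale[OF module_S2] module.scale_right_distrib[OF module_S2] mult.commute add_ac)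
  then show ?thesis
    unfolding prd_RR prd_RX prd_XR prd_XX by (simp only: R comb2_scale comb2_plus add_0_left add_0_right)
qed

end

end

section \<open>Left symmetry and the flag equations\<close>

context flag_extension
begin

context
  fixes d m assumes d: "flag_maps d" and m: "flag_prod d m"
begin

lemmas zero_simps = 
  semilinear_0[OF prdR_semilinear(1)] semilinear_0[OF prdR_semilinear(2)]
  semilinear_0[OF flag_semilinear(1)[OF d]] semilinear_0[OF flag_semilinear(2)[OF d]]
  semilinear_0[OF flag_semilinear(3)[OF d]] semilinear_0[OF flag_semilinear(4)[OF d]]
  module.scale_zero_left[OF module_bscale[OF module_R]] module.scale_one[OF module_bscale[OF module_R]]
  module.scale_zero_right[OF module_bscale[OF module_R]]

lemmas const_simps = capp_const[OF module_R] happ_const capp2_const[OF module_R]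

lemma T_product_cong:
  "capp2 sR pr (Lam + Mu) (bsubst sR (- Mu - Del) f) v = capp2 sR pr (Lam + Mu) (bsubst sR Lam f) v"
  by (rule semilinear_bsubst_cong[OF module_R prdR_semilinear(1)]) simp

lemma T_T_cong:
  "capp sR (f_T d) (- Lam - Mu - Del) (bsubst sR (- Lam - Del) f) = capp sR (f_T d) (- Lam - Mu - Del) (bsubst sR Mu f)"
  by (rule semilinear_bsubst_cong[OF module_R flag_semilinear(2)[OF d]]) simp

lemmas diff_simps =
  semilinear_diff[OF prdR_semilinear(1)] semilinear_diff[OF flag_semilinear(2)[OF d]]
  semilinear_diff[OF flag_semilinear(3)[OF d]] module.scale_left_diff_distrib[OF module_bscale[OF module_R]]

lemma swap_arg: "- Mu - (Del + Lam) = - Lam - (Del + Mu)"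
  by simp

text \<open>
  Consecutive flag equations are paired: they are the components in \<open>R\<close> and \<open>\<complex>[\<partial>]x\<close> of left
  symmetry on \<open>xab\<close>, \<open>abx\<close>, \<open>axx\<close>, \<open>xxa\<close>, \<open>xxx\<close>. After expansion by the multiplication
  table both sides agree up to the order of terms and the two uses of \<open>semilinear_bsubst_cong\<close> above.
\<close>

lemma flag_equations_iff:
  "flag_equations sR pr d [:[:a:]:] [:[:b:]:] \<longleftrightarrow>
     ls_defect S m [:[:(0, x):]:] [:[:(a, 0):]:] [:[:(b, 0):]:] = 0 \<and>
     ls_defect S m [:[:(a, 0):]:] [:[:(b, 0):]:] [:[:(0, x):]:] = 0 \<and>
     ls_defect S m [:[:(a, 0):]:] [:[:(0, x):]:] [:[:(0, x):]:] = 0 \<and>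
     ls_defect S m [:[:(0, x):]:] [:[:(0, x):]:] [:[:(a, 0):]:] = 0 \<and>
     ls_defect S m [:[:(0, x):]:] [:[:(0, x):]:] [:[:(0, x):]:] = 0"
  unfolding ls_defect_def comb2_R comb2_X flag_equations_def Let_def
    Lam_def[symmetric] Mu_def[symmetric] Del_def[symmetric]
  by (simp only: prd_comb2[OF d m] zero_simps const_simps comb2_minus comb2_0[symmetric] comb2_eq_iff
    diff_simps conj_assoc subst_del_hom subst_del_simps mult_zero_left mult_zero_right mult_1_left mult_1_right
    add_0_left add_0_right minus_add_distrib minus_minus minus_zero T_product_cong T_T_cong)
    (simp add: T_product_cong T_T_cong, simp only: algebra_simps swap_arg)

lemma ls_defect_R: "ls_defect S m [:[:(a, 0):]:] [:[:(b, 0):]:] [:[:(c, 0):]:] = 0"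
proof -
  have "ls_defect sR pr [:[:a:]:] [:[:b:]:] [:[:c:]:] = 0"
    using pr by (simp add: lsc_algebra_iff)
  then show ?thesis
    unfolding ls_defect_def comb2_R
    by (simp only: prd_comb2[OF d m] zero_simps subst_del_hom mult_zero_left mult_zero_right
        add_0_right comb2_minus comb2_0 diff_self)
qed

text \<open>
  The zero map is semilinear along every homomorphism, so the comparison of semilinear maps on
  generators applies to it.
\<close>

lemma zero_on_gens:
  assumes G: "semilinear (bscale S) (bscale S) \<sigma> G"
    and V: "\<And>a. a \<in> V \<Longrightarrow> G [:[:(a, 0):]:] = 0" and X: "G [:[:(0, x):]:] = 0"
  shows "G [:[:e:]:] = 0"
proof -
  have c: "semilinear S (bscale S) (\<lambda>a. \<sigma> [:[:a:]:]) (\<lambda>e. G [:[:e:]:])"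
    by (rule semilinear_comp[OF semilinear_const_const[OF module_S] G])
  note z = semilinear_zero[OF module_S2]
  have "G [:[:(a, 0):]:] = 0" for a
    by (rule semilinear_eq_V[OF semilinear_comp[OF linear_Pair(1) c] z]) (rule V)
  then show ?thesis
    by (rule semilinear_eq_gens[OF c z]) (rule X)
qed

lemma lsc_iff_flag_equations:
  "lsc_algebra S m \<longleftrightarrow> (\<forall>a\<in>V. \<forall>b\<in>V. flag_equations sR pr d [:[:a:]:] [:[:b:]:])"
proof
  assume "lsc_algebra S m"
  then show "\<forall>a\<in>V. \<forall>b\<in>V. flag_equations sR pr d [:[:a:]:] [:[:b:]:]"
    by (simp add: lsc_algebra_iff flag_equations_iff)
next
  assume eq: "\<forall>a\<in>V. \<forall>b\<in>V. flag_equations sR pr d [:[:a:]:] [:[:b:]:]"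
  note bil = m_bilinear[OF d m]
  note flip = ls_defect_flip[OF module_S bil] and sl = semilinear_ls_defect[OF module_S bil]
  have "module (\<lambda>c. sR [:c:])" by (rule module_restrict[OF module_R ring_map_const])
  then have "0 \<in> V"
    using gen_V module.subspace_0 unfolding freely_generated_by_def by blast
  let ?Z = "\<lambda>a b c. ls_defect S m [:[:a:]:] [:[:b:]:] [:[:c:]:] = 0"
  have XRR: "?Z (0, x) (a, 0) (b, 0)" and RRX: "?Z (a, 0) (b, 0) (0, x)"
    and RXX: "?Z (a, 0) (0, x) (0, x)" and XXR: "?Z (0, x) (0, x) (a, 0)" and XXX: "?Z (0, x) (0, x) (0, x)"
    if "a \<in> V" "b \<in> V" for a b
    using eq that by (simp_all add: flag_equations_iff)
  note XXX = XXX[OF \<open>0 \<in> V\<close> \<open>0 \<in> V\<close>] and RXX = RXX[OF _ \<open>0 \<in> V\<close>] and XXR = XXR[OF _ \<open>0 \<in> V\<close>]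
  have RR: "?Z (a, 0) (b, 0) e" if "a \<in> V" "b \<in> V" for a b e
    by (rule zero_on_gens[OF sl(3)]) (blast intro: ls_defect_R RRX that)+
  have XR: "?Z (0, x) (a, 0) e" if "a \<in> V" for a e
    by (rule zero_on_gens[OF sl(3)]) (blast intro: XRR that flip[OF RXX])+
  have XX: "?Z (0, x) (0, x) e" for e
    by (rule zero_on_gens[OF sl(3)]) (blast intro: XXR XXX)+
  have R: "?Z (a, 0) f e" if "a \<in> V" for a e f
    by (rule zero_on_gens[OF sl(2)]) (blast intro: RR flip[OF XR] that)+
  have X: "?Z (0, x) f e" for e f
    by (rule zero_on_gens[OF sl(2)]) (blast intro: XR XX)+
  have "?Z g f e" for g f e
    by (rule zero_on_gens[OF sl(1)]) (blast intro: R X)+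
  then show "lsc_algebra S m"
    using bil module_S by (simp add: lsc_algebra_iff)
qed

end

end

section \<open>Isomorphisms and equivalence of flag datums\<close>

context flag_extension
begin

text \<open>
  The endomorphism of \<open>R \<oplus> \<complex>[\<partial>]x\<close> with \<open>a \<mapsto> a\<close> and \<open>x \<mapsto> \<omega> + p x\<close>.
\<close>

definition shift :: "'r \<Rightarrow> complex poly \<Rightarrow> 'r \<times> 'q \<Rightarrow> 'r \<times> 'q" where
  "shift \<omega> p = triangular (\<lambda>y. sR (coord y) \<omega>) (sQ p)"

lemma linear_shift: "semilinear S S (\<lambda>c. c) (shift \<omega> p)"
  unfolding shift_def linear_triangular
  by (simp add: semilinear_def semilinearD[OF linear_coord] module.scale_left_distrib[OF module_R]
    module.scale_scale[OF module_R] module.scale_right_distrib[OF module_Q] module.scale_scale[OF module_Q] mult.commute)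

lemma shift_R: "shift \<omega> p (a, 0) = (a, 0)"
  by (simp add: shift_def triangular_def semilinear_0[OF linear_coord] module.scale_zero_left[OF module_R]
    module.scale_zero_right[OF module_Q])

lemma shift_X: "shift \<omega> p (0, x) = (\<omega>, sQ p x)"
  by (simp add: shift_def triangular_def coord_x module.scale_one[OF module_R])

text \<open>
  Bijectivity makes \<open>p\<close> in \<open>x \<mapsto> \<omega> + p x\<close> a unit of \<open>\<complex>[\<partial>]\<close>: some multiple of it has to be \<open>1\<close>.
\<close>

lemma stabilizing_shift:
  assumes "semilinear S S (\<lambda>c. c) \<phi>" "\<And>a. \<phi> (a, 0) = (a, 0)" "bij \<phi>"
  shows "\<exists>\<omega> \<beta>. \<beta> \<noteq> 0 \<and> \<phi> = shift \<omega> [:\<beta>:]"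
proof -
  define \<omega> p where "\<omega> = fst (\<phi> (0, x))" and "p = coord (snd (\<phi> (0, x)))"
  then have X: "\<phi> (0, x) = (\<omega>, sQ p x)" by (simp add: coord)
  have \<phi>: "\<phi> = shift \<omega> p"
    by (rule ext, rule semilinear_eq_gens[OF assms(1) linear_shift])
      (simp_all add: assms(2) X shift_R shift_X)
  have "surj (sQ p)"
    using assms(3) unfolding \<phi> shift_def bij_triangular by (rule bij_is_surj)
  then obtain y where "sQ p y = x" by (metis surjD)
  then have "sQ (p * coord y) x = sQ 1 x"
    by (simp add: module.scale_scale[OF module_Q, symmetric] coord module.scale_one[OF module_Q])
  then have "p * coord y = 1" by (metis coord_eq)
  then have "p dvd 1" by (metis dvd_triv_left)
  then obtain \<beta> where "p = [:\<beta>:]" "\<beta> \<noteq> 0"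
    by (auto simp: is_unit_poly_iff dvd_field_iff)
  with \<phi> show ?thesis by blast
qed

lemma bij_shift: "\<beta> \<noteq> 0 \<Longrightarrow> bij (shift \<omega> [:\<beta>:])"
  unfolding shift_def bij_triangular
  by (rule o_bij[where g = "sQ [:inverse \<beta>:]"])
    (simp_all add: fun_eq_iff module.scale_scale[OF module_Q] module.scale_one[OF module_Q, folded pCons_one])

lemma snd_shift: "snd \<circ> shift \<omega> [:\<beta>:] = snd \<longleftrightarrow> \<beta> = 1"
proof
  assume "snd \<circ> shift \<omega> [:\<beta>:] = snd"
  then have "snd (shift \<omega> [:\<beta>:] (0, x)) = x" by (metis comp_apply snd_conv)
  then have "[:\<beta>:] = 1" using coord_eq coord_x by (metis shift_X snd_conv)
  then show "\<beta> = 1" by (simp add: one_pCons)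
qed (simp add: fun_eq_iff shift_def triangular_def module.scale_one[OF module_Q, folded pCons_one])

lemma map_shift_comb: "map_poly (shift \<omega> p) (comb f q) = comb (f + pscale sR q [:\<omega>:]) (q * [:p:])"
proof -
  note lin = semilinear_map_poly[OF module_S module_S linear_shift[of \<omega> p]]
  have "map_poly (shift \<omega> p) (inR f) = inR f"
    by (rule poly_eqI) (simp add: coeff_map_poly semilinear_0[OF linear_shift] shift_R)
  moreover have "[:(\<omega>, sQ p x):] = comb [:\<omega>:] [:p:]"
    by (rule poly_eqI) (simp add: comb_def module.pscale_const[OF module_Q] coeff_pCons zero_prod_def split: nat.split)
  then have "map_poly (shift \<omega> p) [:(0, x):] = comb [:\<omega>:] [:p:]"
    by (simp add: map_poly_const semilinear_0[OF linear_shift] shift_X)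
  ultimately have "map_poly (shift \<omega> p) (comb f q) = inR f + pscale S q (comb [:\<omega>:] [:p:])"
    by (simp add: comb_pscale[of f q] semilinear_add[OF lin] semilinear_scale[OF lin])
  moreover have "inR f = comb f 0"
    by (simp add: comb_pscale module.scale_zero_left[OF module.module_pscale[OF module_S]])
  ultimately show ?thesis by (simp add: comb_scale comb_add)
qed

text \<open>
  The three kinds of products of generators give six component equations. The \<open>x\<close>-components carry a
  common factor \<open>\<beta>\<close>; it is cancelled, which leaves \<open>h = h'\<close>, \<open>k = k'\<close> and the equation for \<open>P\<close>.
\<close>

lemma shift_hom_iff:
  assumes d: "flag_maps d" and d': "flag_maps d'" and m: "flag_prod d m" and m': "flag_prod d' m'" and \<beta>: "\<beta> \<noteq> 0"
  shows "(\<forall>e f. map_poly (shift \<omega> [:\<beta>:]) (m e f) = m' (shift \<omega> [:\<beta>:] e) (shift \<omega> [:\<beta>:] f))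
    \<longleftrightarrow> flag_equiv_via sR pr V d d' \<omega> \<beta>"
proof -
  let ?B = "[:[:\<beta>:]:]"
  have prods: "m \<in> extending_products" "m' \<in> extending_products" using m m' by (simp_all add: flag_prod_def)
  note mS = module.module_pscale[OF module_S]
  note l = extending_products_semilinear(1)[OF prods(2)] and r = extending_products_semilinear(2)[OF prods(2)]
  have split: "(\<omega>, sQ [:\<beta>:] x) = (\<omega>, 0) + S [:\<beta>:] (0, x)"
    by (simp add: sum_scale_def module.scale_zero_right[OF module_R])
  have R: "m' (a, 0) (b, 0) = comb (pr a b) 0" for a b
    using prods(2) by (simp add: extending_products_def comb_pscale module.scale_zero_left[OF mS])
  have cancel: "p * ?B = ?B * q \<longleftrightarrow> p = q" for p q :: "complex poly poly"
    using \<beta> by (metis mult.commute mult_left_cancel pCons_eq_0_iff)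
  have RX: "map_poly (shift \<omega> [:\<beta>:]) (m (a, 0) (0, x)) = m' (a, 0) (\<omega>, sQ [:\<beta>:] x) \<longleftrightarrow>
      reflect sR (f_T d a) + pscale sR (f_h d a) [:\<omega>:] = pr a \<omega> + pscale sR ?B (reflect sR (f_T d' a)) \<and>
      f_h d a = f_h d' a" for a
  proof -
    have "m' (a, 0) (\<omega>, sQ [:\<beta>:] x) = comb (pr a \<omega> + pscale sR ?B (reflect sR (f_T d' a))) (?B * f_h d' a)"
      using m' unfolding split semilinear_add[OF r] semilinear_scale[OF r] left_right_simps R flag_prod_def
      by (simp only: comb_scale comb_add add_0_left)
    then show ?thesis
      using m unfolding flag_prod_def by (simp only: map_shift_comb comb_eq_iff cancel)
  qed
  have XR: "map_poly (shift \<omega> [:\<beta>:]) (m (0, x) (a, 0)) = m' (\<omega>, sQ [:\<beta>:] x) (a, 0) \<longleftrightarrow>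
      f_D d a + pscale sR (reflect (*) (f_k d a)) [:\<omega>:] = pr \<omega> a + pscale sR ?B (f_D d' a) \<and>
      f_k d a = f_k d' a" for a
  proof -
    have "m' (\<omega>, sQ [:\<beta>:] x) (a, 0) = comb (pr \<omega> a + pscale sR ?B (f_D d' a)) (?B * reflect (*) (f_k d' a))"
      using m' unfolding split semilinear_add[OF l] semilinear_scale[OF l] left_right_simps R flag_prod_def
      by (simp only: comb_scale comb_add add_0_left)
    moreover have "reflect (*) (f_k d a) = reflect (*) (f_k d' a) \<longleftrightarrow> f_k d a = f_k d' a"
      by (metis reflect_mult_reflect)
    ultimately show ?thesis
      using m unfolding flag_prod_def by (simp only: map_shift_comb comb_eq_iff cancel)
  qed
  have XX: "map_poly (shift \<omega> [:\<beta>:]) (m (0, x) (0, x)) = m' (\<omega>, sQ [:\<beta>:] x) (\<omega>, sQ [:\<beta>:] x) \<longleftrightarrow>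
      f_M d + pscale sR (f_P d) [:\<omega>:] = pr \<omega> \<omega> + pscale sR (?B\<^sup>2) (f_M d')
        + pscale sR ?B (reflect sR (f_T d' \<omega>)) + pscale sR ?B (f_D d' \<omega>) \<and>
      f_P d = reflect (*) (f_k d' \<omega>) + f_h d' \<omega> + ?B * f_P d'"
  proof -
    have "m' (\<omega>, sQ [:\<beta>:] x) (\<omega>, sQ [:\<beta>:] x) = comb
       (pr \<omega> \<omega> + pscale sR (?B\<^sup>2) (f_M d') + pscale sR ?B (reflect sR (f_T d' \<omega>)) + pscale sR ?B (f_D d' \<omega>))
       (?B * (reflect (*) (f_k d' \<omega>) + f_h d' \<omega> + ?B * f_P d'))"
    proof -
      have "m' (\<omega>, 0) (0, x) = comb (reflect sR (f_T d' \<omega>)) (f_h d' \<omega>)"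
        "m' (0, x) (\<omega>, 0) = comb (f_D d' \<omega>) (reflect (*) (f_k d' \<omega>))" "m' (0, x) (0, x) = comb (f_M d') (f_P d')"
        using m' by (simp_all add: flag_prod_def)
      then show ?thesis
        unfolding split semilinear_add[OF l] semilinear_scale[OF l] semilinear_add[OF r] semilinear_scale[OF r]
          left_right_simps R
        by (simp only: comb_scale comb_add module.scale_right_distrib[OF module.module_pscale[OF module_R]]
            module.scale_scale[OF module.module_pscale[OF module_R]] power2_eq_square algebra_simps
            mult_zero_right add_0_left add_0_right)
    qed
    then show ?thesis
      using m unfolding flag_prod_def by (simp only: map_shift_comb comb_eq_iff cancel)
  qed
  have hk: "f_h d = f_h d' \<longleftrightarrow> (\<forall>a\<in>V. f_h d a = f_h d' a)" "f_k d = f_k d' \<longleftrightarrow> (\<forall>a\<in>V. f_k d a = f_k d' a)"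
    using semilinear_eq_V[where G = "f_h d" and H = "f_h d'" and t = "(*)" and \<phi> = left_sub]
      semilinear_eq_V[where G = "f_k d" and H = "f_k d'" and t = "(*)" and \<phi> = left_sub]
      d d' unfolding flag_maps_def fun_eq_iff by blast+
  show ?thesis
    unfolding hom_on_gens[OF prods linear_shift shift_R] shift_X RX XR XX flag_equiv_via_def Let_def hk
    by (auto simp: algebra_simps)
qed

lemma LC_props:
  assumes "d \<in> FLC sR pr V"
  shows "\<exists>!m. is_LC sR pr V sQ x d m" "flag_prod d (LC sR pr V sQ x d)" "lsc_algebra S (LC sR pr V sQ x d)"
    "LC sR pr V sQ x d \<in> extensions sR pr sQ"
proof -
  have d: "flag_maps d" and eq: "\<forall>a\<in>V. \<forall>b\<in>V. flag_equations sR pr d [:[:a:]:] [:[:b:]:]"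
    using assms by (simp_all add: FLC_iff)
  obtain m where m: "flag_prod d m" using ex_flag_prod[OF d] by blast
  with eq have "is_LC sR pr V sQ x d m" by (simp add: is_LC_iff[OF d] lsc_iff_flag_equations[OF d m])
  then show ex1: "\<exists>!m. is_LC sR pr V sQ x d m"
    using flag_prod_unique is_LC_iff[OF d] by blast
  have "is_LC sR pr V sQ x d (LC sR pr V sQ x d)"
    unfolding LC_def by (rule theI'[OF ex1])
  then show "flag_prod d (LC sR pr V sQ x d)" "lsc_algebra S (LC sR pr V sQ x d)"
    "LC sR pr V sQ x d \<in> extensions sR pr sQ"
    by (auto simp: is_LC_iff[OF d] extensions_iff flag_prod_def)
qed

text \<open>
  Any extension has flag maps, and its left symmetry makes them a flag datum.
\<close>

lemma LC_image: "LC sR pr V sQ x ` FLC sR pr V = extensions sR pr sQ"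
proof
  show "LC sR pr V sQ x ` FLC sR pr V \<subseteq> extensions sR pr sQ" using LC_props(4) by blast
  show "extensions sR pr sQ \<subseteq> LC sR pr V sQ x ` FLC sR pr V"
  proof
    fix m assume "m \<in> extensions sR pr sQ"
    then have m: "m \<in> extending_products" "lsc_algebra S m" by (simp_all add: extensions_iff)
    obtain d where d: "flag_maps d" "flag_prod d m" using ex_flag[OF m(1)] .
    then have "d \<in> FLC sR pr V" using lsc_iff_flag_equations[OF d] m(2) by (simp add: FLC_iff)
    moreover from this have "LC sR pr V sQ x d = m" using LC_props(2) d(2) flag_prod_unique by blast
    ultimately show "m \<in> LC sR pr V sQ x ` FLC sR pr V" by blast
  qed
qed

lemma flag_rel_iff:
  assumes d: "d \<in> FLC sR pr V" and d': "d' \<in> FLC sR pr V"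
  defines "m \<equiv> LC sR pr V sQ x d" and "m' \<equiv> LC sR pr V sQ x d'"
  shows "(d, d') \<in> flag_eq sR pr V \<longleftrightarrow> (m, m') \<in> cext_eq sR pr sQ"
    and "(d, d') \<in> flag_approx sR pr V \<longleftrightarrow> (m, m') \<in> cext_approx sR pr sQ"
proof -
  have fm: "flag_maps d" "flag_maps d'" using d d' by (simp_all add: FLC_iff)
  have ext: "m \<in> extensions sR pr sQ" "m' \<in> extensions sR pr sQ"
    and fp: "flag_prod d m" "flag_prod d' m'"
    using LC_props d d' by (simp_all add: m_def m'_def)
  have iso: "stabilizing_iso sR sQ m m' (shift \<omega> [:\<beta>:]) \<longleftrightarrow> flag_equiv_via sR pr V d d' \<omega> \<beta>" if "\<beta> \<noteq> 0" for \<omega> \<beta>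
    using shift_hom_iff[OF fm fp that, of \<omega>] bij_shift[OF that] linear_shift shift_R
    by (simp add: stabilizing_iso_def module_hom_semilinear mods)
  have form: "\<exists>\<omega> \<beta>. \<beta> \<noteq> 0 \<and> \<phi> = shift \<omega> [:\<beta>:]" if "stabilizing_iso sR sQ m m' \<phi>" for \<phi>
    using that stabilizing_shift by (simp add: stabilizing_iso_def module_hom_semilinear mods)
  have "(\<exists>\<omega> \<beta>. \<beta> \<noteq> 0 \<and> flag_equiv_via sR pr V d d' \<omega> \<beta>) \<longleftrightarrow> (\<exists>\<phi>. stabilizing_iso sR sQ m m' \<phi>)"
    using iso form by metis
  then show "(d, d') \<in> flag_eq sR pr V \<longleftrightarrow> (m, m') \<in> cext_eq sR pr sQ"
    using d d' ext by (simp add: flag_eq_def cext_eq_def)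
  have "(\<exists>\<omega>. flag_equiv_via sR pr V d d' \<omega> 1) \<longleftrightarrow> (\<exists>\<phi>. stabilizing_iso sR sQ m m' \<phi> \<and> snd \<circ> \<phi> = snd)"
    using iso form snd_shift by (metis one_neq_zero)
  then show "(d, d') \<in> flag_approx sR pr V \<longleftrightarrow> (m, m') \<in> cext_approx sR pr sQ"
    using d d' ext by (simp add: flag_approx_def cext_approx_def)
qed

text \<open>
  Isomorphism and co-stabilizing isomorphism of extensions are the two instances of \<open>s\<close>.
\<close>

lemma classification:
  assumes s: "equiv (extensions sR pr sQ) s"
    and e: "e = {(\<Omega>, \<Omega>'). \<Omega> \<in> ext_structures sR pr sQ \<and> \<Omega>' \<in> ext_structures sR pr sQ \<and>
      (natural_prod sR pr sQ \<Omega>, natural_prod sR pr sQ \<Omega>') \<in> s}"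
    and f: "f = {(d, d'). d \<in> FLC sR pr V \<and> d' \<in> FLC sR pr V \<and> (LC sR pr V sQ x d, LC sR pr V sQ x d') \<in> s}"
  shows "equiv (FLC sR pr V) f
       \<and> (\<exists>F. bij_betw F (ext_structures sR pr sQ // e) (extensions sR pr sQ // s)
            \<and> (\<forall>\<Omega> \<in> ext_structures sR pr sQ. F (e `` {\<Omega>}) = s `` {natural_prod sR pr sQ \<Omega>}))
       \<and> (\<exists>G. bij_betw G (ext_structures sR pr sQ // e) (FLC sR pr V // f))
       \<and> (\<exists>K. bij_betw K (FLC sR pr V // f) (extensions sR pr sQ // s)
            \<and> (\<forall>d \<in> FLC sR pr V. K (f `` {d}) = s `` {LC sR pr V sQ x d}))"
proof -
  note E = bij_betw_quotients(2)[OF s natural_prod_image e] and F = bij_betw_quotients[OF s LC_image f]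
  have "\<exists>G. bij_betw G (ext_structures sR pr sQ // e) (FLC sR pr V // f)"
    using E F(2) by (meson bij_betw_trans bij_betw_inv_into)
  with E F show ?thesis by blast
qed

end

theorem theorem4p3:
  fixes sR :: "complex poly \<Rightarrow> 'r::ab_group_add \<Rightarrow> 'r"
    and pr :: "'r \<Rightarrow> 'r \<Rightarrow> 'r poly"
    and V :: "'r set"
    and sQ :: "complex poly \<Rightarrow> 'q::ab_group_add \<Rightarrow> 'q"
    and x :: 'q
  assumes "lsc_algebra sR pr"
    and "freely_generated_by sR V"
    and "\<exists>a::'r. a \<noteq> 0"
    and "free_rank_one sQ x"
  shows "(\<forall>d \<in> FLC sR pr V. \<exists>!m. is_LC sR pr V sQ x d m)
    \<and> (equiv (FLC sR pr V) (flag_eq sR pr V)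
       \<and> (\<exists>F. bij_betw F (H2R sR pr sQ) (CExtd sR pr sQ)
            \<and> (\<forall>\<Omega> \<in> ext_structures sR pr sQ.
                 F (ext_eq sR pr sQ `` {\<Omega>}) = cext_eq sR pr sQ `` {natural_prod sR pr sQ \<Omega>}))
       \<and> (\<exists>G. bij_betw G (H2R sR pr sQ) (FLC sR pr V // flag_eq sR pr V))
       \<and> (\<exists>K. bij_betw K (FLC sR pr V // flag_eq sR pr V) (CExtd sR pr sQ)
            \<and> (\<forall>d \<in> FLC sR pr V.
                 K (flag_eq sR pr V `` {d}) = cext_eq sR pr sQ `` {LC sR pr V sQ x d})))
    \<and> (equiv (FLC sR pr V) (flag_approx sR pr V)
       \<and> (\<exists>F. bij_betw F (H2 sR pr sQ) (CExtd' sR pr sQ)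
            \<and> (\<forall>\<Omega> \<in> ext_structures sR pr sQ.
                 F (ext_approx sR pr sQ `` {\<Omega>}) = cext_approx sR pr sQ `` {natural_prod sR pr sQ \<Omega>}))
       \<and> (\<exists>G. bij_betw G (H2 sR pr sQ) (FLC sR pr V // flag_approx sR pr V))
       \<and> (\<exists>K. bij_betw K (FLC sR pr V // flag_approx sR pr V) (CExtd' sR pr sQ)
            \<and> (\<forall>d \<in> FLC sR pr V.
                 K (flag_approx sR pr V `` {d}) = cext_approx sR pr sQ `` {LC sR pr V sQ x d})))"
proof -
  interpret flag_extension sR pr sQ V x
    using assms(1,2,4)
    by (simp add: flag_extension_def module_pair_def flag_extension_axioms_def free_rank_one_def)
  have "ext_eq sR pr sQ \<subseteq> ext_structures sR pr sQ \<times> ext_structures sR pr sQ"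
    "ext_approx sR pr sQ \<subseteq> ext_structures sR pr sQ \<times> ext_structures sR pr sQ"
    by (auto simp: ext_eq_def ext_approx_def)
  then have e: "ext_eq sR pr sQ = {(\<Omega>, \<Omega>'). \<Omega> \<in> ext_structures sR pr sQ \<and> \<Omega>' \<in> ext_structures sR pr sQ \<and>
      (natural_prod sR pr sQ \<Omega>, natural_prod sR pr sQ \<Omega>') \<in> cext_eq sR pr sQ}"
    and e': "ext_approx sR pr sQ = {(\<Omega>, \<Omega>'). \<Omega> \<in> ext_structures sR pr sQ \<and> \<Omega>' \<in> ext_structures sR pr sQ \<and>
      (natural_prod sR pr sQ \<Omega>, natural_prod sR pr sQ \<Omega>') \<in> cext_approx sR pr sQ}"
    using ext_rel_iff by blast+
  have "flag_eq sR pr V \<subseteq> FLC sR pr V \<times> FLC sR pr V" "flag_approx sR pr V \<subseteq> FLC sR pr V \<times> FLC sR pr V"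
    by (auto simp: flag_eq_def flag_approx_def)
  then have f: "flag_eq sR pr V = {(d, d'). d \<in> FLC sR pr V \<and> d' \<in> FLC sR pr V \<and>
      (LC sR pr V sQ x d, LC sR pr V sQ x d') \<in> cext_eq sR pr sQ}"
    and f': "flag_approx sR pr V = {(d, d'). d \<in> FLC sR pr V \<and> d' \<in> FLC sR pr V \<and>
      (LC sR pr V sQ x d, LC sR pr V sQ x d') \<in> cext_approx sR pr sQ}"
    using flag_rel_iff by blast+
  show ?thesis
    unfolding H2R_def H2_def CExtd_def CExtd'_def
    by (rule conjI[OF ballI[OF LC_props(1)]
        conjI[OF classification[OF equiv_cext(1) e f] classification[OF equiv_cext(2) e' f']]])
qed

end
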